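(* Let $k,b$ be positive integers such that either $k\ge 4$, or $k=3$ and $b\ge 2$. Let $H$ be a graph for which there exists a subgraph $H'\subseteq H$ with $d_1(H')=m_1(H)$ and either $H'=K_k$ or $H'=C_k$. Then there exist constants $c,C>0$ such that, for $G\sim G(n,p)$, $$\lim_{n\to\infty}\Pr\left[G \text{ is Maker's win in the } (1:b) \text{ Maker-Breaker vertex } H\text{-game}\right]=\begin{cases}1 & p\ge Cn^{-1/m_1(H)},\\ 0 & p\le cn^{-1/m_1(H)}.\end{cases}$$
   Context: For a graph $F$, $v(F)=|V(F)|$, $e(F)=|E(F)|$. For a graph $F$ with $v(F)\ge 2$, the 1-density is $d_1(F)=\frac{e(F)}{v(F)-1}$, and the maximum 1-density is $m_1(F)=\max\{d_1(F')\,:\,F'\subseteq F,\ v(F')\ge 2\}$. $G(n,p)$ is the binomial random graph on $n$ vertices, each edge present independently with probability $p$. For graphs $G,H$ and a positive integer $b$, the $(1:b)$ Maker-Breaker vertex $H$-game on $G$ is played as follows: Maker and Breaker alternately claim previously unclaimed vertices of $G$, Maker claiming one vertex per turn and Breaker claiming $b$ vertices per turn (the last player may claim fewer if not enough free vertices remain), until all vertices are claimed. Maker wins if the subgraph of $G$ induced by the set of vertices he claimed contains a (not necessarily induced) copy of $H$; otherwise Breaker wins. "$G$ is Maker's win" means Maker has a winning strategy (the statement holds with either player moving first). *)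

theory Defs
  imports Complex_Main
begin

definition graph :: "'a set \<Rightarrow> 'a set set \<Rightarrow> bool" where
  "graph V E \<longleftrightarrow> finite V \<and> (\<forall>e\<in>E. e \<subseteq> V \<and> card e = 2)"

definition subgraph :: "'a set \<Rightarrow> 'a set set \<Rightarrow> 'a set \<Rightarrow> 'a set set \<Rightarrow> bool" where
  "subgraph V' E' V E \<longleftrightarrow> V' \<subseteq> V \<and> E' \<subseteq> E \<and> (\<forall>e\<in>E'. e \<subseteq> V')"

definition d1 :: "'a set \<Rightarrow> 'a set set \<Rightarrow> real" where
  "d1 V E = real (card E) / (real (card V) - 1)"

definition m1 :: "'a set \<Rightarrow> 'a set set \<Rightarrow> real" where
  "m1 V E = Max {d1 V' E' | V' E'. subgraph V' E' V E \<and> card V' \<ge> 2}"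

definition is_complete :: "nat \<Rightarrow> 'a set \<Rightarrow> 'a set set \<Rightarrow> bool" where
  "is_complete k V E \<longleftrightarrow> finite V \<and> card V = k \<and> E = {e. e \<subseteq> V \<and> card e = 2}"

definition is_cycle :: "nat \<Rightarrow> 'a set \<Rightarrow> 'a set set \<Rightarrow> bool" where
  "is_cycle k V E \<longleftrightarrow> (\<exists>f. bij_betw f {0..<k} V \<and>
      E = {{f i, f ((i + 1) mod k)} | i. i < k})"

definition contains_copy :: "'b set \<Rightarrow> 'b set set \<Rightarrow> 'a set \<Rightarrow> 'a set set \<Rightarrow> bool" where
  "contains_copy M E VH EH \<longleftrightarrow>
     (\<exists>f. inj_on f VH \<and> f ` VH \<subseteq> M \<and> (\<forall>e\<in>EH. f ` e \<in> E))"

text \<open>Maker-Breaker vertex game on vertex set V with Maker's winning condition W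
  (a predicate on Maker's final set), bias b.
  mb_win fuel maker_to_move V W b M B: Maker (having claimed M, Breaker having
  claimed B) can force a win. A turn with free vertices always claims at least one
  vertex, so fuel = card V suffices for the whole game.\<close>
fun mb_win :: "nat \<Rightarrow> bool \<Rightarrow> 'v set \<Rightarrow> ('v set \<Rightarrow> bool) \<Rightarrow> nat \<Rightarrow> 'v set \<Rightarrow> 'v set \<Rightarrow> bool" where
  "mb_win 0 mt V W b M B = W M"
| "mb_win (Suc n) mt V W b M B =
     (if V - (M \<union> B) = {} then W M
      else if mt then (\<exists>v \<in> V - (M \<union> B). mb_win n False V W b (insert v M) B)
      else (\<forall>S. S \<subseteq> V - (M \<union> B) \<and> card S = min b (card (V - (M \<union> B)))
                 \<longrightarrow> mb_win n True V W b M (B \<union> S)))"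

definition maker_win :: "bool \<Rightarrow> nat \<Rightarrow> 'b set \<Rightarrow> 'b set set \<Rightarrow> 'a set \<Rightarrow> 'a set set \<Rightarrow> bool" where
  "maker_win maker_first b V E VH EH =
     mb_win (card V) maker_first V (\<lambda>M. contains_copy M E VH EH) b {} {}"

definition all_edges :: "nat \<Rightarrow> nat set set" where
  "all_edges n = {e. e \<subseteq> {0..<n} \<and> card e = 2}"

definition Gnp_prob :: "nat \<Rightarrow> real \<Rightarrow> (nat set set \<Rightarrow> bool) \<Rightarrow> real" where
  "Gnp_prob n p P = (\<Sum>E \<in> Pow (all_edges n).
      if P E then p ^ card E * (1 - p) ^ (card (all_edges n) - card E) else 0)"

end

theory Submission
  imports Defs "HOL-Real_Asymp.Real_Asymp" "HOL-Library.FuncSet"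
begin

text \<open>
  Above the threshold Maker need not think: he ends up with a set of linear size, and by Janson's
  inequality and a union bound over all vertex sets, whp every set of linear size spans a copy of \<open>H\<close>.

  Below the threshold Breaker prevents the copies of \<open>H' = K\<^sub>k\<close> or \<open>C\<^sub>k\<close>, where \<open>H'\<close> has \<open>h\<close> edges. Link two
  copies if they share a vertex. \<open>H'\<close> is strictly balanced for the 1-density, so attaching a copy to a union
  of copies never increases \<open>h v - (k - 1) e\<close>, and leaves it unchanged only if they share
  a single vertex. A first-moment bound along a breadth-first exploration shows that whp every component
  satisfies \<open>h v \<ge> (k - 1) e\<close>, i.e. it is a hypertree of copies up to boundedly many degenerate attachments.
  In such a component one can choose pairs of vertices such that every copy contains a pair and every vertex
  lies in at most one pair (two if \<open>k = 3\<close>, where \<open>b \<ge> 2\<close>); whenever Maker takes a vertex, Breaker takes its partners.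
  For cycles the pairs come from an ear decomposition, for cliques from adding the copies in a suitable order.
\<close>

text \<open>The capacity per vertex is a number c <= b, with c = 1 for k >= 4 and c = 2 for k = 3.
  Two inequalities tie it to k. The first, c + 1 < (k - 1) c, says that reservations of total c + 1
  cannot exhaust all but one vertex of a copy. The second, 2 k < (k - 1) (c + 2), says that the
  potential which a sparse component can spend on ears buys a deficit of at most c + 1. For c = 1
  both mean k >= 4, for c = 2 both hold from k = 3 on. The obstacle on Breaker's side is that adding
  edges may complete copies other than the one being attached. For cycles every such copy runs
  through the whole ear, so one pair inside the ear serves them all. For cliques one new edge
  between old vertices may complete several cliques, and a \<open>K_{k+1}\<close> spends the whole
  potential at once. Hence the order of attachment starts from the worst configuration present: a
  \<open>K_{k+1}\<close>, else two cliques sharing at least two vertices, else any clique. Each of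
  the three starts leaves a total deficit of at most 2 = c + 1.\<close>

section \<open>Harris and Janson inequalities for random subsets\<close>

text \<open>The expectation over a random subset that contains each element of \<open>S\<close>
  independently with probability \<open>p\<close>. It is a polynomial in \<open>p\<close>, so
  identities hold for every real \<open>p\<close> and only inequalities ask for 0 <= p <= 1.\<close>

definition bexp :: "'e set \<Rightarrow> real \<Rightarrow> ('e set \<Rightarrow> real) \<Rightarrow> real" where
  "bexp S p F = (\<Sum>E\<in>Pow S. p ^ card E * (1 - p) ^ (card S - card E) * F E)"

lemma bexp_empty [simp]: "bexp {} p F = F {}"
  by (simp add: bexp_def)

text \<open>Conditioning on the presence of \<open>e\<close>; inductions on the ground set rest on
  it.\<close>

lemma bexp_insert:
  assumes "finite S" "e \<notin> S"
  shows "bexp (insert e S) p F =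
    p * bexp S p (\<lambda>E. F (insert e E)) + (1 - p) * bexp S p F"
proof -
  let ?w = "\<lambda>E. p ^ card E * (1 - p) ^ (card (insert e S) - card E) * F E"
  have inj: "inj_on (insert e) (Pow S)"
    using assms by (auto simp: inj_on_def)
  have disj: "Pow S \<inter> insert e ` Pow S = {}" using assms by auto
  have "bexp (insert e S) p F = sum ?w (Pow S) + sum ?w (insert e ` Pow S)"
    unfolding bexp_def Pow_insert
    by (rule sum.union_disjoint) (use assms disj in auto)
  also have "sum ?w (insert e ` Pow S) = p * bexp S p (\<lambda>E. F (insert e E))"
    unfolding bexp_def sum_distrib_left
    apply (subst sum.reindex[OF inj])
    apply (rule sum.cong)
    using assms apply (auto simp: card_insert_if)
    by (metis (no_types, lifting) card_insert_disjoint finite_subset subsetD mult.assoc power_Suc diff_Suc_Suc)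
  also have "sum ?w (Pow S) = (1 - p) * bexp S p F"
    unfolding bexp_def sum_distrib_left
  proof (rule sum.cong)
    fix E assume "E \<in> Pow S"
    then have "card E \<le> card S" using assms by (simp add: card_mono)
    then have "card (insert e S) - card E = Suc (card S - card E)" using assms by simp
    then show "?w E = (1 - p) * (p ^ card E * (1 - p) ^ (card S - card E) * F E)" by simp
  qed simp
  finally show ?thesis by simp
qed

lemma bexp_const [simp]: "finite S \<Longrightarrow> bexp S p (\<lambda>_. a) = a"
  by (induction S rule: finite_induct) (simp_all add: bexp_insert algebra_simps)

lemma bexp_add: "bexp S p (\<lambda>E. F E + G E) = bexp S p F + bexp S p G"
  by (simp add: bexp_def algebra_simps sum.distrib)

lemma bexp_cmult: "bexp S p (\<lambda>E. a * F E) = a * bexp S p F"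
  by (simp add: bexp_def algebra_simps sum_distrib_left)

lemma bexp_sum: "bexp S p (\<lambda>E. \<Sum>i\<in>I. F i E) = (\<Sum>i\<in>I. bexp S p (F i))"
  unfolding bexp_def sum_distrib_left by (rule sum.swap)

lemma bexp_mono:
  assumes "0 \<le> p" "p \<le> 1" "\<And>E. E \<subseteq> S \<Longrightarrow> F E \<le> G E"
  shows "bexp S p F \<le> bexp S p G"
  unfolding bexp_def
  by (intro sum_mono mult_left_mono) (use assms in auto)

lemma bexp_cong:
  assumes "\<And>E. E \<subseteq> S \<Longrightarrow> F E = G E"
  shows "bexp S p F = bexp S p G"
  unfolding bexp_def by (intro sum.cong) (use assms in auto)

lemma bexp_nonneg:
  assumes "0 \<le> p" "p \<le> 1" "\<And>E. E \<subseteq> S \<Longrightarrow> 0 \<le> F E"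
  shows "0 \<le> bexp S p F"
  unfolding bexp_def
  by (intro sum_nonneg mult_nonneg_nonneg) (use assms in auto)

text \<open>Independence: given that \<open>A\<close> is present, the other elements keep their law.
  Working with \<open>E \<union> A\<close> instead of a conditional law avoids division by a
  probability that may be zero.\<close>

lemma bexp_superset:
  assumes "finite S" "A \<subseteq> S"
  shows "bexp S p (\<lambda>E. if A \<subseteq> E then F E else 0) =
    p ^ card A * bexp S p (\<lambda>E. F (E \<union> A))"
  using assms
proof (induction S arbitrary: A F rule: finite_induct)
  case empty
  then show ?case by simp
next
  case (insert e S)
  show ?case
  proof (cases "e \<in> A")
    case True
    define B where "B = A - {e}"
    have B: "A = insert e B" "e \<notin> B" "B \<subseteq> S" using True insert.prems B_def by auto
    have fB: "finite B" using B insert finite_subset by auto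
    have "bexp S p (\<lambda>E. if A \<subseteq> E then F E else 0) = bexp S p (\<lambda>E. 0)"
      by (rule bexp_cong) (use B insert in auto)
    then have 0: "bexp S p (\<lambda>E. if A \<subseteq> E then F E else 0) = 0"
      using insert by simp
    have 1: "bexp S p (\<lambda>E. if A \<subseteq> insert e E then F (insert e E) else 0)
      = bexp S p (\<lambda>E. if B \<subseteq> E then F (insert e E) else 0)"
      by (rule bexp_cong) (use B insert in auto)
    show ?thesis
      unfolding bexp_insert[OF insert.hyps] 0 1 insert.IH[OF B(3)]
      using B fB insert by (simp add: algebra_simps insert_absorb)
  next
    case False
    then have A: "A \<subseteq> S" using insert.prems by auto
    have 1: "bexp S p (\<lambda>E. if A \<subseteq> insert e E then F (insert e E) else 0)
      = bexp S p (\<lambda>E. if A \<subseteq> E then F (insert e E) else 0)"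
      by (rule bexp_cong) (use False in auto)
    show ?thesis
      unfolding bexp_insert[OF insert.hyps] 1 insert.IH[OF A]
      by (simp add: algebra_simps)
  qed
qed

text \<open>Condition on one element. Both conditional means drop when it is added, so their
  covariance over the two outcomes is nonnegative; the induction hypothesis treats each
  outcome.\<close>

lemma Harris:
  fixes F G :: "'e set \<Rightarrow> real"
  assumes "finite S" "0 \<le> p" "p \<le> 1"
    and "antimono F" "antimono G"
  shows "bexp S p F * bexp S p G \<le> bexp S p (\<lambda>E. F E * G E)"
  using assms(1,4,5)
proof (induction S arbitrary: F G rule: finite_induct)
  case empty
  then show ?case by simp
next
  case (insert e S)
  let ?F = "\<lambda>E. F (insert e E)" and ?G = "\<lambda>E. G (insert e E)"
  have anti: "antimono ?F" "antimono ?G"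
    using insert.prems unfolding antimono_def by (meson insert_mono)+
  have le: "bexp S p ?F \<le> bexp S p F" "bexp S p ?G \<le> bexp S p G"
    using insert.prems assms(2,3) by (auto intro!: bexp_mono simp: antimono_def subset_insertI)
  have "0 \<le> p * (1 - p) * ((bexp S p F - bexp S p ?F) * (bexp S p G - bexp S p ?G))"
    using le assms by (intro mult_nonneg_nonneg) auto
  then have "(p * bexp S p ?F + (1 - p) * bexp S p F) * (p * bexp S p ?G + (1 - p) * bexp S p G)
     \<le> p * (bexp S p ?F * bexp S p ?G) + (1 - p) * (bexp S p F * bexp S p G)"
    by (simp add: algebra_simps)
  also have "\<dots> \<le> p * bexp S p (\<lambda>E. ?F E * ?G E) + (1 - p) * bexp S p (\<lambda>E. F E * G E)"
    using insert.IH[OF insert.prems] insert.IH[OF anti] assms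
    by (intro add_mono mult_left_mono) auto
  finally show ?case unfolding bexp_insert[OF insert.hyps] .
qed

text \<open>The Laplace transform \<open>\<psi>\<close> of the number of sets \<open>A i\<close>
  inside the random set satisfies a linear differential inequality, and integrating it from 0 bounds
  the probability that none occurs. \<open>\<Delta>\<close> runs over ordered pairs including i = j,
  and \<open>t\<close> stays free so that it can be optimised later.\<close>

lemma Janson:
  fixes A :: "'i \<Rightarrow> 'e set" and t :: real
  assumes S: "finite S" and I: "finite I" and AS: "\<And>i. i \<in> I \<Longrightarrow> A i \<subseteq> S"
    and p: "0 \<le> p" "p \<le> 1" and t: "0 \<le> t"
    and mu: "\<mu> = (\<Sum>i\<in>I. p ^ card (A i))"
    and De: "\<Delta> = (\<Sum>i\<in>I. \<Sum>j\<in>{j\<in>I. A i \<inter> A j \<noteq> {}}. p ^ card (A i \<union> A j))"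
  shows "bexp S p (\<lambda>E. if \<exists>i\<in>I. A i \<subseteq> E then 0 else 1) \<le> exp (\<Delta> * t\<^sup>2 / 2 - \<mu> * t)"
proof -
  define X where "X J E = (\<Sum>j\<in>J. if A j \<subseteq> E then 1 else 0 :: real)" for J E
  define \<psi> where "\<psi> t = bexp S p (\<lambda>E. exp (- t * X I E))" for t
  define \<psi>' where "\<psi>' t = bexp S p (\<lambda>E. - (X I E * exp (- t * X I E)))" for t
  have psi_pos: "0 \<le> \<psi> t" for t unfolding \<psi>_def by (intro bexp_nonneg p) auto
  have der: "(\<psi> has_real_derivative \<psi>' t) (at t)" for t
    unfolding \<psi>_def \<psi>'_def bexp_def
    by (auto intro!: derivative_eq_intros sum.cong simp: algebra_simps)
  have Xmono: "X J E \<le> X J E'" if "E \<subseteq> E'" for J E E'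
    unfolding X_def using that by (intro sum_mono) auto
  have anti: "antimono (\<lambda>E. exp (- t * X J (E \<union> B)))" if "0 \<le> t" for t J B
    unfolding antimono_def using that by (auto intro!: mult_left_mono Xmono)
  have anti0: "antimono (\<lambda>E. exp (- t * X J E))" if "0 \<le> t" for t J
    unfolding antimono_def using that by (auto intro!: mult_left_mono Xmono)
  have key: "\<psi>' t \<le> (\<Delta> * t - \<mu>) * \<psi> t" if t: "0 \<le> t" for t
  proof -
    have one: "p ^ card (A i) * \<psi> t - t * \<psi> t * (\<Sum>j\<in>{j\<in>I. A i \<inter> A j \<noteq> {}}. p ^ card (A i \<union> A j))
       \<le> bexp S p (\<lambda>E. if A i \<subseteq> E then exp (- t * X I E) else 0)" if i: "i \<in> I" for i
    proof -
      \<comment> \<open>Forcing \<open>A i\<close> to be present affects only the sets in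
        \<open>?D\<close>. Harris separates them from \<open>?N\<close>, and exp(-x) >= 1 - x
        linearises their contribution.\<close>
      let ?D = "{j\<in>I. A i \<inter> A j \<noteq> {}}" and ?N = "{j\<in>I. A i \<inter> A j = {}}"
      have split: "X I E = X ?D E + X ?N E" for E
        unfolding X_def using I
        by (subst sum.union_disjoint[symmetric]) (auto intro!: sum.cong)
      have N: "X ?N (E \<union> A i) = X ?N E" for E
        unfolding X_def by (rule sum.cong) auto
      have EY: "p ^ card (A i) * bexp S p (\<lambda>E. X ?D (E \<union> A i)) = (\<Sum>j\<in>?D. p ^ card (A i \<union> A j))"
      proof -
        have "p ^ card (A i) * bexp S p (\<lambda>E. X ?D (E \<union> A i)) = bexp S p (\<lambda>E. if A i \<subseteq> E then X ?D E else 0)"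
          using bexp_superset[OF S AS[OF i]] by simp
        also have "\<dots> = bexp S p (\<lambda>E. \<Sum>j\<in>?D. if A i \<union> A j \<subseteq> E then 1 else 0)"
          unfolding X_def by (rule bexp_cong) (auto intro!: sum.cong)
        also have "\<dots> = (\<Sum>j\<in>?D. bexp S p (\<lambda>E. if A i \<union> A j \<subseteq> E then 1 else 0))"
          by (rule bexp_sum)
        also have "\<dots> = (\<Sum>j\<in>?D. p ^ card (A i \<union> A j))"
          using AS i S by (intro sum.cong refl) (subst bexp_superset, auto)
        finally show ?thesis .
      qed
      have "X ?N E \<le> X I E" for E
        unfolding X_def by (rule sum_mono2) (use I in auto)
      then have "\<psi> t \<le> bexp S p (\<lambda>E. exp (- t * X ?N E))"
        unfolding \<psi>_def by (intro bexp_mono[OF p]) (use t in \<open>auto intro!: mult_left_mono\<close>)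
      moreover have "1 - t * bexp S p (\<lambda>E. X ?D (E \<union> A i)) \<le> bexp S p (\<lambda>E. exp (- t * X ?D (E \<union> A i)))"
      proof -
        have "1 - t * bexp S p (\<lambda>E. X ?D (E \<union> A i)) = bexp S p (\<lambda>E. 1 + (- t) * X ?D (E \<union> A i))"
          unfolding bexp_add bexp_cmult using S by simp
        also have "\<dots> \<le> bexp S p (\<lambda>E. exp (- t * X ?D (E \<union> A i)))"
          by (rule bexp_mono[OF p]) (rule exp_ge_add_one_self)
        finally show ?thesis .
      qed
      ultimately have "(1 - t * bexp S p (\<lambda>E. X ?D (E \<union> A i))) * \<psi> t
          \<le> bexp S p (\<lambda>E. exp (- t * X ?D (E \<union> A i))) * bexp S p (\<lambda>E. exp (- t * X ?N E))"
        by (intro order_trans[OF mult_right_mono[OF _ psi_pos] mult_left_mono] bexp_nonneg p) auto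
      also have "\<dots> \<le> bexp S p (\<lambda>E. exp (- t * X ?D (E \<union> A i)) * exp (- t * X ?N E))"
        by (rule Harris[OF S p anti[OF t] anti0[OF t]])
      also have "\<dots> = bexp S p (\<lambda>E. exp (- t * X I (E \<union> A i)))"
        unfolding split N by (simp add: exp_add[symmetric] algebra_simps)
      finally have "p ^ card (A i) * ((1 - t * bexp S p (\<lambda>E. X ?D (E \<union> A i))) * \<psi> t)
          \<le> p ^ card (A i) * bexp S p (\<lambda>E. exp (- t * X I (E \<union> A i)))"
        using p by (intro mult_left_mono) auto
      then show ?thesis
        unfolding bexp_superset[OF S AS[OF i]] EY[symmetric] by (simp add: algebra_simps)
    qed
    have "\<psi>' t = - (\<Sum>i\<in>I. bexp S p (\<lambda>E. if A i \<subseteq> E then exp (- t * X I E) else 0))"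
    proof -
      have "\<psi>' t = - 1 * bexp S p (\<lambda>E. \<Sum>i\<in>I. if A i \<subseteq> E then exp (- t * X I E) else 0)"
        unfolding \<psi>'_def bexp_cmult[symmetric]
        by (rule bexp_cong) (auto simp: X_def sum_distrib_right intro!: sum.cong)
      then show ?thesis unfolding bexp_sum by simp
    qed
    also have "\<dots> \<le> - (\<Sum>i\<in>I. p ^ card (A i) * \<psi> t - t * \<psi> t * (\<Sum>j\<in>{j\<in>I. A i \<inter> A j \<noteq> {}}. p ^ card (A i \<union> A j)))"
      using one by (simp add: sum_mono)
    also have "\<dots> = (\<Delta> * t - \<mu>) * \<psi> t"
      unfolding mu De by (simp add: sum_subtractf sum_distrib_left[symmetric] sum_distrib_right[symmetric] algebra_simps)
    finally show ?thesis .
  qed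
  \<comment> \<open>Integrating factor for the inequality \<open>key\<close>: as \<open>h\<close>
    does not increase from its value 1 at 0, it yields the bound on \<open>\<psi>\<close>.\<close>
  define h where "h t = \<psi> t * exp (\<mu> * t - \<Delta> * t\<^sup>2 / 2)" for t
  have "h t \<le> h 0"
  proof (rule DERIV_nonpos_imp_nonincreasing[OF t])
    fix x assume x: "0 \<le> x" "x \<le> t"
    let ?e = "exp (\<mu> * x - \<Delta> * x\<^sup>2 / 2)"
    have "(h has_real_derivative (\<psi>' x - (\<Delta> * x - \<mu>) * \<psi> x) * ?e) (at x)"
      unfolding h_def by (auto intro!: derivative_eq_intros der simp: algebra_simps)
    moreover have "(\<psi>' x - (\<Delta> * x - \<mu>) * \<psi> x) * ?e \<le> 0"
      using key[OF x(1)] by (intro mult_nonpos_nonneg) auto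
    ultimately show "\<exists>y. (h has_real_derivative y) (at x) \<and> y \<le> 0" by blast
  qed
  also have "h 0 = 1" unfolding h_def \<psi>_def using S by simp
  finally have "\<psi> t \<le> exp (\<Delta> * t\<^sup>2 / 2 - \<mu> * t)"
    unfolding h_def by (simp add: exp_diff pos_le_divide_eq pos_divide_le_eq)
  moreover have "bexp S p (\<lambda>E. if \<exists>i\<in>I. A i \<subseteq> E then 0 else 1) \<le> \<psi> t"
    unfolding \<psi>_def
  proof (rule bexp_mono[OF p])
    fix E
    show "(if \<exists>i\<in>I. A i \<subseteq> E then 0 else 1) \<le> exp (- t * X I E)"
    proof (cases "\<exists>i\<in>I. A i \<subseteq> E")
      case False
      then have "X I E = 0" unfolding X_def by (intro sum.neutral) auto
      then show ?thesis using False by simp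
    qed simp
  qed
  ultimately show ?thesis by linarith
qed

section \<open>Two game criteria\<close>

text \<open>Arbitrary play suffices: Breaker gains at most \<open>b\<close> vertices per turn, so
  the inequality between \<open>card B\<close> and \<open>card M\<close> is invariant. The extra
  \<open>b\<close> covers a Breaker turn not yet answered, which makes the bound valid for both
  orders of play.\<close>

lemma mb_win_if_large_sets_win:
  assumes "finite V" and bpos: "b > 0" and "M \<subseteq> V" "B \<subseteq> V" "M \<inter> B = {}"
    and "card B \<le> b * (card M + (if mt then 1 else 0))"
    and "card (V - (M \<union> B)) \<le> n"
    and W: "\<And>M. M \<subseteq> V \<Longrightarrow> card V \<le> (b + 1) * card M + b \<Longrightarrow> W M"
  shows "mb_win n mt V W b M B"
  using assms(3-7)
proof (induction n arbitrary: mt M B)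
  case 0
  have fin: "finite M" "finite B" using 0(1,2) assms(1) finite_subset by blast+
  have "V = M \<union> B" using 0(1,2,5) assms(1) by auto
  then have "card V = card M + card B" using 0(3) fin by (simp add: card_Un_disjoint)
  then have "W M" using 0 by (intro W) (auto simp: algebra_simps split: if_splits)
  then show ?case by simp
next
  case (Suc n)
  have fin: "finite M" "finite B" using Suc.prems(1,2) assms(1) finite_subset by blast+
  let ?F = "V - (M \<union> B)"
  have finF: "finite ?F" using assms(1) by simp
  show ?case
  proof (cases "?F = {}")
    case True
    have "V = M \<union> B" using Suc.prems True by auto
    then have "card V = card M + card B" using Suc.prems(3) fin by (simp add: card_Un_disjoint)
    then have "W M" using Suc.prems by (intro W) (auto simp: algebra_simps split: if_splits)
    then show ?thesis using True by simp
  next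
    case False
    show ?thesis
    proof (cases mt)
      case True
      obtain v where v: "v \<in> ?F" using False by blast
      have "V - (insert v M \<union> B) = ?F - {v}" by auto
      then have "card (V - (insert v M \<union> B)) \<le> n"
        using v finF Suc.prems(5) by (simp add: card_Diff_singleton)
      moreover have "card B \<le> b * (card (insert v M) + (if False then 1 else 0))"
        using Suc.prems(4) True v fin by (simp add: card_insert_if)
      moreover have "insert v M \<subseteq> V" "insert v M \<inter> B = {}" using Suc.prems v by auto
      ultimately have "mb_win n False V W b (insert v M) B"
        using Suc.prems(2) by (intro Suc.IH)
      then show ?thesis unfolding mb_win.simps using v True False by metis
    next
      case F: False
      have "mb_win n True V W b M (B \<union> S)" if S: "S \<subseteq> ?F" "card S = min b (card ?F)" for S
      proof -
        have fS: "finite S" using S finF finite_subset by blast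
        have cB: "card (B \<union> S) = card B + card S"
          using S fS fin by (subst card_Un_disjoint) auto
        have "V - (M \<union> (B \<union> S)) = ?F - S" by auto
        then have c: "card (V - (M \<union> (B \<union> S))) = card ?F - card S"
          using S fS by (simp add: card_Diff_subset)
        have 1: "card S \<ge> 1" using S \<open>?F \<noteq> {}\<close> finF bpos by (simp add: Suc_leI card_gt_0_iff min_def)
        have "card S \<le> b" using S by simp
        show ?thesis
        proof (rule Suc.IH)
          show "M \<subseteq> V" "B \<union> S \<subseteq> V" "M \<inter> (B \<union> S) = {}" using Suc.prems S by auto
          show "card (B \<union> S) \<le> b * (card M + (if True then 1 else 0))"
            using Suc.prems(4) F cB \<open>card S \<le> b\<close> by (simp add: algebra_simps)
          show "card (V - (M \<union> (B \<union> S))) \<le> n" using c 1 Suc.prems(5) by linarith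
        qed
      qed
      then show ?thesis unfolding mb_win.simps using False F by metis
    qed
  qed
qed

text \<open>Before Maker's turn every pair touched by Maker also meets \<open>B\<close>; before
  Breaker's turn at most \<open>b\<close> free vertices lie in pairs touched by Maker, and Breaker
  claims all of them. No pair is ever contained in \<open>M\<close>, so the conclusion holds for any
  fuel \<open>n\<close>.\<close>

lemma pairing_strategy:
  fixes D :: "'v set set"
  assumes "finite V"
    and D2: "\<And>e. e \<in> D \<Longrightarrow> card e = 2"
    and deg: "\<And>v. card {e\<in>D. v \<in> e} \<le> b" and fin: "finite D"
    and W: "\<And>M. M \<subseteq> V \<Longrightarrow> W M \<Longrightarrow> \<exists>e\<in>D. e \<subseteq> M"
    and "M \<subseteq> V" "M \<inter> B = {}"
    and "\<And>e. e \<in> D \<Longrightarrow> \<not> e \<subseteq> M"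
    and "if mt then (\<forall>e\<in>D. e \<inter> M \<noteq> {} \<longrightarrow> e \<inter> B \<noteq> {})
         else card {y \<in> V - (M \<union> B). \<exists>e\<in>D. y \<in> e \<and> e \<inter> M \<noteq> {}} \<le> b"
    and DV: "\<And>e. e \<in> D \<Longrightarrow> e \<subseteq> V"
  shows "\<not> mb_win n mt V W b M B"
  using assms(6-9)
proof (induction n arbitrary: mt M B)
  case 0
  then have "\<not> W M" using W[of M] by blast
  then show ?case by simp
next
  case (Suc n)
  let ?F = "V - (M \<union> B)"
  have finF: "finite ?F" using assms(1) by simp
  show ?case
  proof (cases "?F = {}")
    case True
    moreover have "\<not> W M" using Suc.prems(1,3) W[of M] by blast
    ultimately show ?thesis by simp
  next
    case False
    show ?thesis
    proof (cases mt)
      case True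
      have inv: "\<And>e. e \<in> D \<Longrightarrow> e \<inter> M \<noteq> {} \<Longrightarrow> e \<inter> B \<noteq> {}" using Suc.prems(4) True by auto
      have "\<not> mb_win n False V W b (insert v M) B" if v: "v \<in> ?F" for v
      proof (rule Suc.IH)
        show "insert v M \<subseteq> V" "insert v M \<inter> B = {}" using v Suc.prems(1,2) by auto
        show no: "\<not> e \<subseteq> insert v M" if e: "e \<in> D" for e
        proof
          assume sub: "e \<subseteq> insert v M"
          have "e \<inter> M \<noteq> {}"
          proof
            assume "e \<inter> M = {}"
            then have "e \<subseteq> {v}" using sub by auto
            then have "card e \<le> 1" using card_mono[of "{v}" e] by simp
            then show False using D2[OF e] by simp
          qed
          then show False using inv[OF e] sub v Suc.prems(2) by auto
        qed
        \<comment> \<open>A pair touched before this move already meets \<open>B\<close>, so each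
          free vertex to be blocked is a partner of \<open>v\<close>. Sending a pair at
          \<open>v\<close> to its other end shows that there are at most as many of them as pairs at
          \<open>v\<close>.\<close>
        have "{y \<in> V - (insert v M \<union> B). \<exists>e\<in>D. y \<in> e \<and> e \<inter> insert v M \<noteq> {}}
            \<subseteq> (\<lambda>e. THE y. y \<in> e \<and> y \<noteq> v) ` {e\<in>D. v \<in> e}"
        proof
          fix y assume "y \<in> {y \<in> V - (insert v M \<union> B). \<exists>e\<in>D. y \<in> e \<and> e \<inter> insert v M \<noteq> {}}"
          then obtain e where y: "y \<in> V" "y \<notin> B" "y \<noteq> v" "y \<notin> M" "e \<in> D" "y \<in> e" "e \<inter> insert v M \<noteq> {}"
            by auto
          have ve: "v \<in> e"
          proof (rule ccontr)
            assume "v \<notin> e"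
            then have "e \<inter> M \<noteq> {}" using y by auto
            then obtain x z where "x \<in> e" "x \<in> M" "z \<in> e" "z \<in> B" using inv[OF y(5)] by blast
            moreover from this have "x \<noteq> y" "x \<noteq> z" "y \<noteq> z" using y Suc.prems(2) by auto
            ultimately have "{x,y,z} \<subseteq> e" "card {x,y,z} = 3" using y by auto
            moreover have "finite e" using D2[OF y(5)] card.infinite by fastforce
            ultimately have "3 \<le> card e" using card_mono by metis
            then show False using D2[OF y(5)] by simp
          qed
          have e: "e = {v, y}"
          proof -
            have "finite e" using D2[OF y(5)] card.infinite by fastforce
            then show ?thesis using D2[OF y(5)] y ve by (intro card_seteq[symmetric]) auto
          qed
          have "y = (THE y. y \<in> e \<and> y \<noteq> v)"
            unfolding e using y by (intro the_equality[symmetric]) auto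
          then show "y \<in> (\<lambda>e. THE y. y \<in> e \<and> y \<noteq> v) ` {e\<in>D. v \<in> e}" using y ve by blast
        qed
        then have "card {y \<in> V - (insert v M \<union> B). \<exists>e\<in>D. y \<in> e \<and> e \<inter> insert v M \<noteq> {}}
           \<le> card {e\<in>D. v \<in> e}"
          using fin by (intro surj_card_le) auto
        then show "if False then \<forall>e\<in>D. e \<inter> insert v M \<noteq> {} \<longrightarrow> e \<inter> B \<noteq> {}
          else card {y \<in> V - (insert v M \<union> B). \<exists>e\<in>D. y \<in> e \<and> e \<inter> insert v M \<noteq> {}} \<le> b"
          using deg[of v] by simp
      qed
      then show ?thesis unfolding mb_win.simps using True False by metis
    next
      case F: False
      let ?R = "{y \<in> ?F. \<exists>e\<in>D. y \<in> e \<and> e \<inter> M \<noteq> {}}"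
      have "card ?R \<le> b" using Suc.prems(4) F by simp
      moreover have "card ?R \<le> card ?F" using finF by (intro card_mono) auto
      \<comment> \<open>The rules fix the size of Breaker's move, so the urgent vertices are padded
        arbitrarily; additional vertices do no harm.\<close>
      ultimately have "\<exists>S. ?R \<subseteq> S \<and> S \<subseteq> ?F \<and> card S = min b (card ?F)"
        using finF by (intro exists_subset_between) auto
      then obtain S where S: "?R \<subseteq> S" "S \<subseteq> ?F" "card S = min b (card ?F)" by blast
      have "\<not> mb_win n True V W b M (B \<union> S)"
      proof (rule Suc.IH)
        show "M \<subseteq> V" "\<And>e. e \<in> D \<Longrightarrow> \<not> e \<subseteq> M" "M \<inter> (B \<union> S) = {}" using Suc.prems(1,2,3) S(2) by auto
        have "e \<inter> (B \<union> S) \<noteq> {}" if e: "e \<in> D" "e \<inter> M \<noteq> {}" for e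
        proof -
          obtain y where y: "y \<in> e" "y \<notin> M" using Suc.prems(3)[OF e(1)] by auto
          then have "y \<in> V" using DV e by auto
          then have "y \<in> B \<or> y \<in> ?R" using y e by auto
          then show ?thesis using S y by auto
        qed
        then show "if True then \<forall>e\<in>D. e \<inter> M \<noteq> {} \<longrightarrow> e \<inter> (B \<union> S) \<noteq> {}
          else card {y \<in> V - (M \<union> (B \<union> S)). \<exists>e\<in>D. y \<in> e \<and> e \<inter> M \<noteq> {}} \<le> b"
          by simp
      qed
      then show ?thesis unfolding mb_win.simps using False F S(2,3) by metis
    qed
  qed
qed

section \<open>Choosing pairs along a sequence of sets\<close>

lemma two_le_card_obtain:
  assumes "2 \<le> card A"
  obtains x y where "x \<in> A" "y \<in> A" "x \<noteq> y"
proof -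
  have "finite A" using assms card.infinite by fastforce
  then have "\<not> (\<forall>x\<in>A. \<forall>y\<in>A. x = y)" using assms card_le_Suc0_iff_eq[of A] by auto
  then show ?thesis using that by blast
qed

text \<open>
  \<open>pairable c V \<S> B\<close>: however an adversary reserves capacity \<open>r\<close> on the vertices, as long as the total
  reservation plus the deficit \<open>B\<close> is at most \<open>c + 1\<close>, one can pick a pair inside every member of \<open>\<S>\<close>
  so that each vertex lies in at most \<open>c\<close> pairs on top of its reservation. Quantifying over
  reservations makes the statement inductive: a set with fewer than two new vertices
  borrows from old vertices, and the borrowed capacity is reserved in the induction hypothesis.
\<close>

definition pairable :: "nat \<Rightarrow> 'v set \<Rightarrow> 'v set set \<Rightarrow> nat \<Rightarrow> bool" where
  "pairable c V \<S> B \<longleftrightarrow> finite V \<and>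
    (\<forall>r :: 'v \<Rightarrow> nat. (\<forall>v\<in>V. r v \<le> c) \<longrightarrow> sum r V + B \<le> c + 1 \<longrightarrow>
      (\<exists>D. (\<forall>e\<in>D. e \<subseteq> V \<and> card e = 2) \<and> (\<forall>S\<in>\<S>. \<exists>e\<in>D. e \<subseteq> S) \<and>
           (\<forall>v\<in>V. card {e\<in>D. v \<in> e} + r v \<le> c)))"

lemma sum_ge_const:
  fixes r :: "'v \<Rightarrow> nat"
  assumes "finite V" "A \<subseteq> V" "\<And>v. v \<in> A \<Longrightarrow> c \<le> r v"
  shows "c * card A \<le> sum r V"
proof -
  have "c * card A = (\<Sum>v\<in>A. c)" by simp
  also have "\<dots> \<le> sum r A" using assms by (intro sum_mono) auto
  also have "\<dots> \<le> sum r V" using assms by (intro sum_mono2) auto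
  finally show ?thesis .
qed

text \<open>If at most one vertex of \<open>S\<close> had capacity left, the other k - 1 would carry
  reservations of total at least (k - 1) c > c + 1.\<close>

lemma pairable_base:
  assumes "k \<le> card S" "c + 1 < (k - 1) * c" "finite S"
  shows "pairable c S {S} 0"
  unfolding pairable_def
proof (intro conjI allI impI)
  fix r :: "'a \<Rightarrow> nat"
  assume r: "\<forall>v\<in>S. r v \<le> c" "sum r S + 0 \<le> c + 1"
  define A where "A = {v\<in>S. r v < c}"
  have "\<not> card A \<le> 1"
  proof
    assume "card A \<le> 1"
    moreover have "card (S - A) = card S - card A"
      using assms by (intro card_Diff_subset) (auto simp: A_def)
    ultimately have "k - 1 \<le> card (S - A)" using assms by linarith
    then have "c * (k - 1) \<le> c * card (S - A)" by simp
    also have "\<dots> \<le> sum r S"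
      by (rule sum_ge_const) (use assms in \<open>auto simp: A_def\<close>)
    finally show False using r assms by (simp add: mult.commute)
  qed
  then obtain x y where xy: "x \<in> A" "y \<in> A" "x \<noteq> y"
    using two_le_card_obtain[of A] by (metis not_less_eq_eq numeral_2_eq_2 One_nat_def)
  have deg: "card {e \<in> {{x, y}}. v \<in> e} = (if v \<in> {x, y} then 1 else 0)" for v
  proof -
    have "{e \<in> {{x, y}}. v \<in> e} = (if v \<in> {x, y} then {{x, y}} else {})" by auto
    then show ?thesis by simp
  qed
  show "\<exists>D. (\<forall>e\<in>D. e \<subseteq> S \<and> card e = 2) \<and> (\<forall>S\<in>{S}. \<exists>e\<in>D. e \<subseteq> S) \<and>
           (\<forall>v\<in>S. card {e\<in>D. v \<in> e} + r v \<le> c)"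
  proof (intro exI[of _ "{{x,y}}"] conjI ballI)
    fix v assume "v \<in> S"
    then have "r v \<le> c" "v = x \<or> v = y \<Longrightarrow> r v < c" using r xy by (auto simp: A_def)
    then show "card {e \<in> {{x, y}}. v \<in> e} + r v \<le> c"
unfolding deg by auto
  qed (use xy in \<open>auto simp: A_def\<close>)
qed (use assms in auto)

text \<open>The start for a \<open>K_{k+1}\<close>: a subset missing at most one vertex cannot break
  both of two disjoint pairs. Deficit 2 equals c + 1 for c = 1, so no reservation has to be
  respected.\<close>

lemma pairable_clique_base:
  assumes "5 \<le> card K"
  shows "pairable 1 K {C. C \<subseteq> K \<and> card K \<le> card C + 1} 2"
  unfolding pairable_def
proof (intro conjI allI impI)
  show fin: "finite K" using assms card.infinite by fastforce
  fix r :: "'a \<Rightarrow> nat"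
  assume "\<forall>v\<in>K. r v \<le> 1" "sum r K + 2 \<le> 1 + 1"
  then have r0: "\<forall>v\<in>K. r v = 0" using fin by auto
  obtain A where A: "A \<subseteq> K" "card A = 4"
    using obtain_subset_with_card_n[of 4 K] assms by auto
  have "\<exists>a b c d. A = {a,b,c,d} \<and> distinct [a,b,c,d]"
  proof -
    obtain xs where "set xs = A" "distinct xs" using finite_distinct_list A fin finite_subset by metis
    moreover from this have "length xs = 4" using A distinct_card by fastforce
    then obtain a b c d where "xs = [a,b,c,d]"
      by (auto simp: length_Suc_conv numeral_eq_Suc)
    ultimately show ?thesis by auto
  qed
  then obtain a b c d where abcd: "A = {a,b,c,d}" "distinct [a,b,c,d]" by blast
  have miss: "x \<in> C" if "C \<subseteq> K" "card K \<le> card C + 1" "y \<in> K" "y \<notin> C" "x \<in> K" "x \<noteq> y" for C x y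
  proof (rule ccontr)
    assume "x \<notin> C"
    then have "C \<subseteq> K - {x, y}" using that by auto
    then have "card C \<le> card (K - {x,y})" using fin by (simp add: card_mono)
    also have "\<dots> = card K - 2" using that fin by (subst card_Diff_subset) auto
    finally show False using that assms by linarith
  qed
  let ?D = "{{a,b},{c,d}}"
  show "\<exists>D. (\<forall>e\<in>D. e \<subseteq> K \<and> card e = 2) \<and> (\<forall>S\<in>{C. C \<subseteq> K \<and> card K \<le> card C + 1}. \<exists>e\<in>D. e \<subseteq> S) \<and>
           (\<forall>v\<in>K. card {e\<in>D. v \<in> e} + r v \<le> 1)"
  proof (intro exI[of _ ?D] conjI ballI)
    fix C assume "C \<in> {C. C \<subseteq> K \<and> card K \<le> card C + 1}"
    then have C: "C \<subseteq> K" "card K \<le> card C + 1" by auto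
    show "\<exists>e\<in>?D. e \<subseteq> C"
    proof (cases "{a,b} \<subseteq> C")
      case False
      then obtain y where "y \<in> {a,b}" "y \<notin> C" by auto
      then have "{c,d} \<subseteq> C" using miss[OF C, of y] A abcd by auto
      then show ?thesis by simp
    qed simp
  next
    fix v assume v: "v \<in> K"
    have "card {e\<in>?D. v \<in> e} \<le> card (if v \<in> {a,b} then {{a,b}} else {{c,d}})"
      using abcd by (intro card_mono) auto
    also have "\<dots> \<le> 1" by simp
    finally show "card {e\<in>?D. v \<in> e} + r v \<le> 1" using r0 v by simp
  qed (use A abcd in auto)
qed

text \<open>The pair in \<open>S\<close> takes new vertices where possible, and the capacity of its
  old ends is reserved before the hypothesis on \<open>V\<close> is applied. The deficit grows by
  the truncated difference 2 - card (S - V), the number of ends that new vertices cannot provide. A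
  saturated new vertex already carries \<open>c\<close> units of reservation, which pay for
  borrowing in its place. The condition on \<open>S\<close> ensures that there is something to
  borrow.\<close>

lemma pairable_step:
  assumes P: "pairable c V \<S> B" and c: "1 \<le> c" "c + 1 < (k - 1) * c"
    and S: "finite S" "2 \<le> card (S \<inter> V) \<or> (S \<inter> V \<noteq> {} \<and> k - 1 \<le> card (S - V))"
  shows "pairable c (V \<union> S) (insert S \<S>) (B + (2 - card (S - V)))"
proof -
  have finV: "finite V" using P by (simp add: pairable_def)
  define Q where "Q = S - V"
  define N where "N = S \<inter> V"
  have finO: "finite Q" "finite N" using S by (auto simp: Q_def N_def)
  have SN: "S = Q \<union> N" "Q \<inter> V = {}" "N \<subseteq> V" "V \<union> S = V \<union> Q" by (auto simp: Q_def N_def)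
  let ?goal = "\<lambda>r. \<exists>D. (\<forall>e\<in>D. e \<subseteq> V \<union> S \<and> card e = 2) \<and> (\<forall>T\<in>insert S \<S>. \<exists>e\<in>D. e \<subseteq> T) \<and>
           (\<forall>v\<in>V \<union> S. card {e\<in>D. v \<in> e} + r v \<le> c)"
  have use: "?goal r" if xy: "x \<in> S" "y \<in> S" "x \<noteq> y" "r x < c" "r y < c"
    and r: "\<forall>v\<in>V \<union> S. r v \<le> c"
    and r': "r' = (\<lambda>v. if v = x \<or> v = y then r v + 1 else r v)"
    and sum: "sum r' V + B \<le> c + 1" for r r' :: "'a \<Rightarrow> nat" and x y
  proof -
    have "\<forall>v\<in>V. r' v \<le> c" using r xy unfolding r' by auto
    then obtain D where D: "\<forall>e\<in>D. e \<subseteq> V \<and> card e = 2" "\<forall>S\<in>\<S>. \<exists>e\<in>D. e \<subseteq> S"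
      "\<forall>v\<in>V. card {e\<in>D. v \<in> e} + r' v \<le> c"
      using P[unfolded pairable_def, THEN conjunct2, rule_format, of r'] sum by auto
    have "D \<subseteq> Pow V" using D by auto
    then have finD: "finite D" using finV finite_subset by auto
    have deg: "card {e \<in> insert {x,y} D. v \<in> e} \<le> card {e\<in>D. v \<in> e} + (if v = x \<or> v = y then 1 else 0)" for v
    proof -
      have "{e \<in> insert {x,y} D. v \<in> e} \<subseteq> (if v = x \<or> v = y then insert {x,y} {e\<in>D. v \<in> e} else {e\<in>D. v \<in> e})"
        by auto
      then have "card {e \<in> insert {x,y} D. v \<in> e} \<le> card (if v = x \<or> v = y then insert {x,y} {e\<in>D. v \<in> e} else {e\<in>D. v \<in> e})"
        using finD by (intro card_mono) auto
      also have "\<dots> \<le> card {e\<in>D. v \<in> e} + (if v = x \<or> v = y then 1 else 0)"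
        using finD by (simp add: card_insert_if)
      finally show ?thesis .
    qed
    show ?thesis
    proof (intro exI[of _ "insert {x,y} D"] conjI ballI)
      fix v assume v: "v \<in> V \<union> S"
      show "card {e \<in> insert {x,y} D. v \<in> e} + r v \<le> c"
      proof (cases "v \<in> V")
        case True
        then have "card {e\<in>D. v \<in> e} + r' v \<le> c" using D by blast
        then show ?thesis using deg[of v] unfolding r' by (auto split: if_splits)
      next
        case False
        then have "{e\<in>D. v \<in> e} = {}" using D by blast
        then have "card {e\<in>D. v \<in> e} = 0" by (simp only: card.empty)
        moreover have "r v \<le> c" "v = x \<or> v = y \<Longrightarrow> r v < c" using xy r v by auto
        ultimately show ?thesis using deg[of v] by (cases "v = x \<or> v = y") simp_all
      qed
    next
      fix e assume "e \<in> insert {x,y} D"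
      then show "e \<subseteq> V \<union> S" "card e = 2" using D xy by auto
    next
      fix T assume "T \<in> insert S \<S>"
      then show "\<exists>e\<in>insert {x,y} D. e \<subseteq> T" using D xy by auto
    qed
  qed
  have "?goal r" if r: "\<forall>v\<in>V \<union> S. r v \<le> c"
    and sum: "sum r (V \<union> S) + (B + (2 - card Q)) \<le> c + 1" for r
  proof -
    define s t o' where "s = sum r Q" and "t = sum r V" and "o' = card Q"
    have st: "t + s + B + (2 - o') \<le> c + 1"
      using sum SN finV finO unfolding s_def t_def o'_def
      by (simp add: sum.union_disjoint Int_commute)
    define A where "A = {v\<in>Q. r v < c}"
    define A' where "A' = {v\<in>N. r v < c}"
    have fA: "finite A" "finite A'" "A \<subseteq> Q" "A' \<subseteq> N" using finO by (auto simp: A_def A'_def)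
    have "c * card (Q - A) \<le> s" unfolding s_def
      by (rule sum_ge_const) (use finO in \<open>auto simp: A_def\<close>)
    then have s: "c * (o' - card A) \<le> s"
      using fA by (simp add: card_Diff_subset o'_def)
    have "c * card (N - A') \<le> t" unfolding t_def
      by (rule sum_ge_const) (use finV SN in \<open>auto simp: A'_def\<close>)
    then have t: "c * (card N - card A') \<le> t"
      using fA by (simp add: card_Diff_subset)
    have mm: "c * j \<le> u" if "j \<le> m" "c * m \<le> u" for j m u :: nat
      using that le_trans mult_le_mono2 by blast
    \<comment> \<open>By the number of ends that can be new: two, one or none.\<close>
    consider "2 \<le> card A" | "card A = 1" | "card A = 0" by linarith
    then show ?thesis
    proof cases
      case 1
      then obtain x y where xy: "x \<in> A" "y \<in> A" "x \<noteq> y" using two_le_card_obtain by metis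
      define r' where "r' = (\<lambda>v. if v = x \<or> v = y then r v + 1 else r v)"
      have "sum r' V = t" unfolding t_def r'_def
        by (rule sum.cong) (use xy SN in \<open>auto simp: A_def\<close>)
      then show ?thesis using use[of x y r r'] xy r st r'_def by (auto simp: A_def SN)
    next
      case 2
      then obtain x where x: "x \<in> A" by (metis card_1_singletonE insertI1)
      then have o1: "1 \<le> o'" using fA finO unfolding o'_def by (metis One_nat_def Suc_leI card_gt_0_iff empty_iff subsetD)
      have "A' \<noteq> {}"
      proof
        assume "A' = {}"
        then have t': "c * card N \<le> t" using t by simp
        show False
        proof (cases "2 \<le> card N")
          case True
          then have "2 * c \<le> t" using mm[OF True t'] by simp
          moreover have "o' = 1 \<or> c \<le> s"
            using o1 s 2 mm[of 1 "o' - 1" s] by (cases "o' = 1") auto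
          ultimately show False using st c by auto
        next
          case False
          then have k: "k - 1 \<le> o'" "N \<noteq> {}" using S by (auto simp: Q_def N_def o'_def)
          then have "1 \<le> card N" using finO by (simp add: Suc_leI card_gt_0_iff)
          then have "c \<le> t" using mm[OF _ t', of 1] by simp
          moreover have "c * (k - 1) - c \<le> s"
            using s 2 k mm[of "k - 1 - 1" "o' - 1" s] by (simp add: diff_mult_distrib2)
          ultimately show False using st c by (simp add: mult.commute)
        qed
      qed
      then obtain y where y: "y \<in> A'" by blast
      define r' where "r' = (\<lambda>v. if v = x \<or> v = y then r v + 1 else r v)"
      have "sum r' V = sum (\<lambda>v. r v + (if v = y then 1 else 0)) V" unfolding r'_def
        by (rule sum.cong) (use x SN in \<open>auto simp: A_def\<close>)
      also have "\<dots> = t + 1" using y SN finV by (auto simp: sum.distrib t_def A'_def)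
      finally have sr: "sum r' V = t + 1" .
      have "o' = 1 \<or> c \<le> s"
        using o1 s 2 mm[of 1 "o' - 1" s] by (cases "o' = 1") auto
      then have "t + 1 + B \<le> c + 1" using st c by auto
      moreover have "x \<noteq> y" using x y SN by (auto simp: A_def A'_def)
      ultimately show ?thesis using use[of x y r r'] x y r sr r'_def by (auto simp: A_def A'_def SN)
    next
      case 3
      have so: "c * o' \<le> s" using s 3 by simp
      have "2 \<le> card A'"
      proof (rule ccontr)
        assume n: "\<not> 2 \<le> card A'"
        show False
        proof (cases "2 \<le> card N")
          case True
          then have ct: "c \<le> t" using mm[OF _ t, of 1] n by simp
          consider "o' = 0" | "o' = 1" | "2 \<le> o'" by linarith
          then show False
          proof cases
            case 3
            then have "2 * c \<le> s" using mm[OF _ so, of 2] by simp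
            then show False using st c \<open>c \<le> t\<close> by linarith
          qed (use st so c ct in auto)
        next
          case False
          then have k: "k - 1 \<le> o'" using S by (auto simp: Q_def N_def o'_def)
          then have "c * (k - 1) \<le> s"
            using mm[OF _ so] by simp
          then show False using st c by (simp add: mult.commute)
        qed
      qed
      then obtain x y where xy: "x \<in> A'" "y \<in> A'" "x \<noteq> y" using two_le_card_obtain by metis
      define r' where "r' = (\<lambda>v. if v = x \<or> v = y then r v + 1 else r v)"
      have "sum r' V = sum (\<lambda>v. r v + (if v = x then 1 else 0) + (if v = y then 1 else 0)) V" unfolding r'_def
        by (rule sum.cong) (use xy in auto)
      also have "\<dots> = t + 2" using xy SN finV by (auto simp: sum.distrib t_def A'_def)
      finally have sr: "sum r' V = t + 2" .
      consider "o' = 0" | "o' = 1" | "o' = 2" | "3 \<le> o'" by linarith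
      then have "t + 2 + B \<le> c + 1"
      proof cases
        case 4
        have "3 * c \<le> s" using mm[OF 4 so] by simp
        then show ?thesis using st c by linarith
      qed (use st so c in auto)
      then show ?thesis using use[of x y r r'] xy r sr r'_def by (auto simp: A'_def SN)
    qed
  qed
  then show ?thesis unfolding pairable_def Q_def using finV S by auto
qed

lemma pairable_obtain:
  assumes "pairable c V \<S> B" "B \<le> c + 1"
  obtains D where "\<forall>e\<in>D. e \<subseteq> V \<and> card e = 2" "\<forall>S\<in>\<S>. \<exists>e\<in>D. e \<subseteq> S" "\<forall>v\<in>V. card {e\<in>D. v \<in> e} \<le> c"
  using assms unfolding pairable_def by (auto dest!: spec[of _ "\<lambda>_. 0"])

section \<open>Unions of copies and their exploration\<close>

text \<open>A copy is encoded by its edge set alone, its vertices being \<open>\<Union>X\<close>.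
  Nothing is lost, as the cliques and cycles in question have no isolated vertices.\<close>

inductive conn_union :: "'v set set set \<Rightarrow> 'v set set \<Rightarrow> bool" for \<C> where
  single: "X \<in> \<C> \<Longrightarrow> conn_union \<C> X"
| attach: "conn_union \<C> F \<Longrightarrow> X \<in> \<C> \<Longrightarrow> \<Union>X \<inter> \<Union>F \<noteq> {} \<Longrightarrow> conn_union \<C> (F \<union> X)"

text \<open>Each attached copy shares a vertex with the earlier union, so closedness propagates
  along the attachments. Connectedness is used later in this form.\<close>

lemma conn_union_closed_subset:
  assumes "conn_union \<C> F" "\<And>X. X \<in> \<C> \<Longrightarrow> X \<subseteq> F \<Longrightarrow> \<Union>X \<inter> W \<noteq> {} \<Longrightarrow> \<Union>X \<subseteq> W"
    "\<Union>F \<inter> W \<noteq> {}"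
  shows "\<Union>F \<subseteq> W"
  using assms
proof (induction rule: conn_union.induct)
  case (single X)
  then show ?case by blast
next
  case (attach F X)
  have X: "\<Union>X \<inter> W \<noteq> {} \<Longrightarrow> \<Union>X \<subseteq> W" using attach.prems(1)[of X] attach.hyps by blast
  have F: "\<Union>F \<inter> W \<noteq> {} \<Longrightarrow> \<Union>F \<subseteq> W" using attach.IH attach.prems(1) by (meson le_supI1)
  show ?case using X F attach.hyps(3) attach.prems(2) by (simp only: Union_Un_distrib) blast
qed

lemma conn_union_cover:
  assumes "conn_union \<C> F" "e \<in> F"
  shows "\<exists>X\<in>\<C>. X \<subseteq> F \<and> e \<in> X"
  using assms by (induction rule: conn_union.induct) blast+

text \<open>For p of order n^(-(k-1)/h), the expected number of subgraphs with u vertices and f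
  edges has order n^(u - (k-1) f / h), and this exponent is negative exactly in the dense case.
  \<open>U\<close> is a separate argument because an exploration starts from a vertex without
  edges.\<close>

definition dense_edges :: "nat \<Rightarrow> nat \<Rightarrow> 'v set \<Rightarrow> 'v set set \<Rightarrow> bool" where
  "dense_edges k h U F \<longleftrightarrow> h * card U < (k - 1) * card F"

definition component :: "'v set set set \<Rightarrow> 'v set set \<Rightarrow> 'v set set \<Rightarrow> bool" where
  "component \<C> E F \<longleftrightarrow> conn_union \<C> F \<and> F \<subseteq> E \<and>
     (\<forall>X\<in>\<C>. X \<subseteq> E \<longrightarrow> \<Union>X \<inter> \<Union>F \<noteq> {} \<longrightarrow> X \<subseteq> F)"

text \<open>\<open>balanced\<close> is strict balancedness for the 1-density in relative form:
  \<open>X\<close> is attached to the vertex set \<open>U\<close>, and \<open>D\<close> stands for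
  its new edges, some of which may lie inside \<open>U\<close>. Unless a full copy hangs at a single
  vertex, the potential h v - (k - 1) e drops by at least 1. The probability estimate exploits this
  integer gap.\<close>

locale copy_family =
  fixes \<C> :: "'v set set set" and k h :: nat
  assumes card_edge: "X \<in> \<C> \<Longrightarrow> e \<in> X \<Longrightarrow> card e = 2"
    and card_copy: "X \<in> \<C> \<Longrightarrow> card X = h"
    and card_verts: "X \<in> \<C> \<Longrightarrow> card (\<Union>X) = k"
    and k2: "2 \<le> k" and h1: "1 \<le> h"
    and balanced: "X \<in> \<C> \<Longrightarrow> \<Union>X \<inter> U \<noteq> {} \<Longrightarrow> D \<subseteq> X \<Longrightarrow> D \<noteq> {} \<Longrightarrow> (\<And>e. e \<in> X \<Longrightarrow> e \<subseteq> U \<or> e \<in> D) \<Longrightarrow>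
       card (\<Union>X - U) = k - 1 \<and> D = X \<or> h * card (\<Union>X - U) + 1 \<le> (k - 1) * card D"
begin

lemma finite_copy: "X \<in> \<C> \<Longrightarrow> finite X"
  using card_copy h1 card.infinite by fastforce

lemma finite_verts: "X \<in> \<C> \<Longrightarrow> finite (\<Union>X)"
  using card_verts k2 card.infinite by fastforce

lemma loss_nonneg:
  assumes "X \<in> \<C>" "\<Union>X \<inter> U \<noteq> {}" "\<Union>F \<subseteq> U"
  shows "h * card (\<Union>X - U) \<le> (k - 1) * card (X - F)"
proof (cases "X \<subseteq> F")
  case True
  then have "\<Union>X - U = {}" using assms by blast
  then show ?thesis by (simp only: card.empty mult_0_right le0)
next
  case False
  then have "card (\<Union>X - U) = k - 1 \<and> X - F = X \<or> h * card (\<Union>X - U) + 1 \<le> (k - 1) * card (X - F)"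
    using assms by (intro balanced) auto
  then show ?thesis using card_copy[OF assms(1)] by auto
qed

end

locale nat_copy_family = copy_family \<C> k h for \<C> :: "nat set set set" and k h
begin

text \<open>
  Breadth-first exploration of the component of a vertex: \<open>P\<close> is processed, \<open>T\<close> is the queue, \<open>F\<close> the
  edges seen. \<open>overrun M\<close> says that some exploration inside \<open>E\<close> becomes too dense or is still
  running after \<open>M\<close> moves.
\<close>

fun overrun :: "nat \<Rightarrow> nat set \<Rightarrow> nat set \<Rightarrow> nat set set \<Rightarrow> nat set set \<Rightarrow> bool" where
  "overrun 0 P T F E = (F \<subseteq> E)"
| "overrun (Suc M) P T F E = (F \<subseteq> E \<and> (dense_edges k h (P \<union> T) F \<or>
     (T \<noteq> {} \<and> (overrun M (insert (Min T) P) (T - {Min T}) F E \<or>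
       (\<exists>X\<in>\<C>. X \<subseteq> E \<and> Min T \<in> \<Union>X \<and> \<not> X \<subseteq> F \<and> overrun M P (T \<union> (\<Union>X - P)) (F \<union> X) E)))))"

text \<open>Running out of moves while \<open>F \<subseteq> E\<close> counts as an overrun, so
  without overrun the queue must become empty. All copies meeting processed vertices then lie in
  \<open>F\<close>. The alternative \<open>F = {}\<close> is a vertex contained in no copy.\<close>

lemma no_overrun_explores:
  assumes "\<not> overrun M P T F E" "finite T" "F \<subseteq> E"
    "\<And>X. X \<in> \<C> \<Longrightarrow> X \<subseteq> E \<Longrightarrow> \<Union>X \<inter> P \<noteq> {} \<Longrightarrow> X \<subseteq> F"
    "F = {} \<and> P \<union> T = {v} \<or> conn_union \<C> F \<and> \<Union>F = P \<union> T \<and> v \<in> P \<union> T"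
  shows "\<exists>F U. F \<subseteq> E \<and> v \<in> U \<and> (F = {} \<and> U = {v} \<or> conn_union \<C> F \<and> \<Union>F = U) \<and>
    (\<forall>X\<in>\<C>. X \<subseteq> E \<longrightarrow> \<Union>X \<inter> U \<noteq> {} \<longrightarrow> X \<subseteq> F) \<and> \<not> dense_edges k h U F"
  using assms
proof (induction M arbitrary: P T F)
  case 0
  then show ?case by simp
next
  case (Suc M)
  have nd: "\<not> dense_edges k h (P \<union> T) F" using Suc.prems(1,3) by auto
  show ?case
  proof (cases "T = {}")
    case True
    show ?thesis
      by (rule exI[of _ F], rule exI[of _ "P \<union> T"])
        (use Suc.prems(3,4,5) nd True in auto)
  next
    case False
    let ?v = "Min T"
    have vT: "?v \<in> T" using False Suc.prems(2) by simp
    show ?thesis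
    \<comment> \<open>Here copies are attached as long as possible and the vertex is left only
      afterwards. \<open>overrun\<close> permits both moves at any time, which merely enlarges the
      event whose probability is bounded.\<close>
    proof (cases "\<exists>X\<in>\<C>. X \<subseteq> E \<and> ?v \<in> \<Union>X \<and> \<not> X \<subseteq> F")
      case True
      then obtain X where X: "X \<in> \<C>" "X \<subseteq> E" "?v \<in> \<Union>X" "\<not> X \<subseteq> F" by blast
      show ?thesis
      proof (rule Suc.IH[of P "T \<union> (\<Union>X - P)" "F \<union> X"])
        show "\<not> overrun M P (T \<union> (\<Union>X - P)) (F \<union> X) E"
          using Suc.prems(1,3) X False by auto
        show "finite (T \<union> (\<Union>X - P))" using Suc.prems(2) finite_verts[OF X(1)] by auto
        show "F \<union> X \<subseteq> E" using X Suc.prems(3) by auto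
        show "\<And>X'. X' \<in> \<C> \<Longrightarrow> X' \<subseteq> E \<Longrightarrow> \<Union>X' \<inter> P \<noteq> {} \<Longrightarrow> X' \<subseteq> F \<union> X"
          using Suc.prems(4) by blast
        have "conn_union \<C> (F \<union> X) \<and> \<Union>(F \<union> X) = P \<union> (T \<union> (\<Union>X - P)) \<and> v \<in> P \<union> (T \<union> (\<Union>X - P))"
          using Suc.prems(5)
        proof
          assume F: "F = {} \<and> P \<union> T = {v}"
          then have "?v = v" using vT by auto
          moreover have "P \<union> (T \<union> (\<Union>X - P)) = P \<union> T \<union> \<Union>X" by auto
          ultimately have "P \<union> (T \<union> (\<Union>X - P)) = \<Union>X" "v \<in> \<Union>X" using F X(3) by auto
          then show ?thesis using F X by (auto intro: conn_union.single)
        next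
          assume F: "conn_union \<C> F \<and> \<Union>F = P \<union> T \<and> v \<in> P \<union> T"
          then have "conn_union \<C> (F \<union> X)" using X vT by (intro conn_union.attach) auto
          then show ?thesis using F by auto
        qed
        then show "F \<union> X = {} \<and> P \<union> (T \<union> (\<Union>X - P)) = {v} \<or>
          conn_union \<C> (F \<union> X) \<and> \<Union>(F \<union> X) = P \<union> (T \<union> (\<Union>X - P)) \<and> v \<in> P \<union> (T \<union> (\<Union>X - P))" by blast
      qed
    next
      case no: False
      have eq: "insert ?v P \<union> (T - {?v}) = P \<union> T" using vT by auto
      show ?thesis
      proof (rule Suc.IH[of "insert ?v P" "T - {?v}" F])
        show "\<not> overrun M (insert ?v P) (T - {?v}) F E"
          using Suc.prems(1,3) False by auto
        show "\<And>X. X \<in> \<C> \<Longrightarrow> X \<subseteq> E \<Longrightarrow> \<Union>X \<inter> insert ?v P \<noteq> {} \<Longrightarrow> X \<subseteq> F"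
          using Suc.prems(4) no by blast
      qed (use Suc.prems(2,3,5) eq in auto)
    qed
  qed
qed

lemma no_overrun_component:
  assumes "\<not> overrun M {} {v} {} E" "X \<in> \<C>" "X \<subseteq> E" "v \<in> \<Union>X"
  shows "\<exists>F. component \<C> E F \<and> X \<subseteq> F \<and> \<not> dense_edges k h (\<Union>F) F"
proof -
  have "\<exists>F U. F \<subseteq> E \<and> v \<in> U \<and> (F = {} \<and> U = {v} \<or> conn_union \<C> F \<and> \<Union>F = U) \<and>
    (\<forall>X\<in>\<C>. X \<subseteq> E \<longrightarrow> \<Union>X \<inter> U \<noteq> {} \<longrightarrow> X \<subseteq> F) \<and> \<not> dense_edges k h U F"
    by (rule no_overrun_explores[OF assms(1)]) auto
  then obtain F U where FU: "F \<subseteq> E" "v \<in> U" "F = {} \<and> U = {v} \<or> conn_union \<C> F \<and> \<Union>F = U"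
    "\<forall>X\<in>\<C>. X \<subseteq> E \<longrightarrow> \<Union>X \<inter> U \<noteq> {} \<longrightarrow> X \<subseteq> F" "\<not> dense_edges k h U F"
    by (elim exE conjE)
  have XF: "X \<subseteq> F" using FU(2,4) assms by blast
  moreover have "X \<noteq> {}" using assms(4) by auto
  ultimately have "F \<noteq> {}" by auto
  then show ?thesis using FU XF unfolding component_def by (intro exI[of _ F]) auto
qed

end

section \<open>Counting vertex sets for the first-moment bound\<close>

lemma sum_subsets_powr:
  fixes n :: nat
  assumes "finite A" "card A \<le> n" "0 < n"
  shows "(\<Sum>N\<in>{N. N \<subseteq> A \<and> card N \<le> k}. 1 / real n ^ card N) \<le> real k + 1"
proof -
  let ?S = "{N. N \<subseteq> A \<and> card N \<le> k}"
  have fin: "finite ?S" using assms by auto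
  have "(\<Sum>N\<in>?S. 1 / real n ^ card N) = (\<Sum>a\<in>{..k}. \<Sum>N\<in>{N\<in>?S. card N = a}. 1 / real n ^ card N)"
    by (rule sum.group[symmetric]) (use fin in auto)
  also have "\<dots> \<le> (\<Sum>a\<in>{..k}. 1)"
  proof (rule sum_mono)
    fix a assume a: "a \<in> {..k}"
    have eq: "{N\<in>?S. card N = a} = {N. N \<subseteq> A \<and> card N = a}" using a by auto
    have "(\<Sum>N\<in>{N\<in>?S. card N = a}. 1 / real n ^ card N) = (\<Sum>N\<in>{N\<in>?S. card N = a}. 1 / real n ^ a)"
      by (rule sum.cong) auto
    also have "\<dots> = real (card A choose a) / real n ^ a"
      unfolding eq using n_subsets[OF assms(1)] by simp
    also have "\<dots> \<le> 1"
    proof -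
      have "(card A choose a) \<le> n ^ a"
        using assms binomial_mono[of a] by (cases "a \<le> card A") (auto intro: order_trans[OF binomial_le_pow power_mono] simp: binomial_eq_0)
      then show ?thesis using assms by (simp add: divide_le_eq flip: of_nat_power)
    qed
    finally show "(\<Sum>N\<in>{N\<in>?S. card N = a}. 1 / real n ^ card N) \<le> 1" .
  qed
  also have "\<dots> = real k + 1" by simp
  finally show ?thesis .
qed

lemma card_small_subsets:
  assumes "finite U" "card U \<le> R" "1 \<le> R"
  shows "card {Z. Z \<subseteq> U \<and> card Z \<le> k} \<le> (k + 1) * R ^ k"
proof -
  have "{Z. Z \<subseteq> U \<and> card Z \<le> k} = (\<Union>a\<in>{..k}. {Z. Z \<subseteq> U \<and> card Z = a})" by auto
  then have "card {Z. Z \<subseteq> U \<and> card Z \<le> k} \<le> (\<Sum>a\<in>{..k}. card {Z. Z \<subseteq> U \<and> card Z = a})"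
    by (simp add: card_UN_le)
  also have "\<dots> \<le> (\<Sum>a\<in>{..k}. R ^ k)"
  proof (rule sum_mono)
    fix a assume a: "a \<in> {..k}"
    have "card {Z. Z \<subseteq> U \<and> card Z = a} = card U choose a" using n_subsets[OF assms(1)] .
    also have "\<dots> \<le> R ^ a"
      using assms by (cases "a \<le> card U") (auto intro: order_trans[OF binomial_le_pow power_mono] simp: binomial_eq_0)
    also have "\<dots> \<le> R ^ k" using a assms by (intro power_increasing) auto
    finally show "card {Z. Z \<subseteq> U \<and> card Z = a} \<le> R ^ k" .
  qed
  finally show ?thesis by simp
qed

text \<open>Split \<open>Y\<close> into \<open>Y \<inter> U\<close> and \<open>Y - U\<close>. The
  first part has at most (k + 1) R^k values; for the second there are at most n^a sets of size a,
  each of weight n^(-a), so the sum over it is at most k + 1.\<close>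

lemma sum_over_vertex_sets:
  fixes n :: nat
  assumes "finite A" "card A \<le> n" "0 < n" "finite U" "card U \<le> R" "1 \<le> R"
    and \<Y>: "\<Y> \<subseteq> {Y. Y \<subseteq> A \<and> card Y \<le> k}"
  shows "(\<Sum>Y\<in>\<Y>. 1 / real n ^ card (Y - U)) \<le> real ((k + 1)\<^sup>2 * R ^ k)"
proof -
  let ?Z = "{Z. Z \<subseteq> U \<and> card Z \<le> k}" and ?N = "{N. N \<subseteq> A \<and> card N \<le> k}"
  have finZ: "finite ?Z" "finite ?N" using assms by auto
  have inj: "inj_on (\<lambda>Y. (Y \<inter> U, Y - U)) \<Y>" by (auto simp: inj_on_def)
  have img: "(\<lambda>Y. (Y \<inter> U, Y - U)) ` \<Y> \<subseteq> ?Z \<times> ?N"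
  proof safe
    fix Y assume "Y \<in> \<Y>"
    then have Y: "Y \<subseteq> A" "card Y \<le> k" using \<Y> by auto
    then have "finite Y" using assms finite_subset by auto
    then show "card (Y \<inter> U) \<le> k" "card (Y - U) \<le> k"
      using Y card_mono[of Y "Y \<inter> U"] card_mono[of Y "Y - U"] by auto
    show "x \<in> Y \<Longrightarrow> x \<in> A" for x using Y by auto
  qed
  have "(\<Sum>Y\<in>\<Y>. 1 / real n ^ card (Y - U)) = (\<Sum>(Z,N)\<in>(\<lambda>Y. (Y \<inter> U, Y - U)) ` \<Y>. 1 / real n ^ card N)"
    by (subst sum.reindex[OF inj]) (simp add: case_prod_unfold)
  also have "\<dots> \<le> (\<Sum>(Z,N)\<in>?Z \<times> ?N. 1 / real n ^ card N)"
    by (rule sum_mono2) (use finZ img in auto)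
  also have "\<dots> = real (card ?Z) * (\<Sum>N\<in>?N. 1 / real n ^ card N)"
    by (simp add: sum.cartesian_product[symmetric])
  also have "\<dots> \<le> real ((k + 1) * R ^ k) * (real k + 1)"
    by (intro mult_mono sum_subsets_powr assms of_nat_mono card_small_subsets sum_nonneg) auto
  also have "\<dots> = real ((k + 1)\<^sup>2 * R ^ k)" by (simp add: power2_eq_square algebra_simps)
  finally show ?thesis .
qed

lemma finite_all_edges: "finite (all_edges n)"
  by (rule finite_subset[of _ "Pow {0..<n}"]) (auto simp: all_edges_def)

context nat_copy_family
begin

text \<open>
  The factor \<open>4 ^ card T\<close> makes advancing past a vertex cost \<open>1/4\<close>; the exponent \<open>1 - \<eta>\<close> instead of \<open>1\<close>
  leaves a factor \<open>n powr (- \<eta> / h)\<close> per degenerate copy, which pays for the polylogarithmic number of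
  ways to attach it.
\<close>

definition weight :: "real \<Rightarrow> real \<Rightarrow> nat \<Rightarrow> nat set \<Rightarrow> nat set \<Rightarrow> nat set set \<Rightarrow> real" where
  "weight c \<eta> n P T F = c ^ card F *
     real n powr (- ((1 - \<eta>) * real (card (P \<union> T)) + \<eta> * (real (k - 1) / real h) * real (card F))) * 4 ^ card T"

lemma weight_nonneg: "0 < c \<Longrightarrow> 0 \<le> weight c \<eta> n P T F"
  by (simp add: weight_def)

lemma card_copies_on: "card {X\<in>\<C>. \<Union>X = Y} \<le> 2 ^ (2 ^ k)"
proof (cases "card Y = k")
  case True
  then have fin: "finite Y" using k2 card.infinite by fastforce
  have "card {X\<in>\<C>. \<Union>X = Y} \<le> card (Pow (Pow Y))"
    using fin by (intro card_mono) auto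
  then show ?thesis using fin True by (simp add: card_Pow)
next
  case False
  then have "{X\<in>\<C>. \<Union>X = Y} = {}" using card_verts by auto
  then show ?thesis by (simp only: card.empty le0)
qed

text \<open>A fixed set of k vertices carries at most 2^(2^k) edge sets, so a sum over copies
  reduces to one over vertex sets.\<close>

lemma sum_over_copies:
  fixes g :: "nat set \<Rightarrow> real"
  assumes "finite \<X>" "\<X> \<subseteq> \<C>" "\<And>Y. 0 \<le> g Y"
  shows "(\<Sum>X\<in>\<X>. g (\<Union>X)) \<le> 2 ^ (2 ^ k) * (\<Sum>Y\<in>Union ` \<X>. g Y)"
proof -
  have "(\<Sum>X\<in>\<X>. g (\<Union>X)) = (\<Sum>Y\<in>Union ` \<X>. \<Sum>X\<in>{X\<in>\<X>. \<Union>X = Y}. g (\<Union>X))"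
    by (rule sum.image_gen[OF assms(1)])
  also have "\<dots> \<le> (\<Sum>Y\<in>Union ` \<X>. 2 ^ (2 ^ k) * g Y)"
  proof (rule sum_mono)
    fix Y
    have "finite {X\<in>\<C>. \<Union>X = Y}"
    proof (rule finite_subset)
      show "{X\<in>\<C>. \<Union>X = Y} \<subseteq> (if finite Y then Pow (Pow Y) else {})"
        using finite_verts by auto
    qed auto
    then have "card {X\<in>\<X>. \<Union>X = Y} \<le> card {X\<in>\<C>. \<Union>X = Y}"
      using assms by (intro card_mono) auto
    then have "card {X\<in>\<X>. \<Union>X = Y} \<le> 2 ^ (2 ^ k)" using card_copies_on[of Y] by linarith
    then have "real (card {X\<in>\<X>. \<Union>X = Y}) \<le> 2 ^ (2 ^ k)"
      using of_nat_mono[where 'a=real] by fastforce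
    moreover have "(\<Sum>X\<in>{X\<in>\<X>. \<Union>X = Y}. g (\<Union>X)) = (\<Sum>X\<in>{X\<in>\<X>. \<Union>X = Y}. g Y)"
      by (rule sum.cong) auto
    ultimately show "(\<Sum>X\<in>{X\<in>\<X>. \<Union>X = Y}. g (\<Union>X)) \<le> 2 ^ (2 ^ k) * g Y"
      using assms(3) by (simp add: mult_right_mono)
  qed
  also have "\<dots> = 2 ^ (2 ^ k) * (\<Sum>Y\<in>Union ` \<X>. g Y)" by (rule sum_distrib_left[symmetric])
  finally show ?thesis .
qed

text \<open>Copies that meet the union only in \<open>v\<close> and have all edges new use at most
  n^(k-1) vertex sets, which the factor n^(-(k-1)) cancels exactly; a small \<open>c\<close> makes
  their sum at most 1/8. Every other copy carries an extra factor n powr (-\<eta>/h) by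
  \<open>balanced\<close>, which beats the power of \<open>R\<close>.\<close>

lemma weight_children:
  fixes n R :: nat and c \<eta> :: real
  assumes n: "1 \<le> n" and R: "1 \<le> R" "card (P \<union> T) \<le> R" and c: "0 < c" "c \<le> 1" and \<eta>: "0 < \<eta>" "\<eta> < 1"
    and c_small: "2 ^ (2 ^ k) * c ^ h * 4 ^ (k - 1) \<le> 1 / 8"
    and n_large: "2 ^ (2 ^ k) * 4 ^ k * real ((k + 1)\<^sup>2 * R ^ k) * real n powr (- (\<eta> / h)) \<le> 1 / 8"
    and fin: "finite P" "finite T" "finite F" and FU: "\<Union>F \<subseteq> P \<union> T" and v: "v \<in> P \<union> T"
    and \<X>: "\<X> \<subseteq> {X\<in>\<C>. X \<subseteq> all_edges n \<and> v \<in> \<Union>X \<and> \<not> X \<subseteq> F}"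
  shows "(\<Sum>X\<in>\<X>. weight c \<eta> n P (T \<union> (\<Union>X - P)) (F \<union> X)) \<le> weight c \<eta> n P T F / 4"
proof -
  define U where "U = P \<union> T"
  define K :: real where "K = 2 ^ (2 ^ k)"
  have finU: "finite U" using fin by (simp add: U_def)
  have "\<X> \<subseteq> Pow (all_edges n)" using \<X> by auto
  then have finX: "finite \<X>" using finite_all_edges by (meson finite_Pow_iff finite_subset)
  define w where "w = weight c \<eta> n P T F"
  have w0: "0 \<le> w" using c by (simp add: w_def weight_nonneg)
  define fac where "fac X = c ^ card (X - F) * real n powr (- ((1 - \<eta>) * real (card (\<Union>X - U)) + \<eta> * (real (k - 1) / real h) * real (card (X - F)))) * 4 ^ card (\<Union>X - U)" for X
  have wfac: "weight c \<eta> n P (T \<union> (\<Union>X - P)) (F \<union> X) = w * fac X" if "X \<in> \<X>" for X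
  proof -
    have X: "X \<in> \<C>" using that \<X> by auto
    have "P \<union> (T \<union> (\<Union>X - P)) = U \<union> (\<Union>X - U)" by (auto simp: U_def)
    then have 1: "card (P \<union> (T \<union> (\<Union>X - P))) = card U + card (\<Union>X - U)"
      using finU finite_verts[OF X] by (simp add: card_Un_disjoint del: Un_Diff_cancel)
    have "T \<union> (\<Union>X - P) = T \<union> (\<Union>X - U)" by (auto simp: U_def)
    then have 2: "card (T \<union> (\<Union>X - P)) = card T + card (\<Union>X - U)"
      using fin finite_verts[OF X] by (simp add: card_Un_disjoint U_def Int_Diff Diff_Int_distrib)
    have 3: "card (F \<union> X) = card F + card (X - F)"
      using fin finite_copy[OF X] card_Un_disjoint[of F "X - F"] by auto
    show ?thesis unfolding weight_def w_def fac_def 1 2 3 U_def[symmetric]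
      using n by (simp add: power_add powr_add[symmetric] algebra_simps add_divide_distrib)
  qed
  define \<X>1 where "\<X>1 = {X\<in>\<X>. card (\<Union>X - U) = k - 1 \<and> X - F = X}"
  define \<X>2 where "\<X>2 = \<X> - \<X>1"
  have XC: "\<X> \<subseteq> \<C>" using \<X> by auto
  have Xn: "\<Union>X \<subseteq> {0..<n}" if "X \<in> \<X>" for X using \<X> that by (auto simp: all_edges_def)
  have fac1: "fac X = c ^ h * 4 ^ (k - 1) * (1 / real n ^ (k - 1))" if X: "X \<in> \<X>1" for X
  proof -
    have X': "card (\<Union>X - U) = k - 1" "card (X - F) = h" using X card_copy \<X> by (auto simp: \<X>1_def)
    \<comment> \<open>For a full copy at one vertex, vertices and edges both contribute k - 1, so
      the mixture does not depend on \<eta>.\<close>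
    have e: "- ((1 - \<eta>) * real (k - 1) + \<eta> * (real (k - 1) / real h) * real h) = - real (k - 1)"
      using h1 by (simp add: algebra_simps)
    show ?thesis unfolding fac_def X' e using n by (simp add: powr_minus powr_realpow divide_inverse)
  qed
  have fac2: "fac X \<le> 4 ^ k * real n powr (- (\<eta> / h)) * (1 / real n ^ card (\<Union>X - U))" if X: "X \<in> \<X>2" for X
  proof -
    have XX: "X \<in> \<X>" "X \<in> \<C>" using X \<X> by (auto simp: \<X>2_def)
    let ?a = "card (\<Union>X - U)" and ?e = "card (X - F)"
    have "?a = k - 1 \<and> X - F = X \<or> h * ?a + 1 \<le> (k - 1) * ?e"
    proof (rule balanced[OF XX(2)])
      show "\<Union>X \<inter> U \<noteq> {}" using XX v \<X> by (auto simp: U_def)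
      show "X - F \<noteq> {}" using XX \<X> by auto
      show "e \<subseteq> U \<or> e \<in> X - F" if "e \<in> X" for e using that FU by (auto simp: U_def)
    qed auto
    then have "h * ?a + 1 \<le> (k - 1) * ?e" using X by (auto simp: \<X>2_def \<X>1_def)
    then have "real (h * ?a + 1) \<le> real ((k - 1) * ?e)" by (simp only: of_nat_le_iff)
    then have "real (h * ?a + 1) / h \<le> real ((k - 1) * ?e) / h" by (rule divide_right_mono) simp
    then have "real ?a + 1 / h \<le> real (k - 1) / h * ?e"
      using h1 by (simp add: add_divide_distrib)
    then have "\<eta> * (real ?a + 1 / h) \<le> \<eta> * (real (k - 1) / h * ?e)"
      using \<eta> by (intro mult_left_mono) auto
    then have "- ((1 - \<eta>) * real ?a + \<eta> * (real (k - 1) / real h) * real ?e) \<le> - (\<eta> / h) - real ?a"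
      by (simp add: algebra_simps)
    then have "real n powr (- ((1 - \<eta>) * real ?a + \<eta> * (real (k - 1) / real h) * real ?e)) \<le> real n powr (- (\<eta> / h) - real ?a)"
      using n by (intro powr_mono) auto
    also have "\<dots> = real n powr (- (\<eta> / h)) * (1 / real n ^ ?a)"
      using n by (simp add: powr_diff powr_realpow)
    finally have 1: "real n powr (- ((1 - \<eta>) * real ?a + \<eta> * (real (k - 1) / real h) * real ?e)) \<le> real n powr (- (\<eta> / h)) * (1 / real n ^ ?a)" .
    have "?a \<le> k" using card_mono[of "\<Union>X" "\<Union>X - U"] card_verts[OF XX(2)] finite_verts[OF XX(2)] by auto
    then have 2: "(4::real) ^ ?a \<le> 4 ^ k" by (intro power_increasing) auto
    have 3: "c ^ ?e \<le> 1" using c by (intro power_le_one) auto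
    have "fac X \<le> 1 * (real n powr (- (\<eta> / h)) * (1 / real n ^ ?a)) * 4 ^ k"
      unfolding fac_def by (intro mult_mono 1 2 3) (use c in auto)
    then show ?thesis by (simp add: mult_ac)
  qed
  have s1: "(\<Sum>X\<in>\<X>1. fac X) \<le> 1 / 8"
  proof -
    have "Union ` \<X>1 \<subseteq> insert v ` {N. N \<subseteq> {0..<n} \<and> card N = k - 1}"
    proof
      fix Y assume "Y \<in> Union ` \<X>1"
      then obtain X where X: "Y = \<Union>X" "X \<in> \<X>" "card (\<Union>X - U) = k - 1" by (auto simp: \<X>1_def)
      have vY: "v \<in> Y" using X \<X> by auto
      have cY: "card Y = k" "finite Y" using X XC card_verts finite_verts by auto
      then have "card (Y - {v}) = k - 1" using vY by simp
      moreover have "Y - {v} \<subseteq> {0..<n}" using Xn X by auto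
      ultimately show "Y \<in> insert v ` {N. N \<subseteq> {0..<n} \<and> card N = k - 1}"
        using vY by (intro image_eqI[of _ _ "Y - {v}"]) auto
    qed
    then have "card (Union ` \<X>1) \<le> card (insert v ` {N. N \<subseteq> {0..<n} \<and> card N = k - 1})"
      by (intro card_mono) auto
    also have "\<dots> \<le> card {N. N \<subseteq> {0..<n} \<and> card N = k - 1}" by (intro card_image_le) auto
    also have "\<dots> = n choose (k - 1)" using n_subsets[of "{0..<n}" "k - 1"] by simp
    also have "\<dots> \<le> n ^ (k - 1)" by (cases "k - 1 \<le> n") (auto intro: binomial_le_pow simp: binomial_eq_0)
    finally have cU: "real (card (Union ` \<X>1)) \<le> real n ^ (k - 1)"
      by (simp flip: of_nat_power)
    have "(\<Sum>X\<in>\<X>1. fac X) = (\<Sum>X\<in>\<X>1. c ^ h * 4 ^ (k - 1) * (1 / real n ^ (k - 1)))"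
      by (rule sum.cong[OF refl fac1])
    also have "\<dots> \<le> 2 ^ (2 ^ k) * (\<Sum>Y\<in>Union ` \<X>1. c ^ h * 4 ^ (k - 1) * (1 / real n ^ (k - 1)))"
      by (rule sum_over_copies) (use finX XC c in \<open>auto simp: \<X>1_def\<close>)
    also have "\<dots> = 2 ^ (2 ^ k) * c ^ h * 4 ^ (k - 1) * (real (card (Union ` \<X>1)) / real n ^ (k - 1))"
      by simp
    also have "\<dots> \<le> 2 ^ (2 ^ k) * c ^ h * 4 ^ (k - 1) * 1"
      using cU n c by (intro mult_left_mono) (auto simp: divide_le_eq)
    also have "\<dots> \<le> 1 / 8" using c_small by simp
    finally show ?thesis .
  qed
  have s2: "(\<Sum>X\<in>\<X>2. fac X) \<le> 1 / 8"
  proof -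
    define g where "g Y = 4 ^ k * real n powr (- (\<eta> / h)) * (1 / real n ^ card (Y - U))" for Y :: "nat set"
    have "(\<Sum>X\<in>\<X>2. fac X) \<le> (\<Sum>X\<in>\<X>2. g (\<Union>X))"
      unfolding g_def by (rule sum_mono) (rule fac2)
    also have "\<dots> \<le> 2 ^ (2 ^ k) * (\<Sum>Y\<in>Union ` \<X>2. g Y)"
      by (rule sum_over_copies) (use finX XC in \<open>auto simp: \<X>2_def g_def\<close>)
    also have "(\<Sum>Y\<in>Union ` \<X>2. g Y) = 4 ^ k * real n powr (- (\<eta> / h)) * (\<Sum>Y\<in>Union ` \<X>2. 1 / real n ^ card (Y - U))"
      unfolding g_def by (rule sum_distrib_left[symmetric])
    also have "2 ^ (2 ^ k) * \<dots> \<le> 2 ^ (2 ^ k) * (4 ^ k * real n powr (- (\<eta> / h)) * real ((k + 1)\<^sup>2 * R ^ k))"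
    proof (intro mult_left_mono)
      show "(\<Sum>Y\<in>Union ` \<X>2. 1 / real n ^ card (Y - U)) \<le> real ((k + 1)\<^sup>2 * R ^ k)"
        by (rule sum_over_vertex_sets[of "{0..<n}"])
          (use n R finU Xn XC card_verts in \<open>auto simp: \<X>2_def U_def\<close>)
    qed auto
    also have "\<dots> \<le> 1 / 8" using n_large by (simp add: mult_ac)
    finally show ?thesis .
  qed
  have "(\<Sum>X\<in>\<X>. weight c \<eta> n P (T \<union> (\<Union>X - P)) (F \<union> X)) = w * (\<Sum>X\<in>\<X>. fac X)"
    unfolding sum_distrib_left by (rule sum.cong[OF refl wfac])
  also have "(\<Sum>X\<in>\<X>. fac X) = (\<Sum>X\<in>\<X>1. fac X) + (\<Sum>X\<in>\<X>2. fac X)"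
    unfolding \<X>2_def using finX by (subst sum.subset_diff[of \<X>1 \<X>]) (auto simp: \<X>1_def)
  also have "w * \<dots> \<le> w * (1 / 4)" using s1 s2 w0 by (intro mult_left_mono) auto
  finally show ?thesis by (simp add: w_def)
qed

end

section \<open>Probability that some exploration overruns\<close>

context nat_copy_family
begin

text \<open>Every move halves the total weight: advancing leaves 1/4, and all attachments together
  at most another 1/4. The two terms of the bound belong to the two ways of stopping, a dense edge
  set or exhausted fuel. The last hypothesis keeps the potential at most that of a single vertex;
  this is where the factor n^(1-\<eta>) comes from.\<close>

lemma overrun_prob:
  fixes n R :: nat and c \<eta> p :: real
  assumes n: "1 \<le> n" and R: "1 \<le> R" and c: "0 < c" "c \<le> 1" and \<eta>: "0 < \<eta>" "\<eta> < 1"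
    and p: "0 \<le> p" "p \<le> 1" "p \<le> c * real n powr (- (real (k - 1) / h))"
    and c_small: "2 ^ (2 ^ k) * c ^ h * 4 ^ (k - 1) \<le> 1 / 8"
    and n_large: "2 ^ (2 ^ k) * 4 ^ k * real ((k + 1)\<^sup>2 * R ^ k) * real n powr (- (\<eta> / h)) \<le> 1 / 8"
    and "finite P" "finite T" "F \<subseteq> all_edges n" "\<Union>F \<subseteq> P \<union> T" "card (P \<union> T) + k * M \<le> R"
    and "h * card (P \<union> T) \<le> h + (k - 1) * card F"
  shows "bexp (all_edges n) p (\<lambda>E. if overrun M P T F E then 1 else 0)
    \<le> weight c \<eta> n P T F * (real n powr (- ((1 - \<eta>) / h)) + real n powr (1 - \<eta>) / 2 ^ M)"
  using assms(12-)
proof (induction M arbitrary: P T F)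
  \<comment> \<open>Comparing p^(card F) with the weight leaves the power of n whose exponent is (1
    - \<eta>)/h times the potential, and \<open>x\<close> is any upper bound for that exponent. The
    factor \<open>4 ^ card T\<close> only helps.\<close>
  have sup: "bexp (all_edges n) p (\<lambda>E. if F \<subseteq> E then 1 else 0) \<le> weight c \<eta> n P T F * real n powr x"
    if F: "F \<subseteq> all_edges n" and x: "(1 - \<eta>) * (real h * real (card (P \<union> T))) - h * x \<le> (1 - \<eta>) * (real (k - 1) * card F)" for F P T and x :: real
  proof -
    have "bexp (all_edges n) p (\<lambda>E. if F \<subseteq> E then 1 else 0) = p ^ card F"
      using bexp_superset[OF finite_all_edges F, of p "\<lambda>_. 1"] finite_all_edges by simp
    also have "\<dots> \<le> (c * real n powr (- (real (k - 1) / h))) ^ card F"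
      using p by (intro power_mono) auto
    also have "\<dots> = c ^ card F * real n powr (- (real (k - 1) / h) * card F)"
      using n by (simp add: power_mult_distrib powr_realpow[symmetric] powr_powr)
    also have "\<dots> \<le> c ^ card F * real n powr (- ((1 - \<eta>) * real (card (P \<union> T)) + \<eta> * (real (k - 1) / real h) * real (card F)) + x)"
    proof (intro mult_left_mono powr_mono)
      have "(1 - \<eta>) * real (card (P \<union> T)) - x \<le> (1 - \<eta>) * (real (k - 1) * card F) / h"
        using x h1 by (simp add: field_simps)
      then show "- (real (k - 1) / h) * card F \<le> - ((1 - \<eta>) * real (card (P \<union> T)) + \<eta> * (real (k - 1) / real h) * real (card F)) + x"
        by (simp add: algebra_simps diff_divide_distrib)
    qed (use n c in auto)
    also have "\<dots> = c ^ card F * real n powr (- ((1 - \<eta>) * real (card (P \<union> T)) + \<eta> * (real (k - 1) / real h) * real (card F))) * 1 * real n powr x"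
      by (simp add: powr_add)
    also have "\<dots> \<le> c ^ card F * real n powr (- ((1 - \<eta>) * real (card (P \<union> T)) + \<eta> * (real (k - 1) / real h) * real (card F))) * 4 ^ card T * real n powr x"
      using c by (intro mult_right_mono mult_left_mono) auto
    finally show ?thesis unfolding weight_def .
  qed
  {
    case 0
    have "real (h * card (P \<union> T)) \<le> real (h + (k - 1) * card F)" using 0 by (simp only: of_nat_le_iff)
    then have "(1 - \<eta>) * (real h * real (card (P \<union> T))) \<le> (1 - \<eta>) * (h + real (k - 1) * card F)"
      using \<eta> by (intro mult_left_mono) auto
    then have "bexp (all_edges n) p (\<lambda>E. if F \<subseteq> E then 1 else 0) \<le> weight c \<eta> n P T F * real n powr (1 - \<eta>)"
      by (intro sup[OF 0(3)]) (simp add: algebra_simps)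
    also have "\<dots> \<le> weight c \<eta> n P T F * (real n powr (- ((1 - \<eta>) / h)) + real n powr (1 - \<eta>) / 2 ^ 0)"
      using c by (intro mult_left_mono) (auto simp: weight_nonneg)
    finally show ?case by simp
  next
    case (Suc M)
    let ?Pr = "\<lambda>\<phi>. bexp (all_edges n) p (\<lambda>E. if \<phi> E then 1 else 0)"
    let ?Y = "\<lambda>M. real n powr (- ((1 - \<eta>) / h)) + real n powr (1 - \<eta>) / 2 ^ M"
    have w0: "0 \<le> weight c \<eta> n P T F" using c by (simp add: weight_nonneg)
    show ?case
    proof (cases "dense_edges k h (P \<union> T) F")
      case True
      have "real (h * card (P \<union> T) + 1) \<le> real ((k - 1) * card F)"
        using True unfolding dense_edges_def by (subst of_nat_le_iff) simp
      then have "(1 - \<eta>) * (real h * real (card (P \<union> T)) + 1) \<le> (1 - \<eta>) * (real (k - 1) * card F)"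
        using \<eta> by (intro mult_left_mono) auto
      then have "(1 - \<eta>) * (real h * real (card (P \<union> T))) - h * (- ((1 - \<eta>) / h)) \<le> (1 - \<eta>) * (real (k - 1) * card F)"
        using h1 by (simp add: distrib_left)
      then have le: "?Pr (\<lambda>E. F \<subseteq> E) \<le> weight c \<eta> n P T F * real n powr (- ((1 - \<eta>) / h))"
        by (rule sup[OF Suc.prems(3)])
      have "?Pr (overrun (Suc M) P T F) \<le> ?Pr (\<lambda>E. F \<subseteq> E)"
        by (rule bexp_mono[OF p(1,2)]) simp
      also note le
      also have "weight c \<eta> n P T F * real n powr (- ((1 - \<eta>) / h)) \<le> weight c \<eta> n P T F * ?Y (Suc M)"
        using w0 by (intro mult_left_mono) auto
      finally show ?thesis .
    next
      case False
      show ?thesis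
      proof (cases "T = {}")
        case True
        then have "?Pr (overrun (Suc M) P T F) = ?Pr (\<lambda>E. False)"
          using False by (intro bexp_cong) simp
        also have "\<dots> \<le> weight c \<eta> n P T F * ?Y (Suc M)"
          using w0 finite_all_edges by simp
        finally show ?thesis .
      next
        case T: False
        define v where "v = Min T"
        have v: "v \<in> T" using T Suc.prems by (simp add: v_def)
        define \<X> where "\<X> = {X\<in>\<C>. X \<subseteq> all_edges n \<and> v \<in> \<Union>X \<and> \<not> X \<subseteq> F}"
        have "\<X> \<subseteq> Pow (all_edges n)" by (auto simp: \<X>_def)
        then have finX: "finite \<X>" by (rule finite_subset) (simp add: finite_all_edges)
        let ?A = "overrun M (insert v P) (T - {v}) F"
        let ?B = "\<lambda>X. overrun M P (T \<union> (\<Union>X - P)) (F \<union> X)"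
        have "?Pr (overrun (Suc M) P T F) \<le> bexp (all_edges n) p (\<lambda>E. (if ?A E then 1 else 0) + (\<Sum>X\<in>\<X>. if ?B X E then 1 else 0))"
        proof (rule bexp_mono[OF p(1,2)])
          fix E assume E: "E \<subseteq> all_edges n"
          show "(if overrun (Suc M) P T F E then 1 else 0) \<le> (if ?A E then 1 else 0) + (\<Sum>X\<in>\<X>. if ?B X E then 1 else (0::real))"
          proof (cases "overrun (Suc M) P T F E \<and> \<not> ?A E")
            case True
            then obtain X where "X \<in> \<C>" "X \<subseteq> E" "v \<in> \<Union>X" "\<not> X \<subseteq> F" "?B X E"
              using \<open>\<not> dense_edges k h (P \<union> T) F\<close> unfolding overrun.simps v_def by blast
            then have X: "X \<in> \<X>" "?B X E" using E by (auto simp: \<X>_def)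
            have "(if ?B X E then 1 else (0::real)) \<le> (\<Sum>X\<in>\<X>. if ?B X E then 1 else (0::real))"
              by (rule member_le_sum) (use X finX in auto)
            then show ?thesis using X by simp
          next
            case False
            moreover have "0 \<le> (\<Sum>X\<in>\<X>. if ?B X E then 1 else (0::real))" by (rule sum_nonneg) auto
            ultimately show ?thesis by auto
          qed
        qed
        also have "\<dots> = ?Pr ?A + (\<Sum>X\<in>\<X>. ?Pr (?B X))" by (simp add: bexp_add bexp_sum)
        also have "\<dots> \<le> weight c \<eta> n (insert v P) (T - {v}) F * ?Y M + (\<Sum>X\<in>\<X>. weight c \<eta> n P (T \<union> (\<Union>X - P)) (F \<union> X) * ?Y M)"
        proof (intro add_mono sum_mono)
          have eq: "insert v P \<union> (T - {v}) = P \<union> T" using v by auto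
          show "?Pr ?A \<le> weight c \<eta> n (insert v P) (T - {v}) F * ?Y M"
            by (rule Suc.IH) (use Suc.prems eq in auto)
          fix X assume X: "X \<in> \<X>"
          then have XC: "X \<in> \<C>" by (auto simp: \<X>_def)
          have eq: "P \<union> (T \<union> (\<Union>X - P)) = P \<union> T \<union> (\<Union>X - (P \<union> T))" by auto
          have card_eq: "card (P \<union> (T \<union> (\<Union>X - P))) = card (P \<union> T) + card (\<Union>X - (P \<union> T))"
            unfolding eq using Suc.prems finite_verts[OF XC] by (intro card_Un_disjoint) auto
          have "finite F" using Suc.prems finite_all_edges finite_subset by blast
          then have cF: "card (F \<union> X) = card F + card (X - F)"
            using finite_copy[OF XC] card_Un_disjoint[of F "X - F"] by auto
          show "?Pr (?B X) \<le> weight c \<eta> n P (T \<union> (\<Union>X - P)) (F \<union> X) * ?Y M"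
          proof (rule Suc.IH)
            show "finite P" "finite (T \<union> (\<Union>X - P))" using Suc.prems finite_verts[OF XC] by auto
            show "F \<union> X \<subseteq> all_edges n" using Suc.prems X by (auto simp: \<X>_def)
            show "\<Union>(F \<union> X) \<subseteq> P \<union> (T \<union> (\<Union>X - P))" using Suc.prems by auto
            have "card (\<Union>X - (P \<union> T)) \<le> k"
              using card_mono[of "\<Union>X" "\<Union>X - (P \<union> T)"] card_verts[OF XC] finite_verts[OF XC] by auto
            then show "card (P \<union> (T \<union> (\<Union>X - P))) + k * M \<le> R"
              unfolding card_eq using Suc.prems by simp
            have "h * card (\<Union>X - (P \<union> T)) \<le> (k - 1) * card (X - F)"
              using X v Suc.prems by (intro loss_nonneg XC) (auto simp: \<X>_def)
            then show "h * card (P \<union> (T \<union> (\<Union>X - P))) \<le> h + (k - 1) * card (F \<union> X)"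
              unfolding card_eq cF using Suc.prems by (simp add: algebra_simps)
          qed
        qed
        also have "\<dots> = (weight c \<eta> n (insert v P) (T - {v}) F + (\<Sum>X\<in>\<X>. weight c \<eta> n P (T \<union> (\<Union>X - P)) (F \<union> X))) * ?Y M"
          by (simp add: distrib_right sum_distrib_right)
        also have "\<dots> \<le> (weight c \<eta> n P T F / 4 + weight c \<eta> n P T F / 4) * ?Y M"
        proof (intro mult_right_mono add_mono)
          have eq: "insert v P \<union> (T - {v}) = P \<union> T" using v by auto
          have "card T = Suc (card (T - {v}))" using v Suc.prems by (metis card.remove)
          then show "weight c \<eta> n (insert v P) (T - {v}) F \<le> weight c \<eta> n P T F / 4"
            unfolding weight_def eq by simp
          show "(\<Sum>X\<in>\<X>. weight c \<eta> n P (T \<union> (\<Union>X - P)) (F \<union> X)) \<le> weight c \<eta> n P T F / 4"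
            by (rule weight_children[where R = R and v = v])
              (use Suc.prems n R c \<eta> c_small n_large v finite_subset[OF _ finite_all_edges] in \<open>auto simp: \<X>_def\<close>)
        qed auto
        also have "\<dots> = weight c \<eta> n P T F * (?Y M / 2)" by simp
        \<comment> \<open>Only the fuel term has to gain the factor 1/2; for the density term it is
          given away.\<close>
        also have "\<dots> \<le> weight c \<eta> n P T F * ?Y (Suc M)"
          using w0 by (intro mult_left_mono) (auto simp: add_divide_distrib mult.commute)
        finally show ?thesis .
      qed
    qed
  }
qed

text \<open>Each of the n start vertices has weight 4 n^(-(1-\<eta>)). The value of \<eta> makes
  \<eta> - (1 - \<eta>)/h equal to -1/(2 h), which settles the density term; the condition n^2 <=
  2^M settles the fuel term.\<close>

lemma some_overrun_prob:
  fixes n :: nat and c \<eta> p :: real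
  assumes n: "1 \<le> n" and c: "0 < c" "c \<le> 1" and \<eta>: "\<eta> = 1 / (2 * (real h + 1))"
    and p: "0 \<le> p" "p \<le> 1" "p \<le> c * real n powr (- (real (k - 1) / h))"
    and c_small: "2 ^ (2 ^ k) * c ^ h * 4 ^ (k - 1) \<le> 1 / 8"
    and n_large: "2 ^ (2 ^ k) * 4 ^ k * real ((k + 1)\<^sup>2 * (1 + k * M) ^ k) * real n powr (- (\<eta> / h)) \<le> 1 / 8"
    and M: "real n ^ 2 \<le> 2 ^ M"
  shows "bexp (all_edges n) p (\<lambda>E. if \<exists>v<n. overrun M {} {v} {} E then 1 else 0)
    \<le> 4 * real n powr (- 1 / (2 * real h)) + 4 / real n"
proof -
  have \<eta>01: "0 < \<eta>" "\<eta> < 1" using \<eta> by (auto simp: divide_less_eq)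
  let ?Y = "real n powr (- ((1 - \<eta>) / h)) + real n powr (1 - \<eta>) / 2 ^ M"
  have "bexp (all_edges n) p (\<lambda>E. if \<exists>v<n. overrun M {} {v} {} E then 1 else 0)
     \<le> bexp (all_edges n) p (\<lambda>E. \<Sum>v<n. if overrun M {} {v} {} E then 1 else 0)"
  proof (rule bexp_mono[OF p(1,2)])
    fix E
    show "(if \<exists>v<n. overrun M {} {v} {} E then 1 else 0) \<le> (\<Sum>v<n. if overrun M {} {v} {} E then 1 else (0::real))"
    proof (cases "\<exists>v<n. overrun M {} {v} {} E")
      case True
      then obtain v where v: "v < n" "overrun M {} {v} {} E" by blast
      have "(if overrun M {} {v} {} E then 1 else (0::real)) \<le> (\<Sum>v<n. if overrun M {} {v} {} E then 1 else (0::real))"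
        by (rule member_le_sum) (use v in auto)
      then show ?thesis using v True by simp
    qed (auto intro: sum_nonneg)
  qed
  also have "\<dots> = (\<Sum>v<n. bexp (all_edges n) p (\<lambda>E. if overrun M {} {v} {} E then 1 else 0))"
    by (rule bexp_sum)
  also have "\<dots> \<le> (\<Sum>v<n. weight c \<eta> n {} {v} {} * ?Y)"
  proof (rule sum_mono)
    fix v
    show "bexp (all_edges n) p (\<lambda>E. if overrun M {} {v} {} E then 1 else 0) \<le> weight c \<eta> n {} {v} {} * ?Y"
      by (rule overrun_prob[where R = "1 + k * M"]) (use assms \<eta>01 in auto)
  qed
  also have "\<dots> = 4 * (real n * real n powr (- (1 - \<eta>)) * real n powr (- ((1 - \<eta>) / h))) + 4 * (real n * real n powr (- (1 - \<eta>)) * real n powr (1 - \<eta>)) / 2 ^ M"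
    by (simp add: weight_def algebra_simps)
  also have "real n * real n powr (- (1 - \<eta>)) * real n powr (- ((1 - \<eta>) / h)) = real n powr (1 + - (1 - \<eta>) + - ((1 - \<eta>) / h))"
    using n by (simp only: powr_add) simp
  also have "1 + - (1 - \<eta>) + - ((1 - \<eta>) / h) = - 1 / (2 * real h)"
  proof -
    have "1 - \<eta> = (2 * real h + 1) / (2 * (real h + 1))" unfolding \<eta> by (simp add: field_simps)
    moreover have "real h > 0" using h1 by simp
    ultimately show ?thesis by (simp add: divide_simps) (simp add: algebra_simps)
  qed
  also have "real n * real n powr (- (1 - \<eta>)) * real n powr (1 - \<eta>) = real n powr (1 + - (1 - \<eta>) + (1 - \<eta>))"
    using n by (simp only: powr_add) simp
  also have "4 * real n powr (1 + - (1 - \<eta>) + (1 - \<eta>)) / 2 ^ M \<le> 4 / real n"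
    using M n by (simp add: power2_eq_square field_simps)
  finally show ?thesis by simp
qed

text \<open>Fuel of order log n suffices, so the explored sets have logarithmic size
  \<open>R\<close>, and R^k is eventually below any fixed power of n.\<close>

lemma overrun_limit:
  fixes c :: real and p :: "nat \<Rightarrow> real"
  assumes c: "0 < c" "c \<le> 1" and c_small: "2 ^ (2 ^ k) * c ^ h * 4 ^ (k - 1) \<le> 1 / 8"
    and p: "\<And>n. 0 \<le> p n \<and> p n \<le> 1"
    and le: "\<forall>\<^sub>F n in sequentially. p n \<le> c * real n powr (- (real (k - 1) / h))"
  shows "\<exists>M. (\<lambda>n. bexp (all_edges n) (p n) (\<lambda>E. if \<exists>v<n. overrun (M n) {} {v} {} E then 1 else 0)) \<longlonglongrightarrow> 0"
proof -
  define \<eta> where "\<eta> = 1 / (2 * (real h + 1))"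
  define M where "M n = nat \<lceil>2 * log 2 (real n)\<rceil>" for n
  \<comment> \<open>The k-th power of n^\<delta> is n^(\<eta>/(2 h)), half of the gain available per
    degenerate copy.\<close>
  define \<delta> where "\<delta> = \<eta> / h / (2 * real k)"
  have pos: "0 < \<eta>" "0 < \<eta> / h" "0 < \<delta>" using h1 k2 by (auto simp: \<eta>_def \<delta>_def)
  define K where "K = 2 ^ (2 ^ k) * 4 ^ k * real ((k + 1)\<^sup>2)"
  have "\<forall>\<^sub>F n in sequentially. 1 + real k * (2 * log 2 (real n) + 1) \<le> real n powr \<delta>"
    using pos by real_asymp
  moreover have "\<forall>\<^sub>F n in sequentially. K * real n powr (- (\<eta> / h / 2)) \<le> 1 / 8"
  proof -
    have "(\<lambda>n. K * real n powr (- (\<eta> / h / 2))) \<longlonglongrightarrow> K * 0"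
      using pos by (intro tendsto_mult tendsto_const tendsto_neg_powr filterlim_real_sequentially) auto
    then have "\<forall>\<^sub>F n in sequentially. K * real n powr (- (\<eta> / h / 2)) < 1 / 8"
      by (rule order_tendstoD) simp
    then show ?thesis by eventually_elim simp
  qed
  ultimately have ev: "\<forall>\<^sub>F n in sequentially. bexp (all_edges n) (p n) (\<lambda>E. if \<exists>v<n. overrun (M n) {} {v} {} E then 1 else 0)
     \<le> 4 * real n powr (- 1 / (2 * real h)) + 4 / real n"
    using le eventually_ge_at_top[of 1]
  proof eventually_elim
    case (elim n)
    have log0: "0 \<le> log 2 (real n)" using elim by simp
    then have Mle: "real (M n) \<le> 2 * log 2 (real n) + 1" and Mge: "2 * log 2 (real n) \<le> real (M n)"
      unfolding M_def by linarith+
    have "real (1 + k * M n) \<le> 1 + real k * (2 * log 2 (real n) + 1)"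
      using mult_left_mono[OF Mle, of "real k"] by simp
    then have "real (1 + k * M n) \<le> real n powr \<delta>" using elim by linarith
    then have "real (1 + k * M n) ^ k \<le> (real n powr \<delta>) ^ k" by (intro power_mono) auto
    also have "\<dots> = real n powr (\<eta> / h / 2)"
      using elim k2 by (simp add: powr_realpow[symmetric] powr_powr \<delta>_def)
    finally have Rk: "real ((1 + k * M n) ^ k) \<le> real n powr (\<eta> / h / 2)" by (simp only: of_nat_power)
    have "2 ^ (2 ^ k) * 4 ^ k * real ((k + 1)\<^sup>2 * (1 + k * M n) ^ k) * real n powr (- (\<eta> / h))
       = K * real ((1 + k * M n) ^ k) * real n powr (- (\<eta> / h))" by (simp add: K_def)
    also have "\<dots> \<le> K * real n powr (\<eta> / h / 2) * real n powr (- (\<eta> / h))"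
      using Rk by (intro mult_left_mono mult_right_mono) (auto simp: K_def)
    also have "\<dots> = K * real n powr (- (\<eta> / h / 2))"
      by (simp only: mult.assoc powr_add[symmetric]) (simp add: field_simps)
    also have "\<dots> \<le> 1 / 8" using elim by simp
    finally have large: "2 ^ (2 ^ k) * 4 ^ k * real ((k + 1)\<^sup>2 * (1 + k * M n) ^ k) * real n powr (- (\<eta> / h)) \<le> 1 / 8" .
    have "real n ^ 2 = 2 powr (2 * log 2 (real n))"
      using elim by (simp add: powr_powr[symmetric] powr_log_cancel mult.commute[of 2])
    also have "\<dots> \<le> 2 powr real (M n)" using Mge by (intro powr_mono) auto
    also have "\<dots> = 2 ^ M n" by (simp add: powr_realpow)
    finally have "real n ^ 2 \<le> 2 ^ M n" .
    then show ?case using some_overrun_prob[OF _ c \<eta>_def _ _ _ c_small large] p[of n] elim by simp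
  qed
  have "(\<lambda>n. 4 * real n powr (- 1 / (2 * real h)) + 4 / real n) \<longlonglongrightarrow> 4 * 0 + 0"
    using h1 by (intro tendsto_add tendsto_mult tendsto_const tendsto_neg_powr filterlim_real_sequentially lim_const_over_n) auto
  then have "(\<lambda>n. bexp (all_edges n) (p n) (\<lambda>E. if \<exists>v<n. overrun (M n) {} {v} {} E then 1 else 0)) \<longlonglongrightarrow> 0"
    by (intro tendsto_sandwich[OF _ ev tendsto_const]) (use p in \<open>auto intro!: always_eventually bexp_nonneg\<close>)
  then show ?thesis by blast
qed

end

section \<open>Cycles\<close>

text \<open>If no copy in \<open>F\<close> led out of \<open>G\<close>, then \<Union>G would be
  closed under the copies of \<open>F\<close> meeting it, so it would contain \<Union>F, and all
  copies of \<open>F\<close> would lie in \<open>G\<close>. Arguments by a maximal subgraph use this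
  to continue.\<close>

lemma conn_union_extend:
  assumes "conn_union \<C> F" "G \<subseteq> F" "\<not> F \<subseteq> G" "\<Union>G \<noteq> {}" "\<And>X e. X \<in> \<C> \<Longrightarrow> e \<in> X \<Longrightarrow> e \<noteq> {}"
  obtains X where "X \<in> \<C>" "X \<subseteq> F" "\<not> X \<subseteq> G" "\<Union>X \<inter> \<Union>G \<noteq> {}"
proof (rule ccontr)
  note ext = that
  assume "\<not> thesis"
  then have sub: "X \<subseteq> G" if "X \<in> \<C>" "X \<subseteq> F" "\<Union>X \<inter> \<Union>G \<noteq> {}" for X using ext[of X] that by blast
  have "\<Union>F \<inter> \<Union>G \<noteq> {}" using assms(2,4) by blast
  then have FG: "\<Union>F \<subseteq> \<Union>G" using sub by (intro conn_union_closed_subset[OF assms(1)]) blast+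
  have "F \<subseteq> G"
  proof
    fix e assume "e \<in> F"
    then obtain X where X: "X \<in> \<C>" "X \<subseteq> F" "e \<in> X" using conn_union_cover[OF assms(1)] by blast
    then have "\<Union>X \<inter> \<Union>G \<noteq> {}" using assms(5)[OF X(1,3)] FG by blast
    then show "e \<in> G" using sub X by blast
  qed
  then show False using assms(3) by blast
qed

text \<open>A cycle as a periodic sequence on all natural numbers, so that walks may start anywhere
  and run past k without reducing indices.\<close>

definition cycle_param :: "nat \<Rightarrow> (nat \<Rightarrow> 'v) \<Rightarrow> 'v set set \<Rightarrow> bool" where
  "cycle_param k g X \<longleftrightarrow> (\<forall>i j. g i = g j \<longleftrightarrow> i mod k = j mod k) \<and> X = range (\<lambda>i. {g i, g (Suc i)})"

definition cycles :: "nat \<Rightarrow> 'v set set set" where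
  "cycles k = {X. is_cycle k (\<Union>X) X}"

lemma is_cycle_param:
  assumes "is_cycle k V X" "2 \<le> k"
  shows "\<exists>g. cycle_param k g X \<and> range g = V"
proof -
  obtain f where f: "bij_betw f {0..<k} V" "X = {{f i, f ((i + 1) mod k)} | i. i < k}"
    using assms unfolding is_cycle_def by blast
  define g where "g i = f (i mod k)" for i
  have k0: "0 < k" using assms by simp
  have 1: "g i = g j \<longleftrightarrow> i mod k = j mod k" for i j
    using f(1) k0 unfolding g_def bij_betw_def inj_on_def by auto
  have range_mod: "range (\<lambda>i. i mod k) = {0..<k}"
  proof
    show "{0..<k} \<subseteq> range (\<lambda>i. i mod k)"
    proof
      fix i assume "i \<in> {0..<k}"
      then have "i = i mod k" by simp
      then show "i \<in> range (\<lambda>i. i mod k)" by (rule range_eqI)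
    qed
  qed (use k0 in auto)
  have "range g = V"
  proof -
    have "range g = f ` range (\<lambda>i. i mod k)" by (auto simp: g_def)
    also note range_mod
    finally show ?thesis using f(1) by (simp add: bij_betw_def)
  qed
  moreover have "X = range (\<lambda>i. {g i, g (Suc i)})"
  proof -
    have "{g i, g (Suc i)} = {f (i mod k), f ((i mod k + 1) mod k)}" for i
      by (simp add: g_def mod_Suc_eq)
    then have "range (\<lambda>i. {g i, g (Suc i)}) = (\<lambda>i. {f i, f ((i + 1) mod k)}) ` range (\<lambda>i. i mod k)"
      by auto
    also note range_mod
    finally show ?thesis using f(2) by auto
  qed
  ultimately show ?thesis using 1 unfolding cycle_param_def by blast
qed

section \<open>Walking along a cycle\<close>

context
  fixes k :: nat and g :: "nat \<Rightarrow> 'v" and X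
  assumes k3: "3 \<le> k" and g: "cycle_param k g X"
begin

lemma cyc_eq: "g i = g j \<longleftrightarrow> i mod k = j mod k"
  using g by (simp add: cycle_param_def)

lemma cyc_X: "X = range (\<lambda>i. {g i, g (Suc i)})"
  using g by (simp add: cycle_param_def)

lemma cyc_edge_in: "{g i, g (Suc i)} \<in> X"
  unfolding cyc_X by blast

lemma cyc_period: "g (i + k) = g i" "g (k + i) = g i" "g (i mod k) = g i"
  by (simp_all add: cyc_eq)

lemma cyc_Suc_mod: "g (Suc (i mod k)) = g (Suc i)"
  by (simp add: cyc_eq mod_Suc_eq)

lemma cyc_Union: "\<Union>X = range g"
  unfolding cyc_X by auto

lemma cyc_neq_Suc: "g i \<noteq> g (Suc i)" "g i \<noteq> g (Suc (Suc i))"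
  using k3 by (auto simp: cyc_eq mod_Suc)

lemma cyc_edge_eq: "{g i, g (Suc i)} = {g j, g (Suc j)} \<longleftrightarrow> i mod k = j mod k"
proof
  assume "{g i, g (Suc i)} = {g j, g (Suc j)}"
  then consider "g i = g j" | "g i = g (Suc j)" "g (Suc i) = g j" by (auto simp: doubleton_eq_iff)
  then show "i mod k = j mod k"
  proof cases
    case 2
    then have "g (Suc i) = g (Suc (Suc j))" by (metis cyc_eq mod_Suc_eq)
    then show ?thesis using 2 cyc_neq_Suc[of j] by (metis)
  qed (simp add: cyc_eq)
next
  assume "i mod k = j mod k"
  then show "{g i, g (Suc i)} = {g j, g (Suc j)}" by (metis cyc_eq cyc_Suc_mod)
qed

lemma cyc_card_edge: "e \<in> X \<Longrightarrow> card e = 2"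
  unfolding cyc_X using cyc_neq_Suc(1) by (auto simp: card_insert_if)

lemma cyc_inj_window: "r \<le> k \<Longrightarrow> inj_on (\<lambda>j. (i + j) mod k) {..<r}"
proof (rule linorder_inj_onI)
  fix x y assume r: "r \<le> k" and xy: "x < y" "x \<in> {..<r}" "y \<in> {..<r}"
  show "(i + x) mod k \<noteq> (i + y) mod k"
  proof
    assume "(i + x) mod k = (i + y) mod k"
    then have "k dvd (i + y) - (i + x)" using xy mod_eq_dvd_iff_nat[of "i + x" "i + y" k] by simp
    then show False using xy r by (auto dest!: dvd_imp_le)
  qed
qed auto

lemma cyc_inj_edges: "r \<le> k \<Longrightarrow> inj_on (\<lambda>j. {g (i + j), g (Suc (i + j))}) {..<r}"
  using cyc_inj_window[of r i] by (auto simp: inj_on_def cyc_edge_eq)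

lemma cyc_inj_verts: "r \<le> k \<Longrightarrow> inj_on (\<lambda>j. g (i + j)) {..<r}"
  using cyc_inj_window[of r i] by (auto simp: inj_on_def cyc_eq)

lemma cyc_X_window: "X = (\<lambda>j. {g j, g (Suc j)}) ` {..<k}"
proof -
  have "{g i, g (Suc i)} = {g (i mod k), g (Suc (i mod k))}" for i by (simp add: cyc_period cyc_Suc_mod)
  moreover have "i mod k \<in> {..<k}" for i using k3 by simp
  ultimately show ?thesis unfolding cyc_X by blast
qed

lemma cyc_V_window: "\<Union>X = g ` {..<k}"
proof -
  have "g i = g (i mod k)" for i by (simp add: cyc_period)
  moreover have "i mod k \<in> {..<k}" for i using k3 by simp
  ultimately show ?thesis unfolding cyc_Union by blast
qed

lemma cyc_card: "card X = k" "card (\<Union>X) = k"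
  unfolding cyc_X_window[THEN arg_cong[of _ _ card]] cyc_V_window
  using cyc_inj_edges[of k 0] cyc_inj_verts[of k 0] by (auto simp: card_image)

lemma cyc_entry:
  assumes "g i0 \<in> U" "\<Union>X - U \<noteq> {}"
  obtains i where "g i \<in> U" "g (Suc i) \<notin> U"
proof -
  obtain j0 where j0: "g j0 \<notin> U" using assms(2) cyc_Union by auto
  \<comment> \<open>Adding whole turns moves \<open>j0\<close> beyond \<open>i0\<close>, so the walk
    from \<open>i0\<close> goes forward and must leave \<open>U\<close> on the way.\<close>
  define j where "j = j0 + k * (i0 + 1)"
  have "g j = g j0" unfolding cyc_eq j_def by (simp only: mod_mult_self2)
  then have "g j \<notin> U" using j0 by simp
  moreover have "1 * (i0 + 1) \<le> k * (i0 + 1)" using k3 by (intro mult_le_mono1) simp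
  then have "i0 \<le> j" by (simp add: j_def)
  ultimately have "\<exists>i\<ge>i0. g i \<in> U \<and> g (Suc i) \<notin> U"
  proof (induction j)
    case 0
    then show ?case using assms by auto
  next
    case (Suc j)
    then show ?case using assms(1) by (metis le_SucE)
  qed
  then show ?thesis using that by blast
qed

text \<open>With \<open>a\<close> vertices outside \<open>U\<close>, the edges starting at them and
  an edge leaving \<open>U\<close> are a + 1 distinct members of \<open>D\<close>. Since (k - 1) (a
  + 1) - k a = k - 1 - a, the gain is positive unless a = k - 1, and then \<open>D\<close> is the
  whole cycle.\<close>

lemma cyc_balanced:
  assumes "\<Union>X \<inter> U \<noteq> {}" "D \<subseteq> X" "D \<noteq> {}" "\<And>e. e \<in> X \<Longrightarrow> e \<subseteq> U \<or> e \<in> D"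
  shows "card (\<Union>X - U) = k - 1 \<and> D = X \<or> k * card (\<Union>X - U) + 1 \<le> (k - 1) * card D"
proof -
  let ?a = "card (\<Union>X - U)"
  have finX: "finite X" "finite (\<Union>X)" using cyc_card k3 card.infinite by fastforce+
  have finD: "finite D" using finite_subset[OF assms(2) finX(1)] .
  show ?thesis
  proof (cases "\<Union>X - U = {}")
    case True
    have "1 \<le> card D" using finD assms(3) by (simp add: Suc_leI card_gt_0_iff)
    then have "(k - 1) * 1 \<le> (k - 1) * card D" by (intro mult_le_mono2)
    then have "1 \<le> (k - 1) * card D" using k3 by linarith
    then show ?thesis unfolding True by simp
  next
    case False
    obtain i0 where "g i0 \<in> U" using assms(1) cyc_Union by auto
    then obtain i where i: "g i \<in> U" "g (Suc i) \<notin> U" using cyc_entry False by metis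
    define I where "I = {j\<in>{..<k}. g j \<notin> U}"
    define E where "E j = {g j, g (Suc j)}" for j
    have injE: "inj_on E {..<k}" using cyc_inj_edges[of k 0] by (simp add: E_def inj_on_def)
    have "\<Union>X - U = g ` I" unfolding cyc_V_window by (auto simp: I_def)
    moreover have "inj_on g I" using cyc_inj_verts[of k 0] by (auto simp: I_def inj_on_def)
    ultimately have cI: "card I = ?a" by (simp add: card_image)
    have ik: "i mod k \<in> {..<k}" "i mod k \<notin> I" using k3 i by (auto simp: I_def cyc_period)
    have "E ` (insert (i mod k) I) \<subseteq> D"
    proof
      fix e assume "e \<in> E ` (insert (i mod k) I)"
      then obtain j where j: "e = E j" "j = i mod k \<or> j \<in> I" by blast
      have "e \<in> X" using j unfolding cyc_X E_def by auto
      moreover have "\<not> e \<subseteq> U" using j i by (auto simp: E_def I_def cyc_Suc_mod)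
      ultimately show "e \<in> D" using assms(4) by blast
    qed
    then have "card (E ` (insert (i mod k) I)) \<le> card D" using finD card_mono by blast
    moreover have "card (E ` (insert (i mod k) I)) = card (insert (i mod k) I)"
      by (intro card_image inj_on_subset[OF injE]) (use ik in \<open>auto simp: I_def\<close>)
    moreover have "card (insert (i mod k) I) = ?a + 1" using ik cI by (simp add: I_def)
    ultimately have aD: "?a + 1 \<le> card D" by simp
    have Dk: "card D \<le> k" using card_mono[OF finX(1) assms(2)] cyc_card by simp
    show ?thesis
    proof (cases "?a = k - 1")
      case True
      then have "card D = card X" using aD Dk cyc_card k3 by linarith
      then have "D = X" using assms(2) finX card_subset_eq by blast
      then show ?thesis using True by blast
    next
      case False
      then have "?a + 2 \<le> k" using aD Dk by linarith
      then obtain d where d: "k = ?a + 2 + d" using le_Suc_ex by blast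
      have "k * ?a + 1 \<le> (k - 1) * (?a + 1)" unfolding d by (simp add: algebra_simps)
      also have "\<dots> \<le> (k - 1) * card D" using aD by (intro mult_le_mono2)
      finally show ?thesis by blast
    qed
  qed
qed

lemma cyc_degree_two:
  assumes "e \<in> X" "z \<in> e"
  shows "\<exists>e'\<in>X. e' \<noteq> e \<and> z \<in> e'"
proof -
  obtain i where i: "e = {g i, g (Suc i)}" using assms cyc_X by auto
  show ?thesis
  proof (cases "z = g (Suc i)")
    case True
    have "{g (Suc i), g (Suc (Suc i))} \<noteq> e"
      unfolding i cyc_edge_eq using cyc_neq_Suc(1)[of i] by (simp add: cyc_eq)
    moreover have "{g (Suc i), g (Suc (Suc i))} \<in> X" using cyc_edge_in by blast
    ultimately show ?thesis using True by (intro bexI[of _ "{g (Suc i), g (Suc (Suc i))}"] conjI) simp_all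
  next
    case False
    then have z: "z = g i" using assms i by auto
    obtain j where j: "Suc j = i + k" using k3 by (metis add_gr_0 gr0_conv_Suc less_le_trans zero_less_numeral)
    have gj: "g (Suc j) = g i" by (simp add: j cyc_period)
    have "{g j, g (Suc j)} \<noteq> e"
    proof
      assume "{g j, g (Suc j)} = e"
      then have "j mod k = i mod k" unfolding i using cyc_edge_eq by blast
      then have "g j = g (Suc j)" using gj cyc_eq by metis
      then show False using cyc_neq_Suc(1) by blast
    qed
    moreover have "{g j, g (Suc j)} \<in> X" by (rule cyc_edge_in)
    ultimately show ?thesis using z gj by (intro bexI[of _ "{g j, g (Suc j)}"] conjI) simp_all
  qed
qed

text \<open>The ear starts in \<open>U\<close> with a missing edge and ends at the first return to
  \<open>U\<close>. The value r = 1 is a single edge between old vertices, and r = k is the full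
  cycle hanging at one vertex of \<open>U\<close>.\<close>

lemma cyc_ear:
  assumes "\<Union>X \<inter> U \<noteq> {}" "\<Union>F \<subseteq> U" "\<not> X \<subseteq> F"
  obtains i r where "1 \<le> r" "r \<le> k" "g i \<in> U" "g (i + r) \<in> U" "\<And>j. 0 < j \<Longrightarrow> j < r \<Longrightarrow> g (i + j) \<notin> U"
    "{g i, g (Suc i)} \<notin> F"
proof -
  have "\<exists>i. g i \<in> U \<and> {g i, g (Suc i)} \<notin> F"
  proof (cases "\<Union>X - U = {}")
    case True
    then show ?thesis using assms(3) cyc_X cyc_Union by blast
  next
    case False
    obtain i0 where "g i0 \<in> U" using assms(1) cyc_Union by auto
    then obtain i where "g i \<in> U" "g (Suc i) \<notin> U" using cyc_entry False by metis
    then show ?thesis using assms(2) by blast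
  qed
  then obtain i where i: "g i \<in> U" "{g i, g (Suc i)} \<notin> F" by blast
  define P where "P r \<longleftrightarrow> 1 \<le> r \<and> g (i + r) \<in> U" for r
  have Pk: "P k" using i k3 by (simp add: P_def cyc_period)
  define r where "r = (LEAST r. P r)"
  have "P r" "r \<le> k" unfolding r_def using Pk by (auto intro: LeastI Least_le)
  moreover have "\<not> P j" if "j < r" for j using that not_less_Least unfolding r_def by blast
  ultimately show ?thesis using i that[of r i] unfolding P_def by force
qed

end


lemma cycles_param:
  assumes "X \<in> cycles k" "3 \<le> k"
  obtains g where "cycle_param k g X"
  using is_cycle_param[of k "\<Union>X" X] assms by (auto simp: cycles_def)

lemma copy_family_cycles:
  assumes "3 \<le> k"
  shows "copy_family (cycles k) k k"
proof
  show "2 \<le> k" "1 \<le> k" using assms by auto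
  fix X :: "'a set set" assume X: "X \<in> cycles k"
  then obtain g where g: "cycle_param k g X" using cycles_param assms by metis
  show "card X = k" "card (\<Union>X) = k" using cyc_card[OF assms g] by auto
  show "card e = 2" if "e \<in> X" for e using cyc_card_edge[OF assms g that] .
  show "card (\<Union>X - U) = k - 1 \<and> D = X \<or> k * card (\<Union>X - U) + 1 \<le> (k - 1) * card D"
    if "\<Union>X \<inter> U \<noteq> {}" "D \<subseteq> X" "D \<noteq> {}" "\<And>e. e \<in> X \<Longrightarrow> e \<subseteq> U \<or> e \<in> D" for U D
    by (rule cyc_balanced[OF assms g]) (use that in auto)
qed

text \<open>
  An ear with \<open>a\<close> inner vertices lowers the potential \<open>k v - (k - 1) e\<close> by \<open>k - 1 - a\<close>, which is at least
  \<open>(k - 1) / 2\<close> times its contribution \<open>2 - a\<close> to the deficit.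
\<close>

definition ear_built :: "nat \<Rightarrow> nat \<Rightarrow> 'v set set \<Rightarrow> bool" where
  "ear_built c k F \<longleftrightarrow> finite F \<and> \<Union>F \<noteq> {} \<and> (\<exists>\<S> B. pairable c (\<Union>F) \<S> B \<and>
     (\<forall>Y\<in>cycles k. Y \<subseteq> F \<longrightarrow> (\<exists>S\<in>\<S>. S \<subseteq> \<Union>Y)) \<and>
     2 * k * card (\<Union>F) + (k - 1) * B \<le> 2 * k + 2 * (k - 1) * card F)"

lemma ear_built_single:
  assumes "X \<in> cycles k" and k: "3 \<le> k" and c: "c + 1 < (k - 1) * c"
  shows "ear_built c k X"
proof -
  interpret copy_family "cycles k" k k by (rule copy_family_cycles[OF k])
  have card: "card X = k" "card (\<Union>X) = k" using assms card_copy card_verts by auto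
  have "pairable c (\<Union>X) {\<Union>X} 0"
    by (rule pairable_base[where k = k]) (use card c finite_verts assms in auto)
  moreover have "Y = X" if "Y \<in> cycles k" "Y \<subseteq> X" for Y
    using that card card_copy[of Y] finite_copy assms(1) card_subset_eq by metis
  \<comment> \<open>A single cycle attains the bound of \<open>ear_built\<close> with equality; this
    fixes the constant term 2 k.\<close>
  moreover have "2 * k * k = 2 * k + 2 * (k - 1) * k" by (cases k) simp_all
  moreover have "\<Union>X \<noteq> {}" using card k by fastforce
  ultimately show ?thesis unfolding ear_built_def using card finite_copy[OF assms(1)]
    by (intro conjI exI[of _ "{\<Union>X}"] exI[of _ 0]) auto
qed

text \<open>Only the ear is added, not all of \<open>X\<close>. Its inner vertices have degree 2 in
  the enlarged graph, so every cycle with a new edge runs through the whole ear, and one pair inside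
  the ear serves all cycles that it completes. Hence the intermediate graphs need not be unions of
  copies.\<close>

lemma ear_built_step:
  assumes F: "ear_built c k F" and X: "X \<in> cycles k" "\<Union>X \<inter> \<Union>F \<noteq> {}" "\<not> X \<subseteq> F"
    and k: "3 \<le> k" and c: "1 \<le> c" "c + 1 < (k - 1) * c"
  shows "\<exists>F'. F \<subset> F' \<and> F' \<subseteq> F \<union> X \<and> ear_built c k F'"
proof -
  obtain g where g: "cycle_param k g X" using cycles_param X k by metis
  note [simp] = cyc_period[OF k g]
  let ?U = "\<Union>F"
  obtain i r where ir: "1 \<le> r" "r \<le> k" "g i \<in> ?U" "g (i + r) \<in> ?U" "\<And>j. 0 < j \<Longrightarrow> j < r \<Longrightarrow> g (i + j) \<notin> ?U"
    "{g i, g (Suc i)} \<notin> F"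
    using cyc_ear[OF k g X(2) subset_refl X(3)] by metis
  define ear where "ear j = {g (i + j), g (Suc (i + j))}" for j
  define A where "A = ear ` {..<r}"
  define S where "S = (\<lambda>j. g (i + j)) ` {..r}"
  obtain \<S> B where SB: "pairable c ?U \<S> B" "\<forall>Y\<in>cycles k. Y \<subseteq> F \<longrightarrow> (\<exists>S\<in>\<S>. S \<subseteq> \<Union>Y)"
     "2 * k * card ?U + (k - 1) * B \<le> 2 * k + 2 * (k - 1) * card F" and finF: "finite F" and neF: "?U \<noteq> {}"
    using F unfolding ear_built_def by blast
  have finU: "finite ?U" using SB(1) by (simp add: pairable_def)
  have earF: "ear j \<notin> F" if "j < r" for j
  proof (cases "j = 0")
    case True
    then show ?thesis using ir(6) by (simp add: ear_def)
  next
    case False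
    then have "g (i + j) \<notin> ?U" using ir(5) that by simp
    then show ?thesis by (auto simp: ear_def)
  qed
  have AF: "A \<inter> F = {}" using earF by (auto simp: A_def)
  have cA: "card A = r" unfolding A_def
    using cyc_inj_edges[OF k g ir(2), of i] by (simp add: card_image ear_def[abs_def])
  have UA: "\<Union>A = S"
  proof
    show "\<Union>A \<subseteq> S"
    proof
      fix x assume "x \<in> \<Union>A"
      then obtain j where "j < r" "x = g (i + j) \<or> x = g (i + Suc j)" by (auto simp: A_def ear_def)
      then show "x \<in> S" unfolding S_def by (metis atMost_iff image_eqI less_imp_le_nat Suc_leI)
    qed
    show "S \<subseteq> \<Union>A"
    proof
      fix x assume "x \<in> S"
      then obtain j where j: "j \<le> r" "x = g (i + j)" by (auto simp: S_def)
      show "x \<in> \<Union>A"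
      proof (cases "j < r")
        case True
        then show ?thesis using j by (auto simp: A_def ear_def)
      next
        case False
        then have "x = g (Suc (i + (r - 1)))" using j ir(1) by simp
        then show ?thesis using ir(1) by (auto simp: A_def ear_def intro!: bexI[of _ "r - 1"])
      qed
    qed
  qed
  have own: "S - ?U = (\<lambda>j. g (i + j)) ` {1..<r}"
  proof
    show "S - ?U \<subseteq> (\<lambda>j. g (i + j)) ` {1..<r}"
    proof
      fix x assume "x \<in> S - ?U"
      then obtain j where j: "j \<le> r" "x = g (i + j)" "x \<notin> ?U" by (auto simp: S_def)
      have "j \<noteq> 0" using j ir(3) by (metis add_0_right)
      moreover have "j \<noteq> r" using j ir(4) by metis
      ultimately have "j \<in> {1..<r}" using j(1) by simp
      then show "x \<in> (\<lambda>j. g (i + j)) ` {1..<r}" using j(2) by blast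
    qed
    show "(\<lambda>j. g (i + j)) ` {1..<r} \<subseteq> S - ?U" using ir(5) by (auto simp: S_def)
  qed
  have cown: "card (S - ?U) = r - 1"
  proof -
    have "inj_on (\<lambda>j. g (i + j)) {1..<r}"
      by (rule inj_on_subset[OF cyc_inj_verts[OF k g ir(2), of i]]) auto
    then show ?thesis unfolding own by (simp add: card_image)
  qed
  \<comment> \<open>A closed ear meets the old vertices once but brings k - 1 new ones; any other
    ear has two distinct old ends.\<close>
  have SU: "2 \<le> card (S \<inter> ?U) \<or> (S \<inter> ?U \<noteq> {} \<and> k - 1 \<le> card (S - ?U))"
  proof (cases "r = k")
    case True
    have "g i \<in> S" by (force simp: S_def)
    then show ?thesis using True cown ir(3) by auto
  next
    case False
    have "g i \<noteq> g (i + r)"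
    proof
      assume "g i = g (i + r)"
      then have "(\<lambda>j. g (i + j)) 0 = (\<lambda>j. g (i + j)) r" by simp
      then have "0 = r" using inj_onD[OF cyc_inj_verts[OF k g order_refl, of i]] False ir(2) by (metis (no_types, lifting) lessThan_iff le_neq_implies_less gr_zeroI k not_numeral_le_zero)
      then show False using ir(1) by simp
    qed
    moreover have "g i \<in> S" "g (i + r) \<in> S" by (force simp: S_def)+
    ultimately have "{g i, g (i + r)} \<subseteq> S \<inter> ?U" "card {g i, g (i + r)} = 2" using ir by auto
    then show ?thesis using finU card_mono by (metis finite_Int)
  qed
  have P': "pairable c (?U \<union> S) (insert S \<S>) (B + (2 - card (S - ?U)))"
    by (rule pairable_step[OF SB(1) c _ SU]) (simp add: S_def)
  let ?F = "F \<union> A"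
  have UF: "\<Union>?F = ?U \<union> S" using UA by auto
  have earX: "ear j \<in> X" for j unfolding cyc_X[OF k g] ear_def by auto
  have new: "S \<subseteq> \<Union>Y" if Y: "Y \<in> cycles k" "Y \<subseteq> ?F" "\<not> Y \<subseteq> F" for Y
  proof -
    obtain gY where gY: "cycle_param k gY Y" using cycles_param Y k by metis
    \<comment> \<open>An inner vertex lies on only two edges of \<open>?F\<close>, both on the ear,
      while a cycle has two edges at each of its vertices.\<close>
    have adj: "ear j \<in> Y \<longleftrightarrow> ear (Suc j) \<in> Y" if j: "Suc j < r" for j
    proof -
      let ?z = "g (i + Suc j)"
      have zU: "?z \<notin> ?U" using ir(5)[of "Suc j"] j by simp
      have only: "e = ear j \<or> e = ear (Suc j)" if "e \<in> Y" "?z \<in> e" for e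
      proof -
        have "e \<in> A" using that Y(2) zU by auto
        then obtain l where l: "l < r" "e = ear l" by (auto simp: A_def)
        then have "?z = g (i + l) \<or> ?z = g (i + Suc l)" using that by (auto simp: ear_def)
        then consider "?z = g (i + l)" | "?z = g (i + Suc l)" "Suc l < r" | "?z = g (i + r)" using l(1)
          by (metis Suc_lessI)
        then show ?thesis
        proof cases
          case 1
          then have "Suc j = l" using inj_onD[OF cyc_inj_verts[OF k g ir(2), of i]] l j by blast
          then show ?thesis using l by simp
        next
          case 2
          then have "Suc j = Suc l" using inj_onD[OF cyc_inj_verts[OF k g ir(2), of i]] l j by blast
          then show ?thesis using l by simp
        next
          case 3
          then show ?thesis using zU ir(4) by simp
        qed
      qed
      have z: "?z \<in> ear j" "?z \<in> ear (Suc j)" by (auto simp: ear_def)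
      have "ear (Suc j) \<in> Y" if "ear j \<in> Y"
        using cyc_degree_two[OF k gY that z(1)] only by metis
      moreover have "ear j \<in> Y" if "ear (Suc j) \<in> Y"
        using cyc_degree_two[OF k gY that z(2)] only by metis
      ultimately show ?thesis by blast
    qed
    have all: "ear j \<in> Y \<longleftrightarrow> ear 0 \<in> Y" if "j < r" for j
      using that by (induction j) (use adj in auto)
    obtain e where "e \<in> Y" "e \<notin> F" using Y(3) by blast
    then have "e \<in> A" using Y(2) by blast
    then obtain j where "j < r" "ear j \<in> Y" using \<open>e \<in> Y\<close> by (auto simp: A_def)
    then have "ear l \<in> Y" if "l < r" for l using all[of j] all[OF that] by blast
    then have "A \<subseteq> Y" by (auto simp: A_def)
    then show ?thesis using UA by blast
  qed
  have "ear_built c k ?F" unfolding ear_built_def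
  proof (intro conjI exI)
    show "finite ?F" using finF by (simp add: A_def)
    show "\<Union>?F \<noteq> {}" using neF by auto
    show "pairable c (\<Union>?F) (insert S \<S>) (B + (2 - card (S - ?U)))" using P' UF by simp
    show "\<forall>Y\<in>cycles k. Y \<subseteq> ?F \<longrightarrow> (\<exists>S\<in>insert S \<S>. S \<subseteq> \<Union>Y)"
    proof (intro ballI impI)
      fix Y assume Y: "Y \<in> cycles k" "Y \<subseteq> ?F"
      show "\<exists>S\<in>insert S \<S>. S \<subseteq> \<Union>Y"
      proof (cases "Y \<subseteq> F")
        case True
        then show ?thesis using SB(2) Y(1) by auto
      next
        case False
        then show ?thesis using new[OF Y] by blast
      qed
    qed
    have cU: "card (\<Union>?F) = card ?U + (r - 1)"
    proof -
      have "?U \<union> S = ?U \<union> (S - ?U)" by auto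
      then show ?thesis unfolding UF using cown finU by (simp add: card_Un_disjoint S_def del: Un_Diff_cancel)
    qed
    have cF: "card ?F = card F + r" using AF finF cA by (simp add: card_Un_disjoint A_def Int_commute)
    obtain r' k' where rk: "r = Suc r'" "k = Suc k'" using ir(1) k by (metis Suc_le_D numeral_3_eq_3 One_nat_def)
    have le: "r' \<le> k'" "2 \<le> k'" using ir(2) k rk by auto
    \<comment> \<open>Here \<open>r'\<close> is the number of inner vertices and 2 - r' the
      truncated growth of the deficit. The case r' = 1 uses k >= 3, the case of larger
      \<open>r'\<close> uses r' <= k - 1.\<close>
    have "2 * k * r' + k' * (2 - r') \<le> 2 * k' * r"
    proof -
      consider "r' = 0" | "r' = 1" | "2 \<le> r'" by linarith
      then show ?thesis by cases (use le rk in auto)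
    qed
    then show "2 * k * card (\<Union>?F) + (k - 1) * (B + (2 - card (S - ?U))) \<le> 2 * k + 2 * (k - 1) * card ?F"
      using SB(3) unfolding cU cF cown using rk by (simp add: algebra_simps)
  qed
  moreover have "A \<noteq> {}" using cA ir(1) by auto
  then have "F \<subset> ?F" using AF by blast
  moreover have "?F \<subseteq> F \<union> X" using earX by (auto simp: A_def)
  ultimately show ?thesis by blast
qed

text \<open>Ears are added until \<open>F\<close> is exhausted. Sparsity keeps the potential
  nonnegative, so (k - 1) B <= 2 k, and the last condition on \<open>c\<close> turns this into B <=
  c + 1, the largest deficit that still admits the zero reservation.\<close>

lemma cycle_pairs:
  assumes k: "3 \<le> k" and c: "1 \<le> c" "c + 1 < (k - 1) * c" "2 * k < (k - 1) * (c + 2)"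
    and F: "conn_union (cycles k) F" "\<not> dense_edges k k (\<Union>F) F" "finite F"
  obtains D where "\<forall>e\<in>D. e \<subseteq> \<Union>F \<and> card e = 2" "\<forall>Y\<in>cycles k. Y \<subseteq> F \<longrightarrow> (\<exists>e\<in>D. e \<subseteq> \<Union>Y)"
    "\<forall>v\<in>\<Union>F. card {e\<in>D. v \<in> e} \<le> c"
proof -
  interpret copy_family "cycles k" k k by (rule copy_family_cycles[OF k])
  obtain X0 where X0: "X0 \<in> cycles k" "X0 \<subseteq> F"
    using F(1) by (induction rule: conn_union.induct) auto
  define \<G> where "\<G> = {G. G \<subseteq> F \<and> ear_built c k G}"
  have "finite \<G>" using F(3) by (simp add: \<G>_def)
  moreover have "X0 \<in> \<G>" using X0 ear_built_single[OF _ k c(2)] by (simp add: \<G>_def)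
  ultimately obtain G where G: "G \<in> \<G>" "\<And>G'. G' \<in> \<G> \<Longrightarrow> G \<subseteq> G' \<Longrightarrow> G = G'"
    using finite_has_maximal[of \<G>] by auto
  have built: "ear_built c k G" "G \<subseteq> F" using G by (auto simp: \<G>_def)
  have "F \<subseteq> G"
  proof (rule ccontr)
    assume nF: "\<not> F \<subseteq> G"
    have ne: "\<Union>G \<noteq> {}" using built by (simp add: ear_built_def)
    obtain X where X: "X \<in> cycles k" "X \<subseteq> F" "\<not> X \<subseteq> G" "\<Union>X \<inter> \<Union>G \<noteq> {}"
      using conn_union_extend[OF F(1) built(2) nF ne] card_edge by (metis card.empty zero_neq_numeral)
    obtain G' where "G \<subset> G'" "G' \<subseteq> G \<union> X" "ear_built c k G'"
      using ear_built_step[OF built(1) X(1,4,3) k c(1,2)] by blast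
    then show False using G(2)[of G'] X built by (auto simp: \<G>_def)
  qed
  then have "ear_built c k F" using built by auto
  then obtain \<S> B where SB: "pairable c (\<Union>F) \<S> B" "\<forall>Y\<in>cycles k. Y \<subseteq> F \<longrightarrow> (\<exists>S\<in>\<S>. S \<subseteq> \<Union>Y)"
     "2 * k * card (\<Union>F) + (k - 1) * B \<le> 2 * k + 2 * (k - 1) * card F"
    unfolding ear_built_def by blast
  have "(k - 1) * card F \<le> k * card (\<Union>F)" using F(2) by (simp add: dense_edges_def)
  then have kB: "(k - 1) * B \<le> 2 * k" using SB(3) by (simp add: mult.assoc)
  have Bc: "B \<le> c + 1"
  proof (rule ccontr)
    assume "\<not> B \<le> c + 1"
    then have "(k - 1) * (c + 2) \<le> (k - 1) * B" by (intro mult_le_mono2) simp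
    then show False using kB c(3) by simp
  qed
  obtain D where D: "\<forall>e\<in>D. e \<subseteq> \<Union>F \<and> card e = 2" "\<forall>S\<in>\<S>. \<exists>e\<in>D. e \<subseteq> S"
    "\<forall>v\<in>\<Union>F. card {e\<in>D. v \<in> e} \<le> c"
    by (rule pairable_obtain[OF SB(1) Bc])
  have "\<forall>Y\<in>cycles k. Y \<subseteq> F \<longrightarrow> (\<exists>e\<in>D. e \<subseteq> \<Union>Y)" using D(2) SB(2) by (metis order_trans)
  then show ?thesis using that[of D] D by blast
qed

section \<open>Cliques\<close>

context copy_family
begin

lemma conn_union_finite: "conn_union \<C> F \<Longrightarrow> finite F \<and> finite (\<Union>F) \<and> \<Union>F \<noteq> {}"
proof (induction rule: conn_union.induct)
  case (single X)
  have "card (\<Union>X) \<noteq> 0" using card_verts[OF single] k2 by simp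
  then have "\<Union>X \<noteq> {}" by (metis card.empty)
  then show ?case using finite_copy[OF single] finite_verts[OF single] by simp
next
  case (attach F X)
  then show ?case using finite_copy[OF attach.hyps(2)] finite_verts[OF attach.hyps(2)]
    by (simp only: Union_Un_distrib) blast
qed

text \<open>Attaching a copy never raises h v - (k - 1) e, so a dense sub-union stays dense while it
  is extended to \<open>F\<close>.\<close>

lemma conn_union_not_dense_subset:
  assumes F: "conn_union \<C> F" "\<not> dense_edges k h (\<Union>F) F" and G: "conn_union \<C> G" "G \<subseteq> F"
  shows "\<not> dense_edges k h (\<Union>G) G"
proof
  assume dG: "dense_edges k h (\<Union>G) G"
  define \<G> where "\<G> = {G. G \<subseteq> F \<and> conn_union \<C> G \<and> dense_edges k h (\<Union>G) G}"
  have "finite \<G>" using conn_union_finite[OF F(1)] by (simp add: \<G>_def)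
  moreover have "G \<in> \<G>" using G dG by (simp add: \<G>_def)
  ultimately obtain M where M: "M \<in> \<G>" "\<And>M'. M' \<in> \<G> \<Longrightarrow> M \<subseteq> M' \<Longrightarrow> M = M'"
    using finite_has_maximal[of \<G>] by auto
  have M': "M \<subseteq> F" "conn_union \<C> M" "dense_edges k h (\<Union>M) M" using M by (auto simp: \<G>_def)
  have "\<not> F \<subseteq> M" using M' F(2) by (metis subset_antisym)
  then obtain X where X: "X \<in> \<C>" "X \<subseteq> F" "\<not> X \<subseteq> M" "\<Union>X \<inter> \<Union>M \<noteq> {}"
    using conn_union_extend[OF F(1) M'(1)] card_edge conn_union_finite[OF M'(2)] by (metis card.empty zero_neq_numeral)
  have fin: "finite M" "finite (\<Union>M)" using conn_union_finite[OF M'(2)] by auto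
  have "\<Union>(M \<union> X) = \<Union>M \<union> (\<Union>X - \<Union>M)" by auto
  then have 1: "card (\<Union>(M \<union> X)) = card (\<Union>M) + card (\<Union>X - \<Union>M)"
    using fin finite_verts[OF X(1)] by (simp only:) (intro card_Un_disjoint; auto)
  have 2: "card (M \<union> X) = card M + card (X - M)"
    using fin finite_copy[OF X(1)] card_Un_disjoint[of M "X - M"] by auto
  have "h * card (\<Union>X - \<Union>M) \<le> (k - 1) * card (X - M)"
    by (rule loss_nonneg) (use X in auto)
  then have "dense_edges k h (\<Union>(M \<union> X)) (M \<union> X)"
    using M'(3) unfolding dense_edges_def 1 2 by (simp add: distrib_left)
  moreover have "conn_union \<C> (M \<union> X)" by (rule conn_union.attach[OF M'(2) X(1,4)])
  ultimately have "M \<union> X \<in> \<G>" using X M' by (simp add: \<G>_def)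
  then show False using M(2)[of "M \<union> X"] X by auto
qed

end

section \<open>Complete graphs as sets of pairs\<close>

definition pairs :: "'v set \<Rightarrow> 'v set set" where
  "pairs V = {e. e \<subseteq> V \<and> card e = 2}"

definition cliques :: "nat \<Rightarrow> 'v set set set" where
  "cliques k = {X. is_complete k (\<Union>X) X}"

lemma two_choose_two: "2 * (n choose 2) = n * (n - 1)"
proof -
  have "2 dvd n * (n - 1)" by (cases n) auto
  then show ?thesis by (simp add: choose_two)
qed

lemma card_pairs: "finite V \<Longrightarrow> card (pairs V) = card V choose 2"
  unfolding pairs_def by (rule n_subsets)

lemma finite_pairs: "finite V \<Longrightarrow> finite (pairs V)"
  unfolding pairs_def by auto

lemma pair_in_pairs: "x \<in> V \<Longrightarrow> y \<in> V \<Longrightarrow> x \<noteq> y \<Longrightarrow> {x, y} \<in> pairs V"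
  by (simp add: pairs_def)

lemma pairs_mono: "V \<subseteq> W \<Longrightarrow> pairs V \<subseteq> pairs W"
  by (auto simp: pairs_def)

lemma pairs_cases:
  assumes "e \<in> pairs V"
  obtains x y where "e = {x, y}" "x \<in> V" "y \<in> V" "x \<noteq> y"
  using assms unfolding pairs_def by (auto simp: card_2_iff)

lemma Union_pairs:
  assumes "2 \<le> card V"
  shows "\<Union>(pairs V) = V"
proof
  show "\<Union>(pairs V) \<subseteq> V" by (auto simp: pairs_def)
  show "V \<subseteq> \<Union>(pairs V)"
  proof
    fix x assume x: "x \<in> V"
    obtain a b where ab: "a \<in> V" "b \<in> V" "a \<noteq> b" using two_le_card_obtain[OF assms] by metis
    then obtain y where "y \<in> V" "y \<noteq> x" by metis
    then have "{x, y} \<in> pairs V" using x by (intro pair_in_pairs) auto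
    then show "x \<in> \<Union>(pairs V)" by blast
  qed
qed

lemma cliques_iff:
  assumes "2 \<le> k"
  shows "X \<in> cliques k \<longleftrightarrow> (\<exists>V. card V = k \<and> X = pairs V)"
proof
  assume "X \<in> cliques k"
  then show "\<exists>V. card V = k \<and> X = pairs V" unfolding cliques_def is_complete_def pairs_def by blast
next
  assume "\<exists>V. card V = k \<and> X = pairs V"
  then obtain V where V: "card V = k" "X = pairs V" by blast
  then have "finite V" using assms card.infinite by fastforce
  moreover have "\<Union>X = V" using V Union_pairs assms by auto
  ultimately show "X \<in> cliques k" using V unfolding cliques_def is_complete_def by (auto simp: pairs_def)
qed

lemma int_choose_two: "2 * int (n choose 2) = int n * (int n - 1)"
proof -
  have "2 * int (n choose 2) = int (n * (n - 1))" using two_choose_two[of n] by linarith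
  then show ?thesis by (cases n) (auto simp: algebra_simps)
qed

text \<open>With i old and a = k - i new vertices, at most i choose 2 edges are old, and twice the
  drop of the potential is at least (k - 1) (i - 1) a. This is positive unless i = 1, where all
  edges are new, or a = 0, where any new edge is a gain.\<close>

lemma copy_family_cliques:
  assumes k: "3 \<le> k"
  shows "copy_family (cliques k) k (k choose 2)"
proof
  show "2 \<le> k" using k by simp
  show h: "1 \<le> k choose 2" using k zero_less_binomial[of 2 k] by linarith
  fix X :: "'a set set" assume "X \<in> cliques k"
  moreover have "2 \<le> k" using k by simp
  ultimately have "\<exists>V. card V = k \<and> X = pairs V" using cliques_iff by blast
  then obtain V where V: "card V = k" "X = pairs V" by blast
  have finV: "finite V" using V(1) k by (metis card.infinite not_numeral_le_zero)
  have UX: "\<Union>X = V" unfolding V(2) by (rule Union_pairs) (use V k in simp)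
  show "card X = k choose 2" "card (\<Union>X) = k" unfolding UX using V card_pairs[OF finV] by simp_all
  show "card e = 2" if "e \<in> X" for e using that V by (simp add: pairs_def)
  fix U D assume U: "\<Union>X \<inter> U \<noteq> {}" and D: "D \<subseteq> X" "D \<noteq> {}" "\<And>e. e \<in> X \<Longrightarrow> e \<subseteq> U \<or> e \<in> D"
  define i where "i = card (V \<inter> U)"
  define a where "a = card (V - U)"
  have finX: "finite X" unfolding V(2) by (rule finite_pairs[OF finV])
  have fin: "finite X" "finite D" using finX finite_subset[OF D(1) finX] by auto
  have ki: "k = a + i" unfolding i_def a_def using V(1) finV card_Int_Diff[of V U] by simp
  have i1: "1 \<le> i" using U UX finV by (simp add: i_def Suc_leI card_gt_0_iff)
  have XD: "X - D \<subseteq> pairs (V \<inter> U)" using D V by (auto simp: pairs_def)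
  then have "card (X - D) \<le> i choose 2"
    using card_mono[OF finite_pairs XD] card_pairs[of "V \<inter> U"] finV by (simp add: i_def)
  then have cD: "k choose 2 \<le> card D + (i choose 2)"
    using card_Diff_subset[OF fin(2) D(1)] V card_pairs[OF finV] by simp
  show "card (\<Union>X - U) = k - 1 \<and> D = X \<or> (k choose 2) * card (\<Union>X - U) + 1 \<le> (k - 1) * card D"
  proof (cases "i = 1")
    case True
    then have "V \<inter> U \<subseteq> V \<inter> U \<and> card (V \<inter> U) = 1" by (simp add: i_def)
    then have "pairs (V \<inter> U) = {}" using card_pairs[of "V \<inter> U"] finV finite_pairs[of "V \<inter> U"] by (simp add: binomial_eq_0)
    then have "D = X" using XD D(1) by auto
    then show ?thesis using True ki UX by (simp add: a_def)
  next
    case False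
    then have i2: "2 \<le> i" using i1 by simp
    have D1: "1 \<le> card D" using fin D(2) by (simp add: Suc_leI card_gt_0_iff)
    show ?thesis
    proof (cases "a = 0")
      case True
      have "(k - 1) * 1 \<le> (k - 1) * card D" using D1 by (intro mult_le_mono2)
      then have "1 \<le> (k - 1) * card D" using k by linarith
      then show ?thesis unfolding UX a_def[symmetric] True by simp
    next
      case False
      have "int (k choose 2) \<le> int (card D) + int (i choose 2)" using cD by linarith
      then have "2 * int (k choose 2) \<le> 2 * int (card D) + 2 * int (i choose 2)" by simp
      then have d: "int k * (int k - 1) - int i * (int i - 1) \<le> 2 * int (card D)"
        unfolding int_choose_two by simp
      have "(int k - 1) * (int k * (int k - 1) - int i * (int i - 1)) \<le> (int k - 1) * (2 * int (card D))"
        using d k by (intro mult_left_mono) auto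
      moreover have "(int k - 1) * (int k * (int k - 1) - int i * (int i - 1)) - int k * (int k - 1) * int a = (int k - 1) * ((int i - 1) * int a)"
        unfolding ki by (simp add: algebra_simps)
      moreover have "2 * 1 \<le> (int k - 1) * ((int i - 1) * int a)"
      proof (intro mult_mono)
        have "1 * 1 \<le> (int i - 1) * int a" using i2 False by (intro mult_mono) auto
        then show "1 \<le> (int i - 1) * int a" by simp
      qed (use k in auto)
      moreover have "2 * int (k choose 2) * int a = int k * (int k - 1) * int a"
        unfolding int_choose_two by simp
      ultimately have "2 * (int (k choose 2) * int a + 1) \<le> 2 * ((int k - 1) * int (card D))"
        by (simp add: algebra_simps)
      then have "int (k choose 2) * int a + 1 \<le> (int k - 1) * int (card D)" by (rule mult_left_le_imp_le) simp
      moreover have "int k - 1 = int (k - 1)" using k by simp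
      ultimately have "int (k choose 2) * int a + 1 \<le> int (k - 1) * int (card D)" by metis
      then have "int ((k choose 2) * a + 1) \<le> int ((k - 1) * card D)"
        by (simp only: of_nat_add of_nat_mult of_nat_1)
      then have "(k choose 2) * a + 1 \<le> (k - 1) * card D" by linarith
      then show ?thesis unfolding UX a_def[symmetric] by blast
    qed
  qed
qed

text \<open>The edges of \<open>Q\<close> at \<open>z\<close> are not in \<open>G\<close>, hence
  they lie in \<open>pairs C\<close>, and together they reach all of \<open>Q\<close>.\<close>

lemma clique_through_fresh_vertex:
  assumes "z \<in> Q" "z \<notin> U" "\<Union>G \<subseteq> U" "pairs Q \<subseteq> G \<union> pairs C" "2 \<le> card Q"
  shows "Q \<subseteq> C"
proof
  have step: "y \<in> C \<and> z \<in> C" if "y \<in> Q" "y \<noteq> z" for y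
  proof -
    have "{z, y} \<in> pairs Q" using that assms by (intro pair_in_pairs) auto
    then have "{z, y} \<in> pairs C" using assms by blast
    then show ?thesis by (simp add: pairs_def)
  qed
  fix y assume y: "y \<in> Q"
  obtain a b where "a \<in> Q" "b \<in> Q" "a \<noteq> b" using two_le_card_obtain[OF assms(5)] by metis
  then obtain y' where "y' \<in> Q" "y' \<noteq> z" by metis
  then show "y \<in> C" using step[of y] step[of y'] y by (cases "y = z") auto
qed

text \<open>With h = k choose 2 this is 2/(k - 1) times the potential h v - (k - 1) e. It equals
  \<open>k\<close> for a \<open>K_k\<close> and 0 for a \<open>K_{k+1}\<close>.\<close>

definition excess :: "nat \<Rightarrow> 'v set set \<Rightarrow> int" where
  "excess k G = int k * int (card (\<Union>G)) - 2 * int (card G)"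

section \<open>Growing a sparse union of cliques\<close>

context
  fixes k :: nat and F :: "'v set set"
  assumes k4: "4 \<le> k"
    and sparse: "\<And>G. conn_union (cliques k) G \<Longrightarrow> G \<subseteq> F \<Longrightarrow> 0 \<le> excess k G"
begin

lemma clique_pairs_in: "card C = k \<Longrightarrow> pairs C \<in> cliques k"
  using cliques_iff[of k "pairs C"] k4 by auto

lemma clique_union: "card C = k \<Longrightarrow> \<Union>(pairs C) = C"
  using Union_pairs[of C] k4 by simp

lemma clique_fin: "card C = k \<Longrightarrow> finite C"
  using k4 by (metis card.infinite not_numeral_le_zero)

lemma clique_conn_finite: "conn_union (cliques k) G \<Longrightarrow> finite G \<and> finite (\<Union>G) \<and> \<Union>G \<noteq> {}"
  using copy_family.conn_union_finite[OF copy_family_cliques, of k G] k4 by simp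

lemma clique_attach:
  assumes G: "conn_union (cliques k) G" and C: "card C = k" "C \<inter> \<Union>G \<noteq> {}"
  shows "conn_union (cliques k) (G \<union> pairs C)"
  using assms clique_union[OF C(1)] by (intro conn_union.attach clique_pairs_in) auto

text \<open>The k - i new vertices add k (k - i), and the new edges take away (k - i) (k + i - 1) +
  2 m, where \<open>m\<close> counts those between old vertices.\<close>

lemma clique_step_excess:
  assumes G: "conn_union (cliques k) G" and C: "card C = k" "C \<inter> \<Union>G \<noteq> {}"
    and i: "i = card (C \<inter> \<Union>G)" and m: "m = card (pairs (C \<inter> \<Union>G) - G)"
  shows "excess k (G \<union> pairs C) = excess k G - (int i - 1) * (int k - int i) - 2 * int m"
    and "1 \<le> i" "i \<le> k" "card (C - \<Union>G) = k - i"
proof -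
  let ?U = "\<Union>G"
  have fin: "finite G" "finite ?U" "finite C" using clique_conn_finite[OF G] clique_fin[OF C(1)] by auto
  show i1: "1 \<le> i" using C(2) fin by (simp add: i Suc_leI card_gt_0_iff)
  have kC: "k = i + card (C - ?U)" using C(1) i card_Int_Diff[OF fin(3), of ?U] by simp
  then show ik: "i \<le> k" "card (C - ?U) = k - i" by auto
  have "\<Union>(G \<union> pairs C) = ?U \<union> (C - ?U)" using clique_union[OF C(1)] by auto
  then have 1: "card (\<Union>(G \<union> pairs C)) = card ?U + (k - i)"
    using fin ik card_Un_disjoint[of ?U "C - ?U"] by (simp only:) auto
  have sub: "pairs (C \<inter> ?U) \<subseteq> pairs C" by (rule pairs_mono) auto
  have "card (pairs C - pairs (C \<inter> ?U)) = (k choose 2) - (i choose 2)"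
    using card_Diff_subset[OF _ sub] finite_pairs[of "C \<inter> ?U"] card_pairs[of C] card_pairs[of "C \<inter> ?U"] fin C(1) i by simp
  moreover have "i choose 2 \<le> k choose 2"
    using card_mono[OF finite_pairs[OF fin(3)] sub] card_pairs[of C] card_pairs[of "C \<inter> ?U"] fin C(1) i by simp
  ultimately have 2: "int (card (pairs C - pairs (C \<inter> ?U))) = int (k choose 2) - int (i choose 2)" by simp
  have "pairs C - G = (pairs C - pairs (C \<inter> ?U)) \<union> (pairs (C \<inter> ?U) - G)"
  proof
    show "pairs C - G \<subseteq> (pairs C - pairs (C \<inter> ?U)) \<union> (pairs (C \<inter> ?U) - G)" by auto
    have "e \<notin> G" if "e \<in> pairs C - pairs (C \<inter> ?U)" for e using that by (auto simp: pairs_def)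
    then show "(pairs C - pairs (C \<inter> ?U)) \<union> (pairs (C \<inter> ?U) - G) \<subseteq> pairs C - G" using sub by auto
  qed
  then have 3: "card (pairs C - G) = card (pairs C - pairs (C \<inter> ?U)) + m"
    unfolding m using fin finite_pairs[of C] finite_pairs[of "C \<inter> ?U"]
    by (simp only:) (intro card_Un_disjoint; auto)
  have 4: "card (G \<union> pairs C) = card G + card (pairs C - G)"
    using fin finite_pairs[of C] card_Un_disjoint[of G "pairs C - G"] by auto
  have "2 * int (card (pairs C - G)) = int k * (int k - 1) - int i * (int i - 1) + 2 * int m"
    unfolding 3 using 2 int_choose_two[of k] int_choose_two[of i] by simp
  then show "excess k (G \<union> pairs C) = excess k G - (int i - 1) * (int k - int i) - 2 * int m"
    unfolding excess_def 1 4 using ik by (simp add: algebra_simps)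
qed

lemma clique_new_edge_fresh:
  assumes "e \<in> pairs C - G" "pairs (C \<inter> \<Union>G) \<subseteq> G"
  obtains z where "z \<in> e" "z \<notin> \<Union>G"
proof -
  have "\<not> e \<subseteq> \<Union>G" using assms unfolding pairs_def by blast
  then show ?thesis using that by blast
qed

text \<open>If \<open>C\<close> brings no edge between old vertices, each new edge has a fresh end,
  which forces any complete subgraph using it into \<open>C\<close>. So \<open>C\<close> is the only
  k-clique created.\<close>

lemma clique_new:
  assumes "pairs (C \<inter> \<Union>G) \<subseteq> G" "pairs Q \<subseteq> G \<union> pairs C" "\<not> pairs Q \<subseteq> G" "2 \<le> card Q"
  shows "Q \<subseteq> C"
proof -
  obtain e where e: "e \<in> pairs Q" "e \<notin> G" using assms(3) by blast
  then have "e \<in> pairs C - G" using assms(2) by blast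
  then obtain z where "z \<in> e" "z \<notin> \<Union>G" using clique_new_edge_fresh assms(1) by metis
  moreover from this have "z \<in> Q" using e by (auto simp: pairs_def)
  ultimately show ?thesis using clique_through_fresh_vertex assms(2,4) by (metis order_refl)
qed

lemma pairs_one_empty: "finite A \<Longrightarrow> card A \<le> 1 \<Longrightarrow> pairs A = {}"
  using card_pairs[of A] finite_pairs[of A] by (simp add: binomial_eq_0)

text \<open>Concavity in \<open>i\<close>: both ends i = 2 and i = k - 1 give k - 2, and the
  difference of the two sides is (i - 2) (k - 1 - i).\<close>

lemma mid_loss: "2 \<le> i \<Longrightarrow> i < k \<Longrightarrow> int k - 2 \<le> (int i - 1) * (int k - int i)"
proof -
  assume i: "2 \<le> i" "i < k"
  have "0 \<le> (int i - 2) * (int k - 1 - int i)" using i by (intro mult_nonneg_nonneg) auto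
  then show ?thesis by (simp add: algebra_simps)
qed

text \<open>
  Attaching a clique that meets the current union in \<open>i\<close> vertices, \<open>m\<close> of whose pairs are new, lowers the
  excess by \<open>(i - 1) (k - i) + 2 m\<close>. Once the excess is zero, only cliques meeting the union in a single
  vertex can follow.
\<close>

definition tight :: "'v set set \<Rightarrow> bool" where
  "tight G \<longleftrightarrow> conn_union (cliques k) G \<and> G \<subseteq> F \<and> excess k G \<le> 0 \<and>
     (\<exists>\<S> B. B \<le> 2 \<and> pairable 1 (\<Union>G) \<S> B \<and> (\<forall>C. card C = k \<longrightarrow> pairs C \<subseteq> G \<longrightarrow> (\<exists>S\<in>\<S>. S \<subseteq> C)))"

lemma capacity_one: "(1::nat) + 1 < (k - 1) * 1" using k4 by simp

lemma Union_Un_pairs: "card C = k \<Longrightarrow> \<Union>(G \<union> pairs C) = \<Union>G \<union> C"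
  by (simp add: clique_union)

lemma tight_step:
  assumes G: "tight G" and C: "card C = k" "pairs C \<subseteq> F" "\<not> pairs C \<subseteq> G" "C \<inter> \<Union>G \<noteq> {}"
  shows "tight (G \<union> pairs C)"
proof -
  let ?U = "\<Union>G"
  obtain \<S> B where SB: "B \<le> 2" "pairable 1 ?U \<S> B" "\<forall>C. card C = k \<longrightarrow> pairs C \<subseteq> G \<longrightarrow> (\<exists>S\<in>\<S>. S \<subseteq> C)"
    and cu: "conn_union (cliques k) G" "G \<subseteq> F" "excess k G \<le> 0" using G unfolding tight_def by blast
  have cu': "conn_union (cliques k) (G \<union> pairs C)" by (rule clique_attach[OF cu(1) C(1,4)])
  have finC: "finite C" by (rule clique_fin[OF C(1)])
  define i where "i = card (C \<inter> ?U)"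
  define m where "m = card (pairs (C \<inter> ?U) - G)"
  note st = clique_step_excess[OF cu(1) C(1,4) i_def m_def]
  have ex: "0 \<le> excess k (G \<union> pairs C)" using cu' cu(2) C(2) by (intro sparse) auto
  have nn: "0 \<le> (int i - 1) * (int k - int i)" using st(2,3) by (intro mult_nonneg_nonneg) auto
  then have z: "(int i - 1) * (int k - int i) = 0" "m = 0" using ex st(1) cu(3) by linarith+
  then have sub: "pairs (C \<inter> ?U) \<subseteq> G" using finite_pairs[of "C \<inter> ?U"] finC by (simp add: m_def)
  have "i \<noteq> k"
  proof
    assume "i = k"
    then have "C \<inter> ?U = C" using C(1) finC unfolding i_def by (intro card_subset_eq) auto
    then show False using sub C(3) by simp
  qed
  then have i1: "i = 1" using z by simp
  then have own: "card (C - ?U) = k - 1" using st(4) by simp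
  have P: "pairable 1 (?U \<union> C) (insert C \<S>) (B + (2 - card (C - ?U)))"
    by (rule pairable_step[OF SB(2) _ capacity_one finC]) (use own C(4) in auto)
  have B: "B + (2 - card (C - ?U)) = B" using own k4 by simp
  have cov: "\<exists>S\<in>insert C \<S>. S \<subseteq> C'" if C': "card C' = k" "pairs C' \<subseteq> G \<union> pairs C" for C'
  proof (cases "pairs C' \<subseteq> G")
    case True
    then show ?thesis using SB(3) C' by blast
  next
    case False
    have "C' \<subseteq> C" by (rule clique_new[OF sub C'(2) False]) (use C' k4 in simp)
    then have "C' = C" using C' C(1) finC by (intro card_subset_eq) auto
    then show ?thesis by blast
  qed
  have "excess k (G \<union> pairs C) \<le> 0" using st(1) z cu(3) by simp
  then show ?thesis unfolding tight_def Union_Un_pairs[OF C(1)]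
    using cu' cu(2) C(2) SB(1) P[unfolded B] cov by blast
qed

text \<open>A \<open>K_{k+1}\<close> spends the entire excess at once, and two disjoint pairs meet
  the demands of all its k-cliques, each of which misses one vertex.\<close>

lemma tight_clique:
  assumes K: "card K = k + 1" "pairs K \<subseteq> F"
  shows "tight (pairs K)"
proof -
  have finK: "finite K" using K(1) by (metis card.infinite add_is_0 zero_neq_one)
  obtain a b where ab: "a \<in> K" "b \<in> K" "a \<noteq> b" using two_le_card_obtain[of K] K k4 by auto
  have "card (K - {a, b}) = k - 1" using ab K(1) finK by (simp add: card_Diff_subset)
  then obtain c where c: "c \<in> K" "c \<noteq> a" "c \<noteq> b" using k4 by (metis Diff_iff card.empty ex_in_conv insertCI not_numeral_le_zero diff_is_0_eq le_trans one_le_numeral order_antisym_conv numeral_le_one_iff semiring_norm(69))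
  have cards: "card (K - {x}) = k" if "x \<in> K" for x using that K(1) finK by simp
  have UKa: "\<Union>(pairs (K - {a})) = K - {a}" by (rule clique_union[OF cards[OF ab(1)]])
  have "conn_union (cliques k) (pairs (K - {a}))"
    by (intro conn_union.single clique_pairs_in cards ab)
  then have "conn_union (cliques k) (pairs (K - {a}) \<union> pairs (K - {b}))"
    by (rule clique_attach[OF _ cards[OF ab(2)]]) (use UKa c in blast)
  then have "conn_union (cliques k) (pairs (K - {a}) \<union> pairs (K - {b}) \<union> pairs (K - {c}))"
    by (rule clique_attach[OF _ cards[OF c(1)]]) (use UKa ab c in blast)
  \<comment> \<open>An edge has only two ends, so it avoids one of \<open>a\<close>,
    \<open>b\<close>, \<open>c\<close>; thus three k-cliques already make up
    \<open>K\<close>.\<close>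
  moreover have "pairs (K - {a}) \<union> pairs (K - {b}) \<union> pairs (K - {c}) = pairs K"
  proof
    show "pairs K \<subseteq> pairs (K - {a}) \<union> pairs (K - {b}) \<union> pairs (K - {c})"
    proof
      fix e assume e: "e \<in> pairs K"
      have "\<not> {a,b,c} \<subseteq> e"
      proof
        assume "{a,b,c} \<subseteq> e"
        moreover have "finite e" using e card.infinite by (fastforce simp: pairs_def)
        ultimately have "card {a,b,c} \<le> card e" by (intro card_mono)
        then show False using e ab c by (simp add: pairs_def)
      qed
      then show "e \<in> pairs (K - {a}) \<union> pairs (K - {b}) \<union> pairs (K - {c})" using e by (auto simp: pairs_def)
    qed
  qed (auto simp: pairs_def)
  ultimately have cu: "conn_union (cliques k) (pairs K)" by simp
  have UK: "\<Union>(pairs K) = K" using Union_pairs[of K] K(1) k4 by simp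
  have "excess k (pairs K) = 0"
    unfolding excess_def UK using int_choose_two[of "k + 1"] card_pairs[OF finK] K(1) by simp
  moreover have "pairable 1 K {C. C \<subseteq> K \<and> card K \<le> card C + 1} 2"
    by (rule pairable_clique_base) (use K k4 in simp)
  moreover have "\<exists>S\<in>{C. C \<subseteq> K \<and> card K \<le> card C + 1}. S \<subseteq> C" if "card C = k" "pairs C \<subseteq> pairs K" for C
  proof -
    have "C \<subseteq> K" using that clique_union[OF that(1)] UK by blast
    then show ?thesis using that K(1) by auto
  qed
  ultimately show ?thesis unfolding tight_def UK using cu K(2) by (intro conjI exI[of _ 2] exI) auto
qed

text \<open>
  \<open>A\<close> and \<open>B\<close> are two cliques sharing at least two vertices; until the remaining excess of at most 2 is spent,
  they are the only such pair.
\<close>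

definition near_tree :: "'v set \<Rightarrow> 'v set \<Rightarrow> 'v set set \<Rightarrow> bool" where
  "near_tree A B G \<longleftrightarrow> conn_union (cliques k) G \<and> G \<subseteq> F \<and> excess k G \<le> 2 \<and>
     (\<exists>\<L>. (\<forall>P\<in>\<L>. card P = k \<and> pairs P \<subseteq> G \<and> P \<subseteq> \<Union>G) \<and> pairable 1 (\<Union>G) \<L> (2 - card (B - A)) \<and>
       (\<forall>Q. 2 \<le> card Q \<longrightarrow> pairs Q \<subseteq> G \<longrightarrow> (\<exists>P\<in>\<L>. Q \<subseteq> P)) \<and>
       (\<forall>P\<in>\<L>. \<forall>R\<in>\<L>. P \<noteq> R \<longrightarrow> 2 \<le> card (P \<inter> R) \<longrightarrow> {P, R} = {A, B}))"

text \<open>By \<open>mid_loss\<close> the second clique leaves at most 2 of the excess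
  \<open>k\<close> of the first.\<close>

lemma near_tree_start:
  assumes A: "card A = k" "pairs A \<subseteq> F" and B: "card B = k" "pairs B \<subseteq> F" and AB: "A \<noteq> B" "2 \<le> card (A \<inter> B)"
  shows "near_tree A B (pairs A \<union> pairs B)"
proof -
  have fin: "finite A" "finite B" using A B clique_fin by auto
  have UA: "\<Union>(pairs A) = A" by (rule clique_union[OF A(1)])
  have cuA: "conn_union (cliques k) (pairs A)" by (intro conn_union.single clique_pairs_in A)
  have ne: "B \<inter> \<Union>(pairs A) \<noteq> {}" unfolding UA using AB(2) by (auto simp: Int_commute)
  note st = clique_step_excess[OF cuA B(1) ne refl refl]
  have cu: "conn_union (cliques k) (pairs A \<union> pairs B)" by (rule clique_attach[OF cuA B(1) ne])
  define i where "i = card (B \<inter> A)"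
  have i2: "2 \<le> i" using AB by (simp add: i_def Int_commute)
  have ik: "i < k"
  proof (rule ccontr)
    assume "\<not> i < k"
    then have "card (B \<inter> A) = card B" using st(3) B(1) unfolding i_def UA by simp
    then have "B \<inter> A = B" using fin by (intro card_subset_eq) auto
    then have "B \<subseteq> A" by blast
    then show False using card_subset_eq[of A B] fin A B AB by auto
  qed
  have "excess k (pairs A) = int k"
    unfolding excess_def UA using int_choose_two[of k] card_pairs[OF fin(1)] A(1) by (simp add: algebra_simps)
  then have ex: "excess k (pairs A \<union> pairs B) \<le> 2"
    using st(1) mid_loss[OF i2 ik] unfolding UA i_def by linarith
  have U: "\<Union>(pairs A \<union> pairs B) = A \<union> B" using UA clique_union[OF B(1)] by auto
  have "pairable 1 A {A} 0" by (rule pairable_base[OF _ capacity_one fin(1)]) (use A in simp)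
  then have P: "pairable 1 (A \<union> B) (insert B {A}) (0 + (2 - card (B - A)))"
    by (rule pairable_step[OF _ _ capacity_one fin(2)]) (use AB(2) in \<open>auto simp: Int_commute\<close>)
  have cl: "\<exists>P\<in>{B, A}. Q \<subseteq> P" if Q: "2 \<le> card Q" "pairs Q \<subseteq> pairs A \<union> pairs B" for Q
  proof (cases "Q \<subseteq> A")
    case False
    then obtain z where "z \<in> Q" "z \<notin> A" by blast
    then have "Q \<subseteq> B" using clique_through_fresh_vertex[of z Q A "pairs A" B] UA Q by simp
    then show ?thesis by blast
  qed simp
  have P': "pairable 1 (A \<union> B) {B, A} (2 - card (B - A))" using P by simp
  have "\<forall>P\<in>{B, A}. card P = k \<and> pairs P \<subseteq> pairs A \<union> pairs B \<and> P \<subseteq> A \<union> B" using A B by blast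
  moreover have "\<forall>P\<in>{B, A}. \<forall>R\<in>{B, A}. P \<noteq> R \<longrightarrow> 2 \<le> card (P \<inter> R) \<longrightarrow> {P, R} = {A, B}" by blast
  moreover have "pairs A \<union> pairs B \<subseteq> F" using A B by blast
  ultimately show ?thesis unfolding near_tree_def U using cu ex P' cl
    by (intro conjI exI[of _ "{B, A}"] allI impI) assumption+
qed

text \<open>Excess at most 2 allows one more degenerate attachment, after which the union is tight.
  Either \<open>C\<close> has both old and new vertices and meets the union in at least two, or it
  adds one edge between old vertices. In the latter case that edge serves as a pair, at deficit 2,
  provided that \<open>B\<close> has caused no deficit; if it has, a \<open>K_{k+1}\<close> would
  arise, which is excluded.\<close>

lemma near_tree_step:
  assumes G: "near_tree A B G" and AB: "card A = k" "card B = k" "A \<noteq> B"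
    and noK: "\<And>K. card K = k + 1 \<Longrightarrow> \<not> pairs K \<subseteq> F"
    and C: "card C = k" "pairs C \<subseteq> F" "\<not> pairs C \<subseteq> G" "C \<inter> \<Union>G \<noteq> {}"
  shows "near_tree A B (G \<union> pairs C) \<or> tight (G \<union> pairs C)"
proof -
  let ?U = "\<Union>G"
  obtain \<L> where L: "\<forall>P\<in>\<L>. card P = k \<and> pairs P \<subseteq> G \<and> P \<subseteq> \<Union>G" "pairable 1 (\<Union>G) \<L> (2 - card (B - A))"
    "\<forall>Q. 2 \<le> card Q \<longrightarrow> pairs Q \<subseteq> G \<longrightarrow> (\<exists>P\<in>\<L>. Q \<subseteq> P)"
    "\<forall>P\<in>\<L>. \<forall>R\<in>\<L>. P \<noteq> R \<longrightarrow> 2 \<le> card (P \<inter> R) \<longrightarrow> {P, R} = {A, B}"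
    and cu: "conn_union (cliques k) G" "G \<subseteq> F" "excess k G \<le> 2" using G unfolding near_tree_def by (elim conjE exE)
  have cu': "conn_union (cliques k) (G \<union> pairs C)" by (rule clique_attach[OF cu(1) C(1,4)])
  have finC: "finite C" by (rule clique_fin[OF C(1)])
  define i where "i = card (C \<inter> ?U)"
  define m where "m = card (pairs (C \<inter> ?U) - G)"
  note st = clique_step_excess[OF cu(1) C(1,4) i_def m_def]
  have ex: "0 \<le> excess k (G \<union> pairs C)" using cu' cu(2) C(2) by (intro sparse) auto
  have old: "\<exists>S\<in>\<L>. S \<subseteq> C'" if C': "card C' = k" "pairs C' \<subseteq> G" for C'
  proof -
    have "2 \<le> card C'" using C' k4 by simp
    then obtain P where P: "P \<in> \<L>" "C' \<subseteq> P" using L(3) C' by blast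
    have "card P = k" using L(1) P by blast
    then have "C' = P" using P C' clique_fin by (intro card_subset_eq) auto
    then show ?thesis using P by blast
  qed
  have Cedge: "C' = C" if "card C' = k" "C' \<subseteq> C" for C' using that C(1) finC by (intro card_subset_eq) auto
  have "\<not> B \<subseteq> A" using AB clique_fin[OF AB(1)] card_subset_eq[of A B] by auto
  then have "1 \<le> card (B - A)" using clique_fin[OF AB(2)] by (simp add: Suc_leI card_gt_0_iff)
  then have BA: "2 - card (B - A) \<le> 1" by simp
  consider "i = 1" | "2 \<le> i" "i < k" | "i = k" using st(2,3) by linarith
  then show ?thesis
  proof cases
    case 1
    then have "pairs (C \<inter> ?U) = {}" using pairs_one_empty[of "C \<inter> ?U"] finC by (simp add: i_def)
    then have sub: "pairs (C \<inter> ?U) \<subseteq> G" by simp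
    have own: "card (C - ?U) = k - 1" using st(4) 1 by simp
    have P: "pairable 1 (?U \<union> C) (insert C \<L>) (2 - card (B - A) + (2 - card (C - ?U)))"
      by (rule pairable_step[OF L(2) _ capacity_one finC]) (use own C(4) in auto)
    have B: "2 - card (B - A) + (2 - card (C - ?U)) = 2 - card (B - A)" using own k4 by simp
    have "excess k (G \<union> pairs C) \<le> 2" using st(1) 1 cu(3) by simp
    moreover have "\<exists>P\<in>insert C \<L>. Q \<subseteq> P" if Q: "2 \<le> card Q" "pairs Q \<subseteq> G \<union> pairs C" for Q
      using clique_new[OF sub Q(2) _ Q(1)] L(3) Q by blast
    moreover have small: "\<not> 2 \<le> card (P \<inter> C)" if "P \<in> \<L>" for P
    proof -
      have "P \<inter> C \<subseteq> C \<inter> ?U" using L(1) that by blast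
      then have "card (P \<inter> C) \<le> i" unfolding i_def using finC by (intro card_mono) auto
      then show ?thesis using 1 by simp
    qed
    then have "\<forall>P\<in>insert C \<L>. \<forall>R\<in>insert C \<L>. P \<noteq> R \<longrightarrow> 2 \<le> card (P \<inter> R) \<longrightarrow> {P, R} = {A, B}"
      using L(4) by (metis Int_commute insertE)
    moreover have "\<forall>P\<in>insert C \<L>. card P = k \<and> pairs P \<subseteq> G \<union> pairs C \<and> P \<subseteq> ?U \<union> C"
      using L(1) C(1) by blast
    ultimately have "near_tree A B (G \<union> pairs C)"
      unfolding near_tree_def Union_Un_pairs[OF C(1)]
      using cu' cu(2) C(2) P[unfolded B] by (intro conjI exI[of _ "insert C \<L>"]) auto
    then show ?thesis by blast
  next
    case 2
    have ml: "int k - 2 \<le> (int i - 1) * (int k - int i)" by (rule mid_loss[OF 2])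
    \<comment> \<open>The loss k - 2 >= 2 uses up all remaining excess, so no edge between old
      vertices can be new.\<close>
    then have m0: "m = 0" and ex0: "excess k (G \<union> pairs C) \<le> 0"
      using ex st(1) cu(3) k4 by linarith+
    then have sub: "pairs (C \<inter> ?U) \<subseteq> G" using finite_pairs[of "C \<inter> ?U"] finC by (simp add: m_def)
    have own: "card (C - ?U) = k - i" using st(4) by simp
    have P: "pairable 1 (?U \<union> C) (insert C \<L>) (2 - card (B - A) + (2 - card (C - ?U)))"
      by (rule pairable_step[OF L(2) _ capacity_one finC]) (use 2 in \<open>auto simp: i_def\<close>)
    have cov: "\<exists>S\<in>insert C \<L>. S \<subseteq> C'" if C': "card C' = k" "pairs C' \<subseteq> G \<union> pairs C" for C'
    proof (cases "pairs C' \<subseteq> G")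
      case True
      then show ?thesis using old C' by blast
    next
      case False
      have "C' \<subseteq> C" by (rule clique_new[OF sub C'(2) False]) (use C' k4 in simp)
      then show ?thesis using Cedge C' by blast
    qed
    have "2 - card (B - A) + (2 - card (C - ?U)) \<le> 2" using BA own 2 by linarith
    then have "tight (G \<union> pairs C)" unfolding tight_def Union_Un_pairs[OF C(1)]
      using cu' cu(2) C(2) ex0 P cov by blast
    then show ?thesis by blast
  next
    case 3
    then have CU: "C \<inter> ?U = C" using C(1) finC unfolding i_def by (intro card_subset_eq) auto
    have "pairs C - G \<noteq> {}" using C(3) by blast
    then have "1 \<le> m" unfolding m_def CU using finite_pairs[OF finC] by (simp add: Suc_leI card_gt_0_iff)
    then have m1: "m = 1" and ex0: "excess k (G \<union> pairs C) \<le> 0"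
      using ex st(1) cu(3) 3 by auto
    then obtain e where e: "pairs C - G = {e}" unfolding m_def CU by (metis card_1_singletonE)
    then have "e \<in> pairs C" by blast
    then obtain x y where xy: "e = {x, y}" "x \<in> C" "y \<in> C" "x \<noteq> y" by (rule pairs_cases)
    show ?thesis
    \<comment> \<open>With two vertices of \<open>B\<close> outside \<open>A\<close> the deficit is
      still 0, and both ends of the new edge may be borrowed. Every new clique contains this
      edge.\<close>
    proof (cases "2 \<le> card (B - A)")
      case True
      have "pairable 1 (?U \<union> {x, y}) (insert {x, y} \<L>) (2 - card (B - A) + (2 - card ({x, y} - ?U)))" (is "pairable 1 _ ?S ?B")
      proof (rule pairable_step[OF L(2) _ capacity_one])
        have "{x, y} \<inter> ?U = {x, y}" using xy CU by blast
        then show "2 \<le> card ({x, y} \<inter> ?U) \<or> {x, y} \<inter> ?U \<noteq> {} \<and> k - 1 \<le> card ({x, y} - ?U)" using xy by simp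
      qed auto
      moreover have "?U \<union> {x, y} = ?U \<union> C" using xy CU by blast
      ultimately have P: "pairable 1 (?U \<union> C) ?S ?B" by simp
      have B2: "2 - card (B - A) + (2 - card ({x, y} - ?U)) \<le> 2" using True by simp
      have cov: "\<exists>S\<in>insert {x, y} \<L>. S \<subseteq> C'" if C': "card C' = k" "pairs C' \<subseteq> G \<union> pairs C" for C'
      proof (cases "pairs C' \<subseteq> G")
        case True
        then show ?thesis using old C' by blast
      next
        case False
        then obtain d where d: "d \<in> pairs C'" "d \<notin> G" by blast
        then have "d \<in> pairs C - G" using C'(2) by blast
        then have "e \<in> pairs C'" using d(1) unfolding e by simp
        then show ?thesis using xy by (auto simp: pairs_def)
      qed
      have "G \<union> pairs C \<subseteq> F" using cu(2) C(2) by blast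
      then have "tight (G \<union> pairs C)" unfolding tight_def Union_Un_pairs[OF C(1)]
        using cu' ex0 P B2 cov by (intro conjI exI[of _ ?S] exI[of _ ?B] allI impI)
      then show ?thesis by blast
    next
      case False
      have sub: "pairs (C - {v}) \<subseteq> G" if v: "v \<in> e" for v
      proof
        fix d assume d: "d \<in> pairs (C - {v})"
        then have "d \<in> pairs C" "d \<noteq> e" using v by (auto simp: pairs_def)
        then show "d \<in> G" using e by blast
      qed
      have cC: "2 \<le> card (C - {v})" if "v \<in> C" for v using that C(1) finC k4 by simp
      \<comment> \<open>\<open>C\<close> without an end of the new edge is complete in
        \<open>G\<close>, so it lies in a member of \<open>\<L>\<close>. The members
        \<open>P\<close> and \<open>R\<close> for the two ends share k - 2 >= 2 vertices and must
        therefore be the exceptional cliques \<open>A\<close> and \<open>B\<close>.\<close>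
      obtain P where P: "P \<in> \<L>" "C - {x} \<subseteq> P" using L(3) sub[of x] cC[of x] xy by blast
      obtain R where R: "R \<in> \<L>" "C - {y} \<subseteq> R" using L(3) sub[of y] cC[of y] xy by blast
      have nC: "\<not> C \<subseteq> T" if "T \<in> \<L>" for T using pairs_mono[of C T] L(1) that C(3) by blast
      have PR: "x \<notin> P" "y \<in> P" "y \<notin> R" "x \<in> R" using P R nC[OF P(1)] nC[OF R(1)] xy by blast+
      have "C - {x, y} \<subseteq> P \<inter> R" using P R by blast
      moreover have finP: "finite P" "card P = k" "finite R" "card R = k" using L(1) P R clique_fin by blast+
      ultimately have "card (C - {x, y}) \<le> card (P \<inter> R)" by (intro card_mono) auto
      moreover have "card (C - {x, y}) = k - 2" using C(1) xy finC by (simp add: card_Diff_subset)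
      ultimately have "2 \<le> card (P \<inter> R)" using k4 by simp
      moreover have "P \<noteq> R" using PR by blast
      ultimately have eq: "{P, R} = {A, B}" using L(4) P R by blast
      have cd: "card (B - A) = card (A - B)"
        using AB clique_fin[of A] clique_fin[of B] by (simp add: card_le_sym_Diff card_Diff_subset_Int Int_commute)
      have cPR: "card (P - R) \<le> 1" "card (R - P) \<le> 1" using False cd eq by (auto simp: doubleton_eq_iff)
      have PR1: "P - R = {y}" "R - P = {x}"
        using PR cPR finP card_le_Suc0_iff_eq[of "P - R"] card_le_Suc0_iff_eq[of "R - P"] by auto
      have "card (P \<union> R) = k + 1"
      proof -
        have "P \<union> R = insert x P" using PR1 PR by blast
        then show ?thesis using finP PR by simp
      qed
      \<comment> \<open>The only pair of vertices of \<open>P \<union> R\<close> inside neither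
        clique is the new edge.\<close>
      moreover have "pairs (P \<union> R) \<subseteq> F"
      proof
        fix d assume "d \<in> pairs (P \<union> R)"
        then obtain u w where uw: "d = {u, w}" "u \<in> P \<union> R" "w \<in> P \<union> R" "u \<noteq> w" by (rule pairs_cases)
        have "v = y" if "v \<in> P" "v \<notin> R" for v using that PR1(1) by blast
        moreover have "v = x" if "v \<in> R" "v \<notin> P" for v using that PR1(2) by blast
        ultimately consider "{u, w} \<subseteq> P" | "{u, w} \<subseteq> R" | "{u, w} = {x, y}"
          using uw(2,3) by (cases "u \<in> P"; cases "w \<in> P"; cases "u \<in> R"; cases "w \<in> R") auto
        then show "d \<in> F"
        proof cases
          case 1
          then have "d \<in> pairs P" using uw by (simp add: pairs_def)
          then show ?thesis using L(1) P cu(2) by blast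
        next
          case 2
          then have "d \<in> pairs R" using uw by (simp add: pairs_def)
          then show ?thesis using L(1) R cu(2) by blast
        next
          case 3
          then have "d = e" using uw xy by simp
          then show ?thesis using \<open>e \<in> pairs C\<close> C(2) by blast
        qed
      qed
      ultimately show ?thesis using noK by blast
    qed
  qed
qed

text \<open>Connectedness extends a maximal good sub-union as long as it differs from
  \<open>F\<close>. The order in which \<open>F\<close> was built is irrelevant, so a chosen
  configuration \<open>G0\<close> can come first.\<close>

lemma clique_grow:
  assumes F: "conn_union (cliques k) F" and start: "good G0"
    and good: "\<And>G. good G \<Longrightarrow> conn_union (cliques k) G \<and> G \<subseteq> F"
    and step: "\<And>G C. good G \<Longrightarrow> card C = k \<Longrightarrow> pairs C \<subseteq> F \<Longrightarrow> \<not> pairs C \<subseteq> G \<Longrightarrow> C \<inter> \<Union>G \<noteq> {} \<Longrightarrow> good (G \<union> pairs C)"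
  shows "good F"
proof -
  interpret copy_family "cliques k" k "k choose 2" by (rule copy_family_cliques) (use k4 in simp)
  have "finite {G. good G}"
    by (rule finite_subset[of _ "Pow F"]) (use good clique_conn_finite[OF F] in auto)
  then obtain G where G: "good G" "\<And>G'. good G' \<Longrightarrow> G \<subseteq> G' \<Longrightarrow> G = G'"
    using finite_has_maximal[of "{G. good G}"] start by auto
  have "F \<subseteq> G"
  proof (rule ccontr)
    assume nF: "\<not> F \<subseteq> G"
    have GF: "G \<subseteq> F" "conn_union (cliques k) G" using good[OF G(1)] by auto
    then obtain X where X: "X \<in> cliques k" "X \<subseteq> F" "\<not> X \<subseteq> G" "\<Union>X \<inter> \<Union>G \<noteq> {}"
      using conn_union_extend[OF F GF(1) nF] card_edge clique_conn_finite[OF GF(2)] by (metis card.empty zero_neq_numeral)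
    then obtain C where C: "card C = k" "X = pairs C" using cliques_iff[of k X] k4 by auto
    have "good (G \<union> pairs C)" using X C clique_union[OF C(1)] by (intro step[OF G(1)]) auto
    then show False using G(2)[of "G \<union> pairs C"] X C by auto
  qed
  then show ?thesis using G(1) good[OF G(1)] by (metis subset_antisym)
qed

definition linear_built :: "'v set set \<Rightarrow> bool" where
  "linear_built G \<longleftrightarrow> conn_union (cliques k) G \<and> G \<subseteq> F \<and> excess k G \<le> int k \<and>
     (\<exists>\<S>. pairable 1 (\<Union>G) \<S> 0 \<and> (\<forall>C. card C = k \<longrightarrow> pairs C \<subseteq> G \<longrightarrow> (\<exists>S\<in>\<S>. S \<subseteq> C)))"

lemma linear_start:
  assumes A: "card A = k" "pairs A \<subseteq> F"
  shows "linear_built (pairs A)"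
proof -
  have fin: "finite A" by (rule clique_fin[OF A(1)])
  have UA: "\<Union>(pairs A) = A" by (rule clique_union[OF A(1)])
  have "conn_union (cliques k) (pairs A)" by (intro conn_union.single clique_pairs_in A)
  moreover have "excess k (pairs A) \<le> int k"
    unfolding excess_def UA using int_choose_two[of k] card_pairs[OF fin] A(1) by (simp add: algebra_simps)
  moreover have "pairable 1 A {A} 0" by (rule pairable_base[OF _ capacity_one fin]) (use A in simp)
  moreover have "\<exists>S\<in>{A}. S \<subseteq> C" if "card C = k" "pairs C \<subseteq> pairs A" for C
  proof -
    have "C \<subseteq> A" using that clique_union[OF that(1)] UA by blast
    then have "C = A" using that A fin by (intro card_subset_eq) auto
    then show ?thesis by simp
  qed
  ultimately show ?thesis unfolding linear_built_def UA using A(2) by blast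
qed

text \<open>Distinct cliques are edge-disjoint here, so all edges between the i old vertices of
  \<open>C\<close> are new and the total loss is k (i - 1). Excess at most \<open>k\<close> forces i
  <= 2, which leaves at least two new vertices, and the deficit stays 0.\<close>

lemma linear_step:
  assumes lin: "\<And>A B. card A = k \<Longrightarrow> card B = k \<Longrightarrow> pairs A \<subseteq> F \<Longrightarrow> pairs B \<subseteq> F \<Longrightarrow> 2 \<le> card (A \<inter> B) \<Longrightarrow> A = B"
    and G: "linear_built G" and C: "card C = k" "pairs C \<subseteq> F" "\<not> pairs C \<subseteq> G" "C \<inter> \<Union>G \<noteq> {}"
  shows "linear_built (G \<union> pairs C)"
proof -
  let ?U = "\<Union>G"
  obtain \<S> where SB: "pairable 1 ?U \<S> 0" "\<forall>C. card C = k \<longrightarrow> pairs C \<subseteq> G \<longrightarrow> (\<exists>S\<in>\<S>. S \<subseteq> C)"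
    and cu: "conn_union (cliques k) G" "G \<subseteq> F" "excess k G \<le> int k"
    using G unfolding linear_built_def by (elim conjE exE)
  have cu': "conn_union (cliques k) (G \<union> pairs C)" by (rule clique_attach[OF cu(1) C(1,4)])
  have finC: "finite C" by (rule clique_fin[OF C(1)])
  have meet: "A = B" if AB: "card A = k" "card B = k" "pairs A \<subseteq> F" "pairs B \<subseteq> F" "e \<in> pairs A" "e \<in> pairs B" for A B e
  proof -
    have "e \<subseteq> A \<inter> B" "card e = 2" using AB by (auto simp: pairs_def)
    then have "2 \<le> card (A \<inter> B)" using clique_fin[OF AB(1)] card_mono by (metis finite_Int)
    then show ?thesis using lin AB by blast
  qed
  have disj: "pairs C \<inter> G = {}"
  proof (rule ccontr)
    assume "pairs C \<inter> G \<noteq> {}"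
    then obtain e where e: "e \<in> pairs C" "e \<in> G" by blast
    obtain X where X: "X \<in> cliques k" "X \<subseteq> G" "e \<in> X" using conn_union_cover[OF cu(1) e(2)] by blast
    then obtain A where A: "card A = k" "X = pairs A" using cliques_iff[of k X] k4 by auto
    have "A = C" using meet[OF A(1) C(1) _ C(2), of e] A X e cu(2) by blast
    then show False using A X C(3) by blast
  qed
  define i where "i = card (C \<inter> ?U)"
  define m where "m = card (pairs (C \<inter> ?U) - G)"
  note st = clique_step_excess[OF cu(1) C(1,4) i_def m_def]
  have ex: "0 \<le> excess k (G \<union> pairs C)" using cu' cu(2) C(2) by (intro sparse) auto
  have "pairs (C \<inter> ?U) - G = pairs (C \<inter> ?U)" using disj pairs_mono[of "C \<inter> ?U" C] by auto
  then have "m = i choose 2" using card_pairs[of "C \<inter> ?U"] finC by (simp add: m_def i_def)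
  then have "2 * int m = int i * (int i - 1)" using int_choose_two by simp
  then have "excess k (G \<union> pairs C) = excess k G - int k * (int i - 1)"
    using st(1) by (simp add: algebra_simps)
  moreover from this have "int k * (int i - 1) \<le> int k * 1" using ex cu(3) by simp
  then have i2: "i \<le> 2" using k4 by (simp add: mult_le_cancel_left)
  moreover have "0 \<le> int k * (int i - 1)" using st(2) by (intro mult_nonneg_nonneg) auto
  ultimately have ex': "excess k (G \<union> pairs C) \<le> int k" using cu(3) by linarith
  have own: "card (C - ?U) = k - i" using st(4) by simp
  have "pairable 1 (?U \<union> C) (insert C \<S>) (0 + (2 - card (C - ?U)))"
  proof (rule pairable_step[OF SB(1) _ capacity_one finC])
    show "2 \<le> card (C \<inter> ?U) \<or> C \<inter> ?U \<noteq> {} \<and> k - 1 \<le> card (C - ?U)"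
      using own C(4) st(2) unfolding i_def[symmetric] by (cases "i = 1") auto
  qed simp
  then have P: "pairable 1 (?U \<union> C) (insert C \<S>) 0" using own i2 k4 by simp
  have cov: "\<exists>S\<in>insert C \<S>. S \<subseteq> C'" if C': "card C' = k" "pairs C' \<subseteq> G \<union> pairs C" for C'
  proof (cases "pairs C' \<subseteq> G")
    case True
    then show ?thesis using SB(2) C' by blast
  next
    case False
    then obtain e where e: "e \<in> pairs C'" "e \<in> pairs C" using C'(2) by blast
    have "pairs C' \<subseteq> F" using C'(2) C(2) cu(2) by blast
    then have "C' = C" using meet[OF C'(1) C(1) _ C(2) e] by blast
    then show ?thesis by blast
  qed
  have "G \<union> pairs C \<subseteq> F" using cu(2) C(2) by blast
  then show ?thesis unfolding linear_built_def Union_Un_pairs[OF C(1)]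
    using cu' ex' P cov by (intro conjI exI[of _ "insert C \<S>"] allI impI)
qed

text \<open>The most degenerate configuration present is taken as the start; in each of the three
  cases its deficit and that of all later attachments add up to at most 2.\<close>

lemma clique_system:
  assumes F: "conn_union (cliques k) F"
  shows "\<exists>\<S> B. B \<le> 2 \<and> pairable 1 (\<Union>F) \<S> B \<and> (\<forall>C. card C = k \<longrightarrow> pairs C \<subseteq> F \<longrightarrow> (\<exists>S\<in>\<S>. S \<subseteq> C))"
proof -
  have tightF: ?thesis if "tight F" using that unfolding tight_def by (elim conjE)
  consider K where "card K = k + 1" "pairs K \<subseteq> F"
    | A B where "\<And>K. card K = k + 1 \<Longrightarrow> \<not> pairs K \<subseteq> F" "card A = k" "card B = k" "pairs A \<subseteq> F" "pairs B \<subseteq> F" "A \<noteq> B" "2 \<le> card (A \<inter> B)"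
    | "\<And>A B. card A = k \<Longrightarrow> card B = k \<Longrightarrow> pairs A \<subseteq> F \<Longrightarrow> pairs B \<subseteq> F \<Longrightarrow> 2 \<le> card (A \<inter> B) \<Longrightarrow> A = B"
    by metis
  then show ?thesis
  proof cases
    case 1
    have "tight F"
    proof (rule clique_grow[where good = tight, OF F tight_clique[OF 1]])
      show "conn_union (cliques k) G \<and> G \<subseteq> F" if "tight G" for G
        using that unfolding tight_def by (elim conjE) (intro conjI; assumption)
    qed (rule tight_step)
    then show ?thesis by (rule tightF)
  next
    case 2
    have "near_tree A B F \<or> tight F"
    proof (rule clique_grow[OF F, where good = "\<lambda>G. near_tree A B G \<or> tight G"])
      show "near_tree A B (pairs A \<union> pairs B) \<or> tight (pairs A \<union> pairs B)"
        using near_tree_start[of A B] 2 by blast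
      show "conn_union (cliques k) G \<and> G \<subseteq> F" if "near_tree A B G \<or> tight G" for G
        using that unfolding near_tree_def tight_def by (elim disjE conjE) (intro conjI; assumption)+
      fix G C assume "near_tree A B G \<or> tight G" and C: "card C = k" "pairs C \<subseteq> F" "\<not> pairs C \<subseteq> G" "C \<inter> \<Union>G \<noteq> {}"
      then show "near_tree A B (G \<union> pairs C) \<or> tight (G \<union> pairs C)"
        using near_tree_step[OF _ 2(2,3,6,1) C] tight_step[OF _ C] by blast
    qed
    then show ?thesis
    proof
      assume "near_tree A B F"
      then obtain \<L> where L: "\<forall>P\<in>\<L>. card P = k \<and> pairs P \<subseteq> F \<and> P \<subseteq> \<Union>F" "pairable 1 (\<Union>F) \<L> (2 - card (B - A))"
        "\<forall>Q. 2 \<le> card Q \<longrightarrow> pairs Q \<subseteq> F \<longrightarrow> (\<exists>P\<in>\<L>. Q \<subseteq> P)"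
        unfolding near_tree_def by (elim conjE exE)
      have "\<exists>S\<in>\<L>. S \<subseteq> C" if C: "card C = k" "pairs C \<subseteq> F" for C
      proof -
        have "2 \<le> card C" using C k4 by simp
        then obtain P where P: "P \<in> \<L>" "C \<subseteq> P" using L(3) C by blast
        have "card P = k" using L(1) P by blast
        then have "C = P" using P C clique_fin by (intro card_subset_eq) auto
        then show ?thesis using P by blast
      qed
      moreover have "2 - card (B - A) \<le> 2" by simp
      ultimately show ?thesis using L(2) by (intro exI[of _ \<L>] exI[of _ "2 - card (B - A)"] conjI allI impI)
    qed (rule tightF)
  next
    case 3
    obtain X0 where X0: "X0 \<in> cliques k" "X0 \<subseteq> F"
      using F by (induction rule: conn_union.induct) auto
    then obtain A where A: "card A = k" "X0 = pairs A" using cliques_iff[of k X0] k4 by auto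
    have "linear_built F"
    proof (rule clique_grow[where good = linear_built, OF F])
      show "linear_built (pairs A)" using linear_start A X0 by blast
      show "conn_union (cliques k) G \<and> G \<subseteq> F" if "linear_built G" for G
        using that unfolding linear_built_def by (elim conjE) (intro conjI; assumption)
      show "linear_built (G \<union> pairs C)" if "linear_built G" "card C = k" "pairs C \<subseteq> F" "\<not> pairs C \<subseteq> G" "C \<inter> \<Union>G \<noteq> {}" for G C
        by (rule linear_step[OF 3 that])
    qed
    then obtain \<S> where "pairable 1 (\<Union>F) \<S> 0" "\<forall>C. card C = k \<longrightarrow> pairs C \<subseteq> F \<longrightarrow> (\<exists>S\<in>\<S>. S \<subseteq> C)"
      unfolding linear_built_def by (elim conjE exE)
    then show ?thesis by (intro exI[of _ \<S>] exI[of _ 0] conjI) simp_all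
  qed
qed

end

lemma clique_pairs:
  assumes k: "4 \<le> k"
    and F: "conn_union (cliques k) F" "\<not> dense_edges k (k choose 2) (\<Union>F) F"
  obtains D where "\<forall>e\<in>D. e \<subseteq> \<Union>F \<and> card e = 2" "\<forall>Y\<in>cliques k. Y \<subseteq> F \<longrightarrow> (\<exists>e\<in>D. e \<subseteq> \<Union>Y)"
    "\<forall>v\<in>\<Union>F. card {e\<in>D. v \<in> e} \<le> 1"
proof -
  interpret copy_family "cliques k" k "k choose 2" by (rule copy_family_cliques) (use k in simp)
  have sparse: "0 \<le> excess k G" if G: "conn_union (cliques k) G" "G \<subseteq> F" for G
  proof -
    have "\<not> dense_edges k (k choose 2) (\<Union>G) G" by (rule conn_union_not_dense_subset[OF F G])
    then have "(k - 1) * card G \<le> (k choose 2) * card (\<Union>G)" by (simp only: dense_edges_def not_less)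
    then have "2 * ((k - 1) * card G) \<le> 2 * ((k choose 2) * card (\<Union>G))" by (rule mult_le_mono2)
    also have "\<dots> = k * (k - 1) * card (\<Union>G)" unfolding mult.assoc[symmetric] two_choose_two ..
    finally have "(k - 1) * (2 * card G) \<le> (k - 1) * (k * card (\<Union>G))" by (simp only: mult_ac)
    moreover have "0 < k - 1" using k by simp
    ultimately have "2 * card G \<le> k * card (\<Union>G)" using mult_le_cancel1 by blast
    then show ?thesis unfolding excess_def by (simp flip: of_nat_mult)
  qed
  have "\<exists>\<S> B. B \<le> 2 \<and> pairable 1 (\<Union>F) \<S> B \<and> (\<forall>C. card C = k \<longrightarrow> pairs C \<subseteq> F \<longrightarrow> (\<exists>S\<in>\<S>. S \<subseteq> C))"
    by (rule clique_system[OF k _ F(1)]) (rule sparse)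
  then obtain \<S> B where SB: "B \<le> 2" "pairable 1 (\<Union>F) \<S> B" "\<forall>C. card C = k \<longrightarrow> pairs C \<subseteq> F \<longrightarrow> (\<exists>S\<in>\<S>. S \<subseteq> C)"
    by (elim exE conjE)
  have B: "B \<le> 1 + 1" using SB(1) by simp
  obtain D where D: "\<forall>e\<in>D. e \<subseteq> \<Union>F \<and> card e = 2" "\<forall>S\<in>\<S>. \<exists>e\<in>D. e \<subseteq> S"
    "\<forall>v\<in>\<Union>F. card {e\<in>D. v \<in> e} \<le> 1"
    by (rule pairable_obtain[OF SB(2) B])
  have "\<exists>e\<in>D. e \<subseteq> \<Union>Y" if Y: "Y \<in> cliques k" "Y \<subseteq> F" for Y
  proof -
    obtain C where C: "card C = k" "Y = pairs C" using cliques_iff[of k Y] k Y by auto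
    then obtain S where S: "S \<in> \<S>" "S \<subseteq> C" using SB(3) Y by blast
    then obtain e where e: "e \<in> D" "e \<subseteq> S" using D(2) by blast
    have "\<Union>Y = C" unfolding C(2) by (rule Union_pairs) (use C k in simp)
    then show ?thesis using e S by blast
  qed
  then show ?thesis using that[of D] D by blast
qed

section \<open>Maker's side\<close>

lemma Gnp_prob_bexp: "Gnp_prob n p P = bexp (all_edges n) p (\<lambda>E. if P E then 1 else 0)"
  unfolding Gnp_prob_def bexp_def by (rule sum.cong) auto

lemma bexp_compl:
  "bexp (all_edges n) p (\<lambda>E. if P E then 1 else 0) = 1 - bexp (all_edges n) p (\<lambda>E. if P E then 0 else 1)"
proof -
  have "(\<lambda>E. (if P E then 1 else 0) + (if P E then 0 else 1)) = (\<lambda>E. 1 :: real)" by auto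
  then have "1 = bexp (all_edges n) p (\<lambda>E. (if P E then 1 else 0) + (if P E then 0 else 1))"
    using bexp_const[OF finite_all_edges, of n p 1] by simp
  then show ?thesis unfolding bexp_add by simp
qed

lemma graph_finite:
  assumes "graph V E"
  shows "finite V" "finite E"
proof -
  show "finite V" using assms by (simp add: graph_def)
  moreover have "E \<subseteq> Pow V" using assms by (auto simp: graph_def)
  ultimately show "finite E" by (metis finite_Pow_iff finite_subset)
qed

definition edges_in :: "'a set set \<Rightarrow> 'a set \<Rightarrow> 'a set set" where
  "edges_in EH J = {e\<in>EH. e \<subseteq> J}"

lemma m1_bound:
  assumes H: "graph VH EH" and J: "J \<subseteq> VH" "2 \<le> card J"
  shows "real (card (edges_in EH J)) \<le> m1 VH EH * (real (card J) - 1)"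
proof -
  let ?S = "{d1 V' E' | V' E'. subgraph V' E' VH EH \<and> card V' \<ge> 2}"
  note fin = graph_finite[OF H]
  have "?S \<subseteq> (\<lambda>(V', E'). d1 V' E') ` (Pow VH \<times> Pow EH)" by (auto simp: subgraph_def)
  then have "finite ?S" using fin by (rule_tac finite_subset) auto
  moreover have "d1 J (edges_in EH J) \<in> ?S" using J by (auto simp: subgraph_def edges_in_def)
  ultimately have "d1 J (edges_in EH J) \<le> m1 VH EH" unfolding m1_def by (rule Max_ge)
  then show ?thesis unfolding d1_def using J(2) by (simp add: divide_le_eq)
qed

text \<open>Janson's inequality for transversal copies: \<open>M\<close> contains disjoint classes
  of \<open>m\<close> vertices, one for each vertex of H, and a copy picks one vertex per class. Two
  such copies share exactly the edges of H inside the set J where their choices agree, and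
  \<open>dense\<close> for J bounds the contribution of all pairs that agree on J.\<close>

lemma no_copy_prob:
  fixes VH :: "'a set" and p \<Lambda> :: real and m n :: nat
  assumes H: "graph VH EH" "EH \<noteq> {}" and M: "M \<subseteq> {0..<n}" "card VH * m \<le> card M"
    and p: "0 \<le> p" "p \<le> 1" and L: "0 < \<Lambda>"
    and dense: "\<And>J. J \<subseteq> VH \<Longrightarrow> edges_in EH J \<noteq> {} \<Longrightarrow> \<Lambda> \<le> real m ^ card J * p ^ card (edges_in EH J)"
  shows "bexp (all_edges n) p (\<lambda>E. if contains_copy M E VH EH then 0 else 1) \<le> exp (- \<Lambda> / 2 ^ (card VH + 1))"
proof -
  note finH = graph_finite[OF H(1)]
  have EH: "\<And>e. e \<in> EH \<Longrightarrow> e \<subseteq> VH \<and> card e = 2" using H by (simp add: graph_def)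
  have finM: "finite M" using M(1) finite_subset by auto
  have "card (VH \<times> {0..<m}) \<le> card M" using M(2) by (simp add: card_cartesian_product)
  then obtain \<psi> where \<psi>: "\<psi> ` (VH \<times> {0..<m}) \<subseteq> M" "inj_on \<psi> (VH \<times> {0..<m})"
    using card_le_inj[of "VH \<times> {0..<m}" M] finH finM by auto
  define v where "v = card VH"
  define e where "e = card EH"
  define I where "I = (PiE VH (\<lambda>_. {0..<m}))"
  define f where "f \<phi> x = \<psi> (x, \<phi> x)" for \<phi> x
  define A where "A \<phi> = (\<lambda>d. f \<phi> ` d) ` EH" for \<phi>
  have finI: "finite I" unfolding I_def using finH by (intro finite_PiE) auto
  have cI: "card I = m ^ v" unfolding I_def v_def using finH by (simp add: card_PiE)
  have f_eq: "f \<phi> x = f \<phi>' y \<longleftrightarrow> x = y \<and> \<phi> x = \<phi>' y" if "\<phi> \<in> I" "\<phi>' \<in> I" "x \<in> VH" "y \<in> VH" for \<phi> \<phi>' x y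
  proof -
    have "(x, \<phi> x) \<in> VH \<times> {0..<m}" "(y, \<phi>' y) \<in> VH \<times> {0..<m}" using that by (auto simp: I_def PiE_iff)
    then show ?thesis unfolding f_def using inj_on_eq_iff[OF \<psi>(2)] by auto
  qed
  have fM: "f \<phi> x \<in> M" if "\<phi> \<in> I" "x \<in> VH" for \<phi> x
  proof -
    have "(x, \<phi> x) \<in> VH \<times> {0..<m}" using that by (auto simp: I_def PiE_iff)
    then show ?thesis unfolding f_def using \<psi>(1) by blast
  qed
  have f_inj: "inj_on (f \<phi>) VH" if "\<phi> \<in> I" for \<phi> using f_eq that by (auto simp: inj_on_def)
  have img_eq: "f \<phi> ` d = f \<phi>' ` d' \<longleftrightarrow> d = d' \<and> (\<forall>x\<in>d. \<phi> x = \<phi>' x)"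
    if I: "\<phi> \<in> I" "\<phi>' \<in> I" "d \<in> EH" "d' \<in> EH" for \<phi> \<phi>' d d'
  proof
    have sub: "d \<subseteq> VH" "d' \<subseteq> VH" using EH I by auto
    assume eq: "f \<phi> ` d = f \<phi>' ` d'"
    have 1: "x \<in> d' \<and> \<phi> x = \<phi>' x" if x: "x \<in> d" for x
    proof -
      have "f \<phi> x \<in> f \<phi>' ` d'" using x eq by blast
      then obtain y where y: "y \<in> d'" "f \<phi> x = f \<phi>' y" by blast
      then show ?thesis using f_eq[OF I(1,2), of x y] x sub by auto
    qed
    have 2: "x \<in> d" if x: "x \<in> d'" for x
    proof -
      have "f \<phi>' x \<in> f \<phi> ` d" using x eq by blast
      then obtain y where y: "y \<in> d" "f \<phi>' x = f \<phi> y" by blast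
      then show ?thesis using f_eq[OF I(2,1), of x y] x sub by auto
    qed
    show "d = d' \<and> (\<forall>x\<in>d. \<phi> x = \<phi>' x)" using 1 2 by blast
  next
    assume "d = d' \<and> (\<forall>x\<in>d. \<phi> x = \<phi>' x)"
    then show "f \<phi> ` d = f \<phi>' ` d'" by (auto simp: f_def)
  qed
  have cA: "card (A \<phi>) = e" if "\<phi> \<in> I" for \<phi>
    unfolding A_def e_def using img_eq[OF that that] by (intro card_image) (auto simp: inj_on_def)
  have finA: "finite (A \<phi>)" for \<phi> using finH by (simp add: A_def)
  have AS: "A \<phi> \<subseteq> all_edges n" if "\<phi> \<in> I" for \<phi>
  proof
    fix d assume "d \<in> A \<phi>"
    then obtain d' where d': "d' \<in> EH" "d = f \<phi> ` d'" by (auto simp: A_def)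
    have "card d = 2" using d' EH[OF d'(1)] inj_on_subset[OF f_inj[OF that]] by (simp add: card_image)
    moreover have "d \<subseteq> {0..<n}" using fM that d' EH M(1) by blast
    ultimately show "d \<in> all_edges n" by (simp add: all_edges_def)
  qed
  define agree where "agree \<phi> \<phi>' = {x\<in>VH. \<phi> x = \<phi>' x}" for \<phi> \<phi>' :: "'a \<Rightarrow> nat"
  have AA: "A \<phi> \<inter> A \<phi>' = (\<lambda>d. f \<phi> ` d) ` edges_in EH (agree \<phi> \<phi>')" if I: "\<phi> \<in> I" "\<phi>' \<in> I" for \<phi> \<phi>'
  proof
    show "A \<phi> \<inter> A \<phi>' \<subseteq> (\<lambda>d. f \<phi> ` d) ` edges_in EH (agree \<phi> \<phi>')"
    proof
      fix x assume "x \<in> A \<phi> \<inter> A \<phi>'"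
      then obtain d d' where d: "d \<in> EH" "d' \<in> EH" "x = f \<phi> ` d" "x = f \<phi>' ` d'" by (auto simp: A_def)
      then have "d \<in> edges_in EH (agree \<phi> \<phi>')" using img_eq[OF I d(1,2)] EH[OF d(1)] by (auto simp: edges_in_def agree_def)
      then show "x \<in> (\<lambda>d. f \<phi> ` d) ` edges_in EH (agree \<phi> \<phi>')" using d by blast
    qed
    show "(\<lambda>d. f \<phi> ` d) ` edges_in EH (agree \<phi> \<phi>') \<subseteq> A \<phi> \<inter> A \<phi>'"
    proof
      fix x assume "x \<in> (\<lambda>d. f \<phi> ` d) ` edges_in EH (agree \<phi> \<phi>')"
      then obtain d where d: "d \<in> EH" "d \<subseteq> agree \<phi> \<phi>'" "x = f \<phi> ` d" by (auto simp: edges_in_def)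
      then have "f \<phi> ` d = f \<phi>' ` d" using img_eq[OF I d(1,1)] by (auto simp: agree_def)
      then have "x \<in> A \<phi>" "x \<in> A \<phi>'" using d unfolding A_def by blast+
      then show "x \<in> A \<phi> \<inter> A \<phi>'" by blast
    qed
  qed
  have cAA: "card (A \<phi> \<inter> A \<phi>') = card (edges_in EH (agree \<phi> \<phi>'))" if I: "\<phi> \<in> I" "\<phi>' \<in> I" for \<phi> \<phi>'
    unfolding AA[OF I] using img_eq[OF I(1) I(1)] by (intro card_image) (auto simp: inj_on_def edges_in_def)
  have eJ: "card (edges_in EH J) \<le> e" for J unfolding e_def edges_in_def using finH by (intro card_mono) auto
  define \<mu> where "\<mu> = (\<Sum>\<phi>\<in>I. p ^ card (A \<phi>))"
  define \<Delta> where "\<Delta> = (\<Sum>\<phi>\<in>I. \<Sum>\<phi>'\<in>{\<phi>'\<in>I. A \<phi> \<inter> A \<phi>' \<noteq> {}}. p ^ card (A \<phi> \<union> A \<phi>'))"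
  have mu: "\<mu> = real m ^ v * p ^ e"
    unfolding \<mu>_def using cA cI by (simp add: of_nat_power)
  have "edges_in EH VH = EH" using EH by (auto simp: edges_in_def)
  then have muL: "\<Lambda> \<le> \<mu>" using dense[of VH] H(2) mu by (simp add: v_def e_def)
  then have mu0: "0 < \<mu>" using L by simp
  define \<J> where "\<J> = {J. J \<subseteq> VH \<and> edges_in EH J \<noteq> {}}"
  have finJ: "finite \<J>" unfolding \<J>_def using finH by auto
  have cJ: "real (card \<J>) \<le> 2 ^ v"
  proof -
    have "card \<J> \<le> card (Pow VH)" unfolding \<J>_def using finH by (intro card_mono) auto
    then have "card \<J> \<le> 2 ^ v" using finH by (simp add: card_Pow v_def)
    then show ?thesis using of_nat_mono[where 'a=real] by fastforce
  qed
  have inner: "(\<Sum>\<phi>'\<in>{\<phi>'\<in>I. A \<phi> \<inter> A \<phi>' \<noteq> {}}. p ^ card (A \<phi> \<union> A \<phi>')) \<le> 2 ^ v * (p ^ e * (\<mu> / \<Lambda>))" if \<phi>: "\<phi> \<in> I" for \<phi>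
  proof -
    let ?S = "{\<phi>'\<in>I. A \<phi> \<inter> A \<phi>' \<noteq> {}}"
    have "agree \<phi> \<phi>' \<in> \<J>" if "\<phi>' \<in> ?S" for \<phi>'
    proof -
      have "edges_in EH (agree \<phi> \<phi>') \<noteq> {}" using that AA[OF \<phi>, of \<phi>'] by auto
      then show ?thesis by (simp add: \<J>_def agree_def)
    qed
    then have img: "agree \<phi> ` ?S \<subseteq> \<J>" by (rule image_subsetI)
    have "(\<Sum>\<phi>'\<in>?S. p ^ card (A \<phi> \<union> A \<phi>')) = (\<Sum>J\<in>\<J>. \<Sum>\<phi>'\<in>{\<phi>'\<in>?S. agree \<phi> \<phi>' = J}. p ^ card (A \<phi> \<union> A \<phi>'))"
      by (rule sum.group[symmetric]) (use finI finJ img in auto)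
    also have "\<dots> \<le> (\<Sum>J\<in>\<J>. p ^ e * (\<mu> / \<Lambda>))"
    proof (rule sum_mono)
      fix J assume J: "J \<in> \<J>"
      then have JV: "J \<subseteq> VH" "edges_in EH J \<noteq> {}" by (auto simp: \<J>_def)
      let ?T = "{\<phi>'\<in>?S. agree \<phi> \<phi>' = J}"
      let ?j = "card (edges_in EH J)"
      have "(\<Sum>\<phi>'\<in>?T. p ^ card (A \<phi> \<union> A \<phi>')) = (\<Sum>\<phi>'\<in>?T. p ^ (e + (e - ?j)))"
      proof (rule sum.cong[OF refl])
        fix \<phi>' assume T: "\<phi>' \<in> ?T"
        have "card (A \<phi>) + card (A \<phi>') = card (A \<phi> \<union> A \<phi>') + card (A \<phi> \<inter> A \<phi>')"
          by (rule card_Un_Int[OF finA finA])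
        then have "card (A \<phi> \<union> A \<phi>') = e + (e - ?j)" using cA[OF \<phi>] cA[of \<phi>'] cAA[OF \<phi>, of \<phi>'] T eJ[of J] by auto
        then show "p ^ card (A \<phi> \<union> A \<phi>') = p ^ (e + (e - ?j))" by simp
      qed
      also have "\<dots> = real (card ?T) * (p ^ e * p ^ (e - ?j))" by (simp add: power_add)
      also have "\<dots> \<le> real (m ^ (v - card J)) * (p ^ e * p ^ (e - ?j))"
      proof (intro mult_right_mono)
        have finJ': "finite J" using JV finH finite_subset by blast
        let ?r = "\<lambda>\<phi>'. restrict \<phi>' (VH - J)"
        have "inj_on ?r ?T"
        proof (rule inj_onI)
          fix \<alpha> \<beta> assume ab: "\<alpha> \<in> ?T" "\<beta> \<in> ?T" "?r \<alpha> = ?r \<beta>"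
          have I: "\<alpha> \<in> I" "\<beta> \<in> I" using ab by auto
          have "\<alpha> x = \<beta> x" if "x \<in> VH" for x
          proof (cases "x \<in> J")
            case True
            then have "\<phi> x = \<alpha> x" "\<phi> x = \<beta> x" using ab by (auto simp: agree_def)
            then show ?thesis by simp
          next
            case False
            then show ?thesis using fun_cong[OF ab(3), of x] that by simp
          qed
          then show "\<alpha> = \<beta>" using I unfolding I_def by (rule_tac PiE_ext) auto
        qed
        moreover have "?r ` ?T \<subseteq> PiE (VH - J) (\<lambda>_. {0..<m})" by (auto simp: I_def PiE_iff)
        ultimately have "card ?T \<le> card (PiE (VH - J) (\<lambda>_. {0..<m}))"
          using finH by (intro card_inj_on_le[of ?r]) (auto intro: finite_PiE)
        also have "\<dots> = m ^ (v - card J)" using finH JV finJ' by (simp add: card_PiE card_Diff_subset v_def)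
        finally show "real (card ?T) \<le> real (m ^ (v - card J))" by (rule of_nat_mono)
      qed (use p in auto)
      also have "\<dots> = p ^ e * (real m ^ (v - card J) * p ^ (e - ?j))" by (simp add: of_nat_power)
      also have "\<dots> \<le> p ^ e * (\<mu> / \<Lambda>)"
      proof (rule mult_left_mono)
        have jv: "card J \<le> v" unfolding v_def using JV finH by (intro card_mono) auto
        let ?x = "real m ^ (v - card J) * p ^ (e - ?j)"
        have "\<Lambda> * ?x \<le> (real m ^ card J * p ^ ?j) * ?x"
          using dense[OF JV] p by (intro mult_right_mono) auto
        also have "\<dots> = real m ^ (card J + (v - card J)) * p ^ (?j + (e - ?j))" by (simp add: power_add)
        also have "\<dots> = \<mu>" using jv eJ[of J] mu by simp
        finally show "?x \<le> \<mu> / \<Lambda>" using L by (simp add: pos_le_divide_eq mult.commute)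
      qed (use p in auto)
      finally show "(\<Sum>\<phi>'\<in>?T. p ^ card (A \<phi> \<union> A \<phi>')) \<le> p ^ e * (\<mu> / \<Lambda>)" .
    qed
    also have "\<dots> = real (card \<J>) * (p ^ e * (\<mu> / \<Lambda>))" by simp
    also have "\<dots> \<le> 2 ^ v * (p ^ e * (\<mu> / \<Lambda>))" using cJ p mu0 L by (intro mult_right_mono) auto
    finally show ?thesis .
  qed
  have "\<Delta> \<le> (\<Sum>\<phi>\<in>I. 2 ^ v * (p ^ e * (\<mu> / \<Lambda>)))" unfolding \<Delta>_def by (rule sum_mono) (rule inner)
  also have "\<dots> = 2 ^ v * (\<mu> * (\<mu> / \<Lambda>))" using cI by (simp add: mu of_nat_power)
  finally have De: "\<Delta> \<le> 2 ^ v * (\<mu> * (\<mu> / \<Lambda>))" .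
  \<comment> \<open>The minimiser of the exponent after \<Delta> is replaced by its bound 2^v
    \<mu>^2 / \<Lambda>.\<close>
  define t where "t = \<Lambda> / (2 ^ v * \<mu>)"
  have t0: "0 \<le> t" using L mu0 by (simp add: t_def)
  have "bexp (all_edges n) p (\<lambda>E. if \<exists>\<phi>\<in>I. A \<phi> \<subseteq> E then 0 else 1) \<le> exp (\<Delta> * t\<^sup>2 / 2 - \<mu> * t)"
    by (rule Janson[OF finite_all_edges finI AS p t0 \<mu>_def \<Delta>_def])
  also have "\<Delta> * t\<^sup>2 / 2 - \<mu> * t \<le> - \<Lambda> / 2 ^ (v + 1)"
  proof -
    have "\<Delta> * t\<^sup>2 \<le> 2 ^ v * (\<mu> * (\<mu> / \<Lambda>)) * t\<^sup>2" using De by (rule mult_right_mono) simp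
    also have "\<dots> = \<Lambda> / 2 ^ v" unfolding t_def using mu0 L by (simp add: power2_eq_square field_simps)
    finally have le: "\<Delta> * t\<^sup>2 / 2 \<le> \<Lambda> / 2 ^ v / 2" by simp
    have mt: "\<mu> * t = \<Lambda> / 2 ^ v" unfolding t_def using mu0 by simp
    have eq: "- \<Lambda> / 2 ^ (v + 1) = \<Lambda> / 2 ^ v / 2 - \<Lambda> / 2 ^ v" by simp
    show ?thesis unfolding mt eq using le by (rule diff_right_mono)
  qed
  finally have J: "bexp (all_edges n) p (\<lambda>E. if \<exists>\<phi>\<in>I. A \<phi> \<subseteq> E then 0 else 1) \<le> exp (- \<Lambda> / 2 ^ (v + 1))" by simp
  have "bexp (all_edges n) p (\<lambda>E. if contains_copy M E VH EH then 0 else 1)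
     \<le> bexp (all_edges n) p (\<lambda>E. if \<exists>\<phi>\<in>I. A \<phi> \<subseteq> E then 0 else 1)"
  proof (rule bexp_mono[OF p])
    fix E
    have "contains_copy M E VH EH" if "\<phi> \<in> I" "A \<phi> \<subseteq> E" for \<phi>
      unfolding contains_copy_def
    proof (intro exI[of _ "f \<phi>"] conjI ballI)
      show "inj_on (f \<phi>) VH" by (rule f_inj[OF that(1)])
      show "f \<phi> ` VH \<subseteq> M" using fM[OF that(1)] by blast
      show "f \<phi> ` d \<in> E" if "d \<in> EH" for d using that \<open>A \<phi> \<subseteq> E\<close> by (auto simp: A_def)
    qed
    then show "(if contains_copy M E VH EH then 0 else 1) \<le> (if \<exists>\<phi>\<in>I. A \<phi> \<subseteq> E then 0 else (1::real))" by auto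
  qed
  then show ?thesis using J by (simp add: v_def)
qed

text \<open>At most 2^n sets can be Maker's final set, all of linear size, and \<open>C\<close> is
  so large that each of them fails with probability at most exp(-2 n).\<close>

lemma maker_wins_whp:
  fixes VH :: "'a set" and p :: "nat \<Rightarrow> real"
  assumes H: "graph VH EH" "EH \<noteq> {}" and b: "0 < b" and m1: "0 < m1 VH EH"
    and \<gamma>: "\<gamma> = 1 / (4 * (real b + 1) * card VH)" and C: "1 \<le> C" "2 ^ (card VH + 1) * 2 / \<gamma> ^ card VH \<le> C"
    and p: "\<And>n. 0 \<le> p n \<and> p n \<le> 1"
    and le: "\<forall>\<^sub>F n in sequentially. C * real n powr (- 1 / m1 VH EH) \<le> p n"
  shows "(\<lambda>n. Gnp_prob n (p n) (\<lambda>E. maker_win maker_first b {0..<n} E VH EH)) \<longlonglongrightarrow> 1"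
proof -
  note finH = graph_finite[OF H(1)]
  have EH: "\<And>e. e \<in> EH \<Longrightarrow> e \<subseteq> VH \<and> card e = 2" using H by (simp add: graph_def)
  obtain e0 where e0: "e0 \<in> EH" using H(2) by blast
  have v2: "2 \<le> card VH" using EH[OF e0] card_mono[OF finH(1), of e0] by simp
  \<comment> \<open>A final set of Maker has about n / (b + 1) vertices. The factor 2 in
    \<open>q\<close> absorbs the additive \<open>b\<close>, and the further factor 2 in \<gamma> the
    rounding in \<open>n div q\<close>.\<close>
  define q where "q = 2 * (b + 1) * card VH"
  have q0: "0 < q" using v2 by (simp add: q_def)
  have "card VH \<le> q" by (simp add: q_def)
  have \<gamma>q: "\<gamma> = 1 / (2 * real q)" unfolding \<gamma> q_def by (simp add: algebra_simps)
  have \<gamma>01: "0 < \<gamma>" "\<gamma> \<le> 1" using q0 by (auto simp: \<gamma>q)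
  have "\<forall>\<^sub>F n in sequentially. 1 - Gnp_prob n (p n) (\<lambda>E. maker_win maker_first b {0..<n} E VH EH) \<le> exp (- real n)"
    using le eventually_ge_at_top[of "2 * q + 2 * b"]
  proof eventually_elim
    case (elim n)
    have n: "1 \<le> n" "2 * q \<le> n" "2 * b \<le> n" using elim q0 by auto
    define m where "m = n div q"
    have "real n < real q * (real m + 1)"
      using q0 unfolding m_def by (metis add.commute dividend_less_div_times mult.commute of_nat_Suc of_nat_less_iff of_nat_mult plus_1_eq_Suc mult_Suc)
    moreover have "real q \<le> real n / 2" using n(2) by linarith
    ultimately have "real n / 2 \<le> real q * real m" by (simp add: algebra_simps)
    then have mge: "\<gamma> * real n \<le> real m" using q0 by (simp add: \<gamma>q field_simps)
    define \<Lambda> where "\<Lambda> = \<gamma> ^ card VH * C * real n"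
    have L0: "0 < \<Lambda>" using \<gamma>01 C n by (simp add: \<Lambda>_def)
    have dense: "\<Lambda> \<le> real m ^ card J * p n ^ card (edges_in EH J)" if J: "J \<subseteq> VH" "edges_in EH J \<noteq> {}" for J
    proof -
      let ?e = "card (edges_in EH J)" and ?j = "card J"
      obtain d where d: "d \<in> EH" "d \<subseteq> J" using J(2) by (auto simp: edges_in_def)
      have finJ: "finite J" using J finH finite_subset by blast
      have j2: "2 \<le> ?j" using card_mono[OF finJ d(2)] EH[OF d(1)] by simp
      have jv: "?j \<le> card VH" using J finH by (intro card_mono) auto
      have "finite (edges_in EH J)" using finH by (simp add: edges_in_def)
      then have e1: "1 \<le> ?e" using J(2) by (simp add: Suc_leI card_gt_0_iff)
      have "real ?e \<le> m1 VH EH * (real ?j - 1)" by (rule m1_bound[OF H(1) J(1) j2])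
      then have "real ?e / m1 VH EH \<le> real ?j - 1" using m1 by (simp add: divide_le_eq mult.commute)
      then have ex: "- (real ?j - 1) \<le> - 1 / m1 VH EH * real ?e" by simp
      \<comment> \<open>Since e / m1 <= j - 1, every subgraph with an edge leaves at least one
        factor n; this is what the threshold exponent provides.\<close>
      have "\<Lambda> = \<gamma> ^ card VH * real n ^ ?j * (C * real n powr (- (real ?j - 1)))"
        using n by (simp add: \<Lambda>_def powr_diff powr_minus powr_realpow field_simps)
      also have "\<dots> \<le> \<gamma> ^ ?j * real n ^ ?j * (C ^ ?e * real n powr (- 1 / m1 VH EH * real ?e))"
      proof (intro mult_mono)
        show "\<gamma> ^ card VH \<le> \<gamma> ^ ?j" using \<gamma>01 jv by (intro power_decreasing) auto
        show "C \<le> C ^ ?e" using C(1) e1 power_increasing[of 1 ?e C] by simp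
        show "real n powr (- (real ?j - 1)) \<le> real n powr (- 1 / m1 VH EH * real ?e)"
          using ex n by (intro powr_mono) auto
      qed (use \<gamma>01 C in auto)
      also have "\<dots> = (\<gamma> * real n) ^ ?j * (C * real n powr (- 1 / m1 VH EH)) ^ ?e"
        using n by (simp add: power_mult_distrib powr_realpow[symmetric] powr_powr)
      also have "\<dots> \<le> real m ^ ?j * p n ^ ?e"
        using mge elim(1) \<gamma>01 C by (intro mult_mono power_mono) auto
      finally show ?thesis .
    qed
    let ?bad = "\<lambda>M E. M \<subseteq> {0..<n} \<and> n \<le> (b + 1) * card M + b \<and> \<not> contains_copy M E VH EH"
    have size: "card VH * m \<le> card M" if "n \<le> (b + 1) * card M + b" for M :: "nat set"
    proof -
      have "q * m \<le> n" unfolding m_def by simp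
      then have "2 * ((b + 1) * (card VH * m)) \<le> n" by (simp add: q_def mult_ac)
      moreover have "n \<le> 2 * ((b + 1) * card M)" using that n(3) by linarith
      ultimately have "(b + 1) * (card VH * m) \<le> (b + 1) * card M" by linarith
      then show ?thesis using mult_le_cancel1[of "b + 1"] by simp
    qed
    have win: "maker_win maker_first b {0..<n} E VH EH" if "\<nexists>M. ?bad M E" for E
      unfolding maker_win_def
      by (rule mb_win_if_large_sets_win[OF _ b]) (use that in auto)
    have "1 - Gnp_prob n (p n) (\<lambda>E. maker_win maker_first b {0..<n} E VH EH)
       = bexp (all_edges n) (p n) (\<lambda>E. if maker_win maker_first b {0..<n} E VH EH then 0 else 1)"
      unfolding Gnp_prob_bexp bexp_compl by simp
    also have "\<dots> \<le> bexp (all_edges n) (p n) (\<lambda>E. \<Sum>M\<in>{M. M \<subseteq> {0..<n} \<and> n \<le> (b + 1) * card M + b}. if contains_copy M E VH EH then 0 else 1)"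
    proof (rule bexp_mono)
      fix E
      let ?S = "{M. M \<subseteq> {0..<n} \<and> n \<le> (b + 1) * card M + b}"
      have finS: "finite ?S" by simp
      show "(if maker_win maker_first b {0..<n} E VH EH then 0 else 1) \<le> (\<Sum>M\<in>?S. if contains_copy M E VH EH then 0 else (1::real))"
      proof (cases "\<exists>M. ?bad M E")
        case True
        then obtain M where M: "M \<in> ?S" "\<not> contains_copy M E VH EH" by blast
        have "(if contains_copy M E VH EH then 0 else (1::real)) \<le> (\<Sum>M\<in>?S. if contains_copy M E VH EH then 0 else (1::real))"
          by (rule member_le_sum) (use M finS in auto)
        then show ?thesis using M by auto
      next
        case False
        then have "maker_win maker_first b {0..<n} E VH EH" by (rule win)
        then show ?thesis by (auto intro: sum_nonneg)
      qed
    qed (use p in auto)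
    also have "\<dots> = (\<Sum>M\<in>{M. M \<subseteq> {0..<n} \<and> n \<le> (b + 1) * card M + b}. bexp (all_edges n) (p n) (\<lambda>E. if contains_copy M E VH EH then 0 else 1))"
      by (rule bexp_sum)
    also have "\<dots> \<le> (\<Sum>M\<in>{M. M \<subseteq> {0..<n} \<and> n \<le> (b + 1) * card M + b}. exp (- \<Lambda> / 2 ^ (card VH + 1)))"
      by (rule sum_mono, rule no_copy_prob[OF H _ _ _ _ L0 dense]) (use p size in auto)
    also have "\<dots> = real (card {M. M \<subseteq> {0..<n} \<and> n \<le> (b + 1) * card M + b}) * exp (- \<Lambda> / 2 ^ (card VH + 1))" by simp
    also have "\<dots> \<le> exp (real n) * exp (- (2 * real n))"
    proof (intro mult_mono)
      have "card {M. M \<subseteq> {0..<n} \<and> n \<le> (b + 1) * card M + b} \<le> card (Pow {0..<n})" by (intro card_mono) auto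
      then have "real (card {M. M \<subseteq> {0..<n} \<and> n \<le> (b + 1) * card M + b}) \<le> 2 ^ n"
        using of_nat_mono[where 'a=real] by (fastforce simp: card_Pow)
      also have "(2::real) ^ n \<le> exp 1 ^ n" using exp_ge_add_one_self[of "1::real"] by (intro power_mono) auto
      also have "\<dots> = exp (real n)" by (simp add: exp_of_nat_mult[symmetric])
      finally show "real (card {M. M \<subseteq> {0..<n} \<and> n \<le> (b + 1) * card M + b}) \<le> exp (real n)" .
      have "2 ^ (card VH + 1) * 2 \<le> C * \<gamma> ^ card VH" using C(2) \<gamma>01 by (simp add: divide_le_eq)
      then have "2 ^ (card VH + 1) * 2 * real n \<le> C * \<gamma> ^ card VH * real n" by (rule mult_right_mono) simp
      then have "2 * real n \<le> \<Lambda> / 2 ^ (card VH + 1)" by (simp add: \<Lambda>_def field_simps)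
      then show "exp (- \<Lambda> / 2 ^ (card VH + 1)) \<le> exp (- (2 * real n))" by simp
    qed auto
    also have "\<dots> = exp (- real n)" by (simp add: exp_add[symmetric])
    finally show ?case .
  qed
  then have ev: "\<forall>\<^sub>F n in sequentially. 1 - exp (- real n) \<le> Gnp_prob n (p n) (\<lambda>E. maker_win maker_first b {0..<n} E VH EH)"
    by eventually_elim linarith
  have le1: "Gnp_prob n (p n) P \<le> 1" for n P
  proof -
    have "bexp (all_edges n) (p n) (\<lambda>E. if P E then 1 else 0) \<le> bexp (all_edges n) (p n) (\<lambda>_. 1)"
      by (rule bexp_mono) (use p in auto)
    then show ?thesis using finite_all_edges by (simp add: Gnp_prob_bexp)
  qed
  have "(\<lambda>n. 1 - exp (- real n)) \<longlonglongrightarrow> 1" by real_asymp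
  moreover have "\<forall>\<^sub>F n in sequentially. Gnp_prob n (p n) (\<lambda>E. maker_win maker_first b {0..<n} E VH EH) \<le> 1"
    using le1 by (rule always_eventually[OF allI])
  ultimately show ?thesis by (intro tendsto_sandwich[OF ev _ _ tendsto_const])
qed

section \<open>Breaker's side and the threshold\<close>

definition pair_coverable :: "'v set set set \<Rightarrow> nat \<Rightarrow> 'v set set \<Rightarrow> bool" where
  "pair_coverable \<C> c F \<longleftrightarrow> (\<exists>D. (\<forall>e\<in>D. e \<subseteq> \<Union>F \<and> card e = 2) \<and>
     (\<forall>Y\<in>\<C>. Y \<subseteq> F \<longrightarrow> (\<exists>e\<in>D. e \<subseteq> \<Union>Y)) \<and> (\<forall>v\<in>\<Union>F. card {e\<in>D. v \<in> e} \<le> c))"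

text \<open>Both are closed under the copies meeting them, so a shared vertex makes each contain the
  other. Pairs chosen in different components therefore never meet.\<close>

lemma component_unique:
  assumes "component \<C> E F" "component \<C> E F'" "\<Union>F \<inter> \<Union>F' \<noteq> {}" "\<And>X e. X \<in> \<C> \<Longrightarrow> e \<in> X \<Longrightarrow> e \<noteq> {}"
  shows "F = F'"
proof -
  have sub: "F \<subseteq> F'" if F: "component \<C> E F" "component \<C> E F'" "\<Union>F \<inter> \<Union>F' \<noteq> {}" for F F'
  proof
    have cu: "conn_union \<C> F" "F \<subseteq> E" using F(1) by (auto simp: component_def)
    have cl: "X \<subseteq> F'" if "X \<in> \<C>" "X \<subseteq> F" "\<Union>X \<inter> \<Union>F' \<noteq> {}" for X
      using F(2) cu that unfolding component_def by blast
    have UF: "\<Union>F \<subseteq> \<Union>F'" by (rule conn_union_closed_subset[OF cu(1) _ F(3)]) (use cl in blast)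
    fix e assume "e \<in> F"
    then obtain X where X: "X \<in> \<C>" "X \<subseteq> F" "e \<in> X" using conn_union_cover[OF cu(1)] by blast
    then have "\<Union>X \<inter> \<Union>F' \<noteq> {}" using assms(4)[OF X(1,3)] UF by blast
    then show "e \<in> F'" using cl X by blast
  qed
  show ?thesis using sub[OF assms(1,2,3)] sub[OF assms(2,1)] assms(3) by (simp add: Int_commute subset_antisym)
qed

context nat_copy_family
begin

text \<open>Components are vertex-disjoint, so the pairs found in each can be united without adding
  up degrees. Without overrun every copy lies in a component that is not dense, hence contains a
  chosen pair.\<close>

lemma breaker_wins_no_overrun:
  assumes E: "E \<subseteq> all_edges n" and no: "\<And>v. v < n \<Longrightarrow> \<not> overrun M {} {v} {} E"
    and cover: "\<And>F. conn_union \<C> F \<Longrightarrow> \<not> dense_edges k h (\<Union>F) F \<Longrightarrow> pair_coverable \<C> c F"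
    and cb: "c \<le> b"
    and copy: "\<And>M. contains_copy M E VH EH \<Longrightarrow> \<exists>X\<in>\<C>. X \<subseteq> E \<and> \<Union>X \<subseteq> M"
  shows "\<not> maker_win maker_first b {0..<n} E VH EH"
proof -
  define \<F> where "\<F> = {F. component \<C> E F \<and> \<not> dense_edges k h (\<Union>F) F}"
  define cov where "cov F D \<longleftrightarrow> (\<forall>e\<in>D. e \<subseteq> \<Union>F \<and> card e = 2) \<and>
     (\<forall>Y\<in>\<C>. Y \<subseteq> F \<longrightarrow> (\<exists>e\<in>D. e \<subseteq> \<Union>Y)) \<and> (\<forall>v\<in>\<Union>F. card {e\<in>D. v \<in> e} \<le> c)" for F D
  have "\<forall>F\<in>\<F>. \<exists>D. cov F D"
    using cover unfolding pair_coverable_def \<F>_def component_def cov_def by auto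
  then obtain D where cov: "\<forall>F\<in>\<F>. cov F (D F)" by (auto dest!: bchoice)
  have D: "\<And>F e. F \<in> \<F> \<Longrightarrow> e \<in> D F \<Longrightarrow> e \<subseteq> \<Union>F \<and> card e = 2"
     "\<And>F Y. F \<in> \<F> \<Longrightarrow> Y \<in> \<C> \<Longrightarrow> Y \<subseteq> F \<Longrightarrow> (\<exists>e\<in>D F. e \<subseteq> \<Union>Y)" "\<And>F v. F \<in> \<F> \<Longrightarrow> v \<in> \<Union>F \<Longrightarrow> card {e\<in>D F. v \<in> e} \<le> c"
    using cov unfolding cov_def by blast+
  define DD where "DD = (\<Union>F\<in>\<F>. D F)"
  have En: "\<Union>E \<subseteq> {0..<n}" using E by (auto simp: all_edges_def)
  have Fn: "\<Union>F \<subseteq> {0..<n}" if "F \<in> \<F>" for F using that En by (auto simp: \<F>_def component_def)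
  have DDn: "e \<subseteq> {0..<n}" "card e = 2" if "e \<in> DD" for e
    using that D(1) Fn unfolding DD_def by (metis UN_E order_trans)+
  have finDD: "finite DD" by (rule finite_subset[of _ "Pow {0..<n}"]) (use DDn in auto)
  have ne: "e \<noteq> {}" if "X \<in> \<C>" "e \<in> X" for X e using card_edge[OF that] by auto
  have deg: "card {e\<in>DD. v \<in> e} \<le> b" for v
  proof (cases "\<exists>F\<in>\<F>. v \<in> \<Union>F")
    case True
    then obtain F where F: "F \<in> \<F>" "v \<in> \<Union>F" by blast
    have "{e\<in>DD. v \<in> e} \<subseteq> {e\<in>D F. v \<in> e}"
    proof
      fix e assume "e \<in> {e\<in>DD. v \<in> e}"
      then obtain F' where F': "F' \<in> \<F>" "e \<in> D F'" "v \<in> e" by (auto simp: DD_def)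
      then have "v \<in> \<Union>F'" using D(1) by blast
      then have "\<Union>F \<inter> \<Union>F' \<noteq> {}" using F(2) by blast
      then have "F = F'" using F(1) F'(1) ne unfolding \<F>_def by (intro component_unique[of \<C> E]) auto
      then show "e \<in> {e\<in>D F. v \<in> e}" using F' by simp
    qed
    moreover have "finite (D F)"
      by (rule finite_subset[of _ "Pow {0..<n}"]) (use D(1)[OF F(1)] Fn[OF F(1)] in auto)
    ultimately have "card {e\<in>DD. v \<in> e} \<le> card {e\<in>D F. v \<in> e}" by (intro card_mono) auto
    also have "\<dots> \<le> c" using D(3) F by blast
    finally show ?thesis using cb by simp
  next
    case False
    have "v \<notin> e" if e: "e \<in> DD" for e
    proof
      assume v: "v \<in> e"
      obtain F where F: "F \<in> \<F>" "e \<in> D F" using e unfolding DD_def by blast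
      then have "v \<in> \<Union>F" using D(1)[OF F] v by blast
      then show False using False F(1) by blast
    qed
    then have "{e\<in>DD. v \<in> e} = {}" by blast
    then show ?thesis by (simp only: card.empty le0)
  qed
  have W: "\<exists>e\<in>DD. e \<subseteq> M'" if M': "M' \<subseteq> {0..<n}" "contains_copy M' E VH EH" for M'
  proof -
    obtain X where X: "X \<in> \<C>" "X \<subseteq> E" "\<Union>X \<subseteq> M'" using copy M' by blast
    have "card (\<Union>X) \<noteq> 0" using card_verts[OF X(1)] k2 by simp
    then have "\<Union>X \<noteq> {}" by (metis card.empty)
    then obtain v where v: "v \<in> \<Union>X" by blast
    then have "v \<in> {0..<n}" using X(3) M'(1) by blast
    then have "v < n" by simp
    then obtain F where F: "component \<C> E F" "X \<subseteq> F" "\<not> dense_edges k h (\<Union>F) F"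
      using no_overrun_component[OF no X(1,2) v] by blast
    then have "F \<in> \<F>" by (simp add: \<F>_def)
    then obtain e where "e \<in> D F" "e \<subseteq> \<Union>X" using D(2) X(1) F(2) by blast
    then show ?thesis using \<open>F \<in> \<F>\<close> X(3) unfolding DD_def by blast
  qed
  show ?thesis unfolding maker_win_def
  proof (rule pairing_strategy[of _ DD])
    show "\<not> e \<subseteq> {}" if "e \<in> DD" for e using DDn(2)[OF that] by auto
  qed (use DDn deg finDD W in auto)
qed

lemma breaker_wins_whp:
  fixes p :: "nat \<Rightarrow> real" and c0 :: real
  assumes c0: "0 < c0" "c0 \<le> 1" "2 ^ (2 ^ k) * c0 ^ h * 4 ^ (k - 1) \<le> 1 / 8"
    and p: "\<And>n. 0 \<le> p n \<and> p n \<le> 1"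
    and le: "\<forall>\<^sub>F n in sequentially. p n \<le> c0 * real n powr (- (real (k - 1) / h))"
    and cover: "\<And>F. conn_union \<C> F \<Longrightarrow> \<not> dense_edges k h (\<Union>F) F \<Longrightarrow> pair_coverable \<C> c F"
    and cb: "c \<le> b"
    and copy: "\<And>M E. contains_copy M E VH EH \<Longrightarrow> \<exists>X\<in>\<C>. X \<subseteq> E \<and> \<Union>X \<subseteq> M"
  shows "(\<lambda>n. Gnp_prob n (p n) (\<lambda>E. maker_win maker_first b {0..<n} E VH EH)) \<longlonglongrightarrow> 0"
proof -
  obtain M where M: "(\<lambda>n. bexp (all_edges n) (p n) (\<lambda>E. if \<exists>v<n. overrun (M n) {} {v} {} E then 1 else 0)) \<longlonglongrightarrow> 0"
    using overrun_limit[OF c0 p le] by blast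
  show ?thesis
  proof (rule tendsto_sandwich[OF _ _ tendsto_const M])
    show "\<forall>\<^sub>F n in sequentially. 0 \<le> Gnp_prob n (p n) (\<lambda>E. maker_win maker_first b {0..<n} E VH EH)"
      unfolding Gnp_prob_bexp by (intro always_eventually allI bexp_nonneg) (use p in auto)
    show "\<forall>\<^sub>F n in sequentially. Gnp_prob n (p n) (\<lambda>E. maker_win maker_first b {0..<n} E VH EH)
      \<le> bexp (all_edges n) (p n) (\<lambda>E. if \<exists>v<n. overrun (M n) {} {v} {} E then 1 else 0)"
      unfolding Gnp_prob_bexp
    proof (intro always_eventually allI bexp_mono)
      fix n E assume E: "E \<subseteq> all_edges n"
      have "\<exists>v<n. overrun (M n) {} {v} {} E" if "maker_win maker_first b {0..<n} E VH EH"
        using breaker_wins_no_overrun[OF E _ cover cb copy] that by blast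
      then show "(if maker_win maker_first b {0..<n} E VH EH then 1 else 0) \<le> (if \<exists>v<n. overrun (M n) {} {v} {} E then 1 else (0::real))"
        by auto
    qed (use p in auto)
  qed
qed

lemma small_constant:
  "\<exists>c0::real. 0 < c0 \<and> c0 \<le> 1 \<and> 2 ^ (2 ^ k) * c0 ^ h * 4 ^ (k - 1) \<le> 1 / 8"
proof -
  define K :: real where "K = 2 ^ (2 ^ k) * 4 ^ (k - 1)"
  have "1 * 1 \<le> K" unfolding K_def by (rule mult_mono) auto
  then have K: "1 \<le> K" by simp
  define c0 where "c0 = 1 / (8 * K)"
  have c0: "0 < c0" "c0 \<le> 1" using K by (auto simp: c0_def)
  have "c0 ^ h \<le> c0 ^ 1" using c0 h1 by (intro power_decreasing) auto
  then have "K * c0 ^ h \<le> K * c0" using K by simp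
  also have "\<dots> = 1 / 8" using K by (simp add: c0_def)
  finally show ?thesis using c0 by (intro exI[of _ c0]) (simp add: K_def mult_ac)
qed

end

section \<open>Images of cliques and cycles under injections\<close>

lemma is_cycle_Union:
  assumes "is_cycle k V X" "3 \<le> k"
  shows "\<Union>X = V" "card X = k" "card V = k"
proof -
  obtain g where g: "cycle_param k g X" "range g = V" using is_cycle_param[OF assms(1)] assms(2) by auto
  show "\<Union>X = V" using cyc_Union[OF assms(2) g(1)] g(2) by simp
  then show "card X = k" "card V = k" using cyc_card[OF assms(2) g(1)] by auto
qed

lemma is_cycle_image:
  assumes "is_cycle k V X" "inj_on f V"
  shows "is_cycle k (f ` V) ((\<lambda>e. f ` e) ` X)"
proof -
  obtain g where g: "bij_betw g {0..<k} V" "X = {{g i, g ((i + 1) mod k)} | i. i < k}"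
    using assms(1) unfolding is_cycle_def by blast
  have "bij_betw (f \<circ> g) {0..<k} (f ` V)"
    using g(1) assms(2) by (intro bij_betw_trans[of g _ V f]) (auto simp: bij_betw_def)
  moreover have "(\<lambda>e. f ` e) ` X = {{(f \<circ> g) i, (f \<circ> g) ((i + 1) mod k)} | i. i < k}"
    unfolding g(2) by (auto simp: image_iff) blast+
  ultimately show ?thesis unfolding is_cycle_def by blast
qed

lemma is_complete_pairs: "is_complete k V X \<longleftrightarrow> finite V \<and> card V = k \<and> X = pairs V"
  by (simp add: is_complete_def pairs_def)

lemma pairs_image:
  assumes "inj_on f V"
  shows "(\<lambda>e. f ` e) ` pairs V = pairs (f ` V)"
proof
  show "(\<lambda>e. f ` e) ` pairs V \<subseteq> pairs (f ` V)"
    using assms by (auto simp: pairs_def card_image inj_on_subset)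
  show "pairs (f ` V) \<subseteq> (\<lambda>e. f ` e) ` pairs V"
  proof
    fix e assume "e \<in> pairs (f ` V)"
    then obtain x y where "e = {f x, f y}" "x \<in> V" "y \<in> V" "f x \<noteq> f y" by (elim pairs_cases) auto
    then have "e = f ` {x, y}" "{x, y} \<in> pairs V" by (auto intro: pair_in_pairs)
    then show "e \<in> (\<lambda>e. f ` e) ` pairs V" by blast
  qed
qed

text \<open>Moves \<open>K_3\<close> to the cycle argument, since the clique argument requires k >=
  4.\<close>

lemma triangle_is_cycle:
  assumes "is_complete 3 V X"
  shows "is_cycle 3 V X"
proof -
  obtain a b c where V: "V = {a, b, c}" "a \<noteq> b" "b \<noteq> c" "a \<noteq> c"
    using assms unfolding is_complete_def by (auto simp: card_3_iff)
  define f where "f i = (if i = 0 then a else if i = 1 then b else c)" for i :: nat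
  have three: "{0..<3::nat} = {0, 1, 2}" by auto
  have "bij_betw f {0..<3} V" unfolding bij_betw_def three V f_def using V by (auto simp: inj_on_def)
  moreover have "X = {{f i, f ((i + 1) mod 3)} | i. i < 3}"
  proof -
    have "{{f i, f ((i + 1) mod 3)} | i. i < 3} = (\<lambda>i. {f i, f ((i + 1) mod 3)}) ` {0..<3}" by auto
    also have "\<dots> = {{a, b}, {b, c}, {c, a}}" unfolding three by (simp add: f_def)
    also have "\<dots> = pairs V"
    proof
      show "{{a, b}, {b, c}, {c, a}} \<subseteq> pairs V" using V by (auto simp: pairs_def)
      show "pairs V \<subseteq> {{a, b}, {b, c}, {c, a}}"
      proof
        fix e assume "e \<in> pairs V"
        then obtain x y where "e = {x, y}" "x \<in> V" "y \<in> V" "x \<noteq> y" by (rule pairs_cases)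
        then show "e \<in> {{a, b}, {b, c}, {c, a}}" unfolding V by auto
      qed
    qed
    finally show ?thesis using assms by (simp add: is_complete_pairs)
  qed
  ultimately show ?thesis unfolding is_cycle_def by blast
qed

lemma contains_copy_subgraph:
  assumes "contains_copy M E VH EH" "subgraph V' E' VH EH"
  obtains f where "inj_on f V'" "f ` V' \<subseteq> M" "(\<lambda>e. f ` e) ` E' \<subseteq> E"
proof -
  obtain f where f: "inj_on f VH" "f ` VH \<subseteq> M" "\<forall>e\<in>EH. f ` e \<in> E"
    using assms(1) unfolding contains_copy_def by blast
  have V': "V' \<subseteq> VH" "E' \<subseteq> EH" using assms(2) by (auto simp: subgraph_def)
  show ?thesis
  proof (rule that[of f])
    show "inj_on f V'" by (rule inj_on_subset[OF f(1) V'(1)])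
  qed (use f V' in auto)
qed

theorem theorem1:
  fixes k b :: nat and VH :: "'a set" and EH :: "'a set set"
  assumes kb: "k > 0" "b > 0" "k \<ge> 4 \<or> (k = 3 \<and> b \<ge> 2)"
    and H: "graph VH EH"
    and H': "\<exists>V' E'. subgraph V' E' VH EH \<and> card V' \<ge> 2 \<and> d1 V' E' = m1 VH EH \<and>
               (is_complete k V' E' \<or> is_cycle k V' E')"
  shows "\<forall>maker_first. \<exists>c C :: real. c > 0 \<and> C > 0 \<and>
    (\<forall>p :: nat \<Rightarrow> real. (\<forall>n. 0 \<le> p n \<and> p n \<le> 1) \<longrightarrow>
       (\<forall>\<^sub>F n in sequentially. p n \<ge> C * real n powr (- 1 / m1 VH EH)) \<longrightarrow>
       (\<lambda>n. Gnp_prob n (p n) (\<lambda>E. maker_win maker_first b {0..<n} E VH EH))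
          \<longlonglongrightarrow> 1) \<and>
    (\<forall>p :: nat \<Rightarrow> real. (\<forall>n. 0 \<le> p n \<and> p n \<le> 1) \<longrightarrow>
       (\<forall>\<^sub>F n in sequentially. p n \<le> c * real n powr (- 1 / m1 VH EH)) \<longrightarrow>
       (\<lambda>n. Gnp_prob n (p n) (\<lambda>E. maker_win maker_first b {0..<n} E VH EH))
          \<longlonglongrightarrow> 0)"
proof
  fix maker_first
  have k3: "3 \<le> k" using kb by auto
  obtain V' E' where S: "subgraph V' E' VH EH" "d1 V' E' = m1 VH EH" and "is_complete k V' E' \<or> is_cycle k V' E'"
    using H' by blast
  moreover have "is_cycle k V' E'" if "is_complete k V' E'" "k = 3" using that triangle_is_cycle by blast
  ultimately have cases: "is_complete k V' E' \<and> 4 \<le> k \<or> is_cycle k V' E'" using kb by auto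
  \<comment> \<open>Both cases supply the same interface: a balanced family of copies, a capacity
    \<open>c\<close>, and pairs for sparse unions. Cliques and cycles are not distinguished
    afterwards.\<close>
  have "\<exists>(\<C> :: nat set set set) h c. copy_family \<C> k h \<and> card E' = h \<and> card V' = k \<and> c \<le> b \<and>
     (\<forall>F. conn_union \<C> F \<longrightarrow> \<not> dense_edges k h (\<Union>F) F \<longrightarrow> pair_coverable \<C> c F) \<and>
     (\<forall>f. inj_on f V' \<longrightarrow> (\<lambda>e. f ` e) ` E' \<in> \<C> \<and> \<Union>((\<lambda>e. f ` e) ` E') = f ` V')"
    using cases
  proof
    assume A: "is_complete k V' E' \<and> 4 \<le> k"
    then have V': "finite V'" "card V' = k" "E' = pairs V'" by (auto simp: is_complete_pairs)
    have cover: "pair_coverable (cliques k) 1 F" if "conn_union (cliques k) F" "\<not> dense_edges k (k choose 2) (\<Union>F) F" for F :: "nat set set"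
      by (rule clique_pairs[of k F]) (use A that in \<open>auto simp: pair_coverable_def\<close>)
    have img: "(\<lambda>e. f ` e) ` E' \<in> cliques k \<and> \<Union>((\<lambda>e. f ` e) ` E') = f ` V'" if f: "inj_on f V'" for f :: "'a \<Rightarrow> nat"
    proof -
      have "card (f ` V') = k" using V' f by (simp add: card_image)
      then show ?thesis unfolding V'(3) pairs_image[OF f]
        using cliques_iff[of k "pairs (f ` V')"] Union_pairs[of "f ` V'"] k3 by auto
    qed
    show ?thesis
      by (intro exI[of _ "cliques k"] exI[of _ "k choose 2"] exI[of _ 1] conjI allI impI)
        (use copy_family_cliques[OF k3] V' card_pairs kb cover img in auto)
  next
    assume A: "is_cycle k V' E'"
    \<comment> \<open>Capacity 2 occurs only for triangles, where b >= 2 is assumed; with this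
      choice both numerical conditions of \<open>cycle_pairs\<close> hold.\<close>
    define c where "c = (if k = 3 then 2 else 1 :: nat)"
    have c: "1 \<le> c" "c + 1 < (k - 1) * c" "2 * k < (k - 1) * (c + 2)" "c \<le> b" using kb by (auto simp: c_def)
    have cover: "pair_coverable (cycles k) c F" if F: "conn_union (cycles k) F" "\<not> dense_edges k k (\<Union>F) F" for F :: "nat set set"
    proof -
      have "finite F" using copy_family.conn_union_finite[OF copy_family_cycles[OF k3] F(1)] by simp
      then show ?thesis by (rule_tac cycle_pairs[OF k3 c(1-3) F]) (auto simp: pair_coverable_def)
    qed
    have img: "(\<lambda>e. f ` e) ` E' \<in> cycles k \<and> \<Union>((\<lambda>e. f ` e) ` E') = f ` V'" if f: "inj_on f V'" for f :: "'a \<Rightarrow> nat"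
    proof -
      have "is_cycle k (f ` V') ((\<lambda>e. f ` e) ` E')" by (rule is_cycle_image[OF A f])
      moreover from this have "\<Union>((\<lambda>e. f ` e) ` E') = f ` V'" by (rule is_cycle_Union[OF _ k3])
      ultimately show ?thesis by (simp only: cycles_def mem_Collect_eq simp_thms)
    qed
    show ?thesis
      by (intro exI[of _ "cycles k"] exI[of _ k] exI[of _ c] conjI allI impI)
        (use copy_family_cycles[OF k3] is_cycle_Union[OF A k3] c cover img in auto)
  qed
  then obtain \<C> :: "nat set set set" and h c where fam: "copy_family \<C> k h" and cards: "card E' = h" "card V' = k"
    and cb: "c \<le> b" and cover: "\<forall>F. conn_union \<C> F \<longrightarrow> \<not> dense_edges k h (\<Union>F) F \<longrightarrow> pair_coverable \<C> c F"
    and img: "\<forall>f. inj_on f V' \<longrightarrow> (\<lambda>e. f ` e) ` E' \<in> \<C> \<and> \<Union>((\<lambda>e. f ` e) ` E') = f ` V'"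
    by (elim exE conjE)
  interpret nat_copy_family \<C> k h using fam by (simp add: nat_copy_family_def)
  have m1: "m1 VH EH = real h / real (k - 1)" using S(2) cards k3 by (simp add: d1_def of_nat_diff)
  then have m1pos: "0 < m1 VH EH" using h1 k3 by simp
  have expo: "- 1 / m1 VH EH = - (real (k - 1) / h)" unfolding m1 by simp
  have "E' \<noteq> {}" using cards h1 by auto
  then have EH: "EH \<noteq> {}" using S(1) by (auto simp: subgraph_def)
  have copy: "\<exists>X\<in>\<C>. X \<subseteq> E \<and> \<Union>X \<subseteq> M" if cc: "contains_copy M E VH EH" for M E
  proof -
    obtain f where "inj_on f V'" "f ` V' \<subseteq> M" "(\<lambda>e. f ` e) ` E' \<subseteq> E"
      by (rule contains_copy_subgraph[OF cc S(1)])
    then show ?thesis using img by (intro bexI[of _ "(\<lambda>e. f ` e) ` E'"]) auto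
  qed
  obtain c0 :: real where c0: "0 < c0" "c0 \<le> 1" "2 ^ (2 ^ k) * c0 ^ h * 4 ^ (k - 1) \<le> 1 / 8"
    using small_constant by blast
  define \<gamma> where "\<gamma> = 1 / (4 * (real b + 1) * card VH)"
  define C where "C = max 1 (2 ^ (card VH + 1) * 2 / \<gamma> ^ card VH)"
  have C: "1 \<le> C" "2 ^ (card VH + 1) * 2 / \<gamma> ^ card VH \<le> C" by (auto simp: C_def)
  show "\<exists>c C :: real. c > 0 \<and> C > 0 \<and>
    (\<forall>p :: nat \<Rightarrow> real. (\<forall>n. 0 \<le> p n \<and> p n \<le> 1) \<longrightarrow>
       (\<forall>\<^sub>F n in sequentially. p n \<ge> C * real n powr (- 1 / m1 VH EH)) \<longrightarrow>
       (\<lambda>n. Gnp_prob n (p n) (\<lambda>E. maker_win maker_first b {0..<n} E VH EH))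
          \<longlonglongrightarrow> 1) \<and>
    (\<forall>p :: nat \<Rightarrow> real. (\<forall>n. 0 \<le> p n \<and> p n \<le> 1) \<longrightarrow>
       (\<forall>\<^sub>F n in sequentially. p n \<le> c * real n powr (- 1 / m1 VH EH)) \<longrightarrow>
       (\<lambda>n. Gnp_prob n (p n) (\<lambda>E. maker_win maker_first b {0..<n} E VH EH))
          \<longlonglongrightarrow> 0)"
  proof (rule exI[of _ c0], rule exI[of _ C], intro conjI allI impI)
    fix p :: "nat \<Rightarrow> real"
    assume "\<forall>n. 0 \<le> p n \<and> p n \<le> 1" and "\<forall>\<^sub>F n in sequentially. p n \<ge> C * real n powr (- 1 / m1 VH EH)"
    then show "(\<lambda>n. Gnp_prob n (p n) (\<lambda>E. maker_win maker_first b {0..<n} E VH EH)) \<longlonglongrightarrow> 1"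
      by (intro maker_wins_whp[OF H EH kb(2) m1pos \<gamma>_def C]) auto
  next
    fix p :: "nat \<Rightarrow> real"
    assume p: "\<forall>n. 0 \<le> p n \<and> p n \<le> 1" "\<forall>\<^sub>F n in sequentially. p n \<le> c0 * real n powr (- 1 / m1 VH EH)"
    show "(\<lambda>n. Gnp_prob n (p n) (\<lambda>E. maker_win maker_first b {0..<n} E VH EH)) \<longlonglongrightarrow> 0"
    proof (rule breaker_wins_whp[OF c0 _ _ _ cb])
      show "0 \<le> p n \<and> p n \<le> 1" for n using p(1) by blast
      show "\<forall>\<^sub>F n in sequentially. p n \<le> c0 * real n powr (- (real (k - 1) / h))" using p(2) unfolding expo .
      show "pair_coverable \<C> c F" if "conn_union \<C> F" "\<not> dense_edges k h (\<Union>F) F" for F using cover that by blast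
    qed (rule copy)
  qed (use c0 C in auto)
qed

end
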